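(* In the space of marked groups $\mathcal{G}_{\mathrm{WP}}$, the set of residually finite marked groups is $\boldsymbol{\Pi}_3^0$-complete. The same holds for the set of residually nilpotent marked groups and for the set of residually finitely presented marked groups.
   Context: For $k\in\mathbb{N}$, a $k$-marked group is a pair $(G,S)$ with $G$ a group and $S\in G^k$ a generating $k$-tuple, up to marked isomorphism (group isomorphisms sending the $i$-th generator to the $i$-th generator); $k$-marked groups correspond to normal subgroups of the free group $\mathbb{F}_k$. $\mathcal{G}_{\mathrm{WP}}$ is the set of all marked groups with the topological disjoint union over $k$ of the subspace topologies coming from $\{0,1\}^{\mathbb{F}_k}$; it is a Polish space. For a class $\mathcal{C}$ of groups, a group $G$ is residually-$\mathcal{C}$ if every non-identity element of $G$ has non-identity image in some quotient of $G$ belonging to $\mathcal{C}$. Residually finite, residually nilpotent, residually finitely presented correspond to $\mathcal{C}$ being the finite, nilpotent, finitely presentable groups. $\boldsymbol{\Pi}^0_3$-completeness is with respect to continuous (Wadge) reductions: a set $A$ in a Polish space $X$ is $\boldsymbol{\Pi}^0_3$-complete if $A\in\boldsymbol{\Pi}^0_3$ and for every $\boldsymbol{\Pi}^0_3$ subset $B$ of a zero-dimensional Polish space $Y$ there is a continuous $f:Y\to X$ with $B=f^{-1}(A)$. *)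

theory Defs
  imports "HOL-Analysis.Analysis" "HOL-Algebra.Generated_Groups"
begin

section \<open>Finite levels of the Borel hierarchy and completeness\<close>

text \<open>Level \<open>n + 1\<close> is obtained from level \<open>n\<close> alone rather than from all lower levels; since
  open sets of metrizable spaces are \<open>F\<^sub>\<sigma>\<close>, this is the usual hierarchy there. Level \<open>0\<close> is
  a dummy.\<close>

fun sigma0_in :: "'a topology \<Rightarrow> nat \<Rightarrow> 'a set \<Rightarrow> bool" where
  "sigma0_in X 0 = (\<lambda>A. False)"
| "sigma0_in X (Suc 0) = openin X"
| "sigma0_in X (Suc (Suc n)) =
     countable union_of (\<lambda>A. A \<subseteq> topspace X \<and> sigma0_in X (Suc n) (topspace X - A))"

definition pi0_in :: "'a topology \<Rightarrow> nat \<Rightarrow> 'a set \<Rightarrow> bool" where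
  "pi0_in X n A \<longleftrightarrow> A \<subseteq> topspace X \<and> sigma0_in X n (topspace X - A)"

lemma pi0_in_1: "pi0_in X 1 = closedin X"
  by (auto simp: pi0_in_def closedin_def fun_eq_iff)

lemma sigma0_in_2: "sigma0_in X 2 = fsigma_in X"
proof -
  have "(\<lambda>A. A \<subseteq> topspace X \<and> sigma0_in X (Suc 0) (topspace X - A)) = closedin X"
    using pi0_in_1[of X] by (simp add: pi0_in_def fun_eq_iff)
  then show ?thesis
    by (simp add: numeral_2_eq_2 fsigma_in_def)
qed

definition zero_dim_polish_space :: "'a topology \<Rightarrow> bool" where
  "zero_dim_polish_space X \<longleftrightarrow>
     completely_metrizable_space X \<and> second_countable X \<and> X dim_le 0"

text \<open>The type argument is the type carrying the test spaces \<open>Y\<close>. Statements that leave it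
  a free type variable range over all zero-dimensional Polish spaces.\<close>

definition pi0_complete_in :: "'y itself \<Rightarrow> 'a topology \<Rightarrow> nat \<Rightarrow> 'a set \<Rightarrow> bool" where
  "pi0_complete_in _ X n A \<longleftrightarrow>
     pi0_in X n A \<and>
     (\<forall>(Y :: 'y topology) B. zero_dim_polish_space Y \<and> pi0_in Y n B \<longrightarrow>
        (\<exists>f. continuous_map Y X f \<and> B = {y \<in> topspace Y. f y \<in> A}))"


section \<open>The free group on \<open>k\<close> generators\<close>

text \<open>The letter \<open>(i, True)\<close> stands for the \<open>i\<close>-th generator, \<open>(i, False)\<close> for its inverse.
  Group elements are the reduced words.\<close>

type_synonym word = "(nat \<times> bool) list"

definition inv_letter :: "nat \<times> bool \<Rightarrow> nat \<times> bool" where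
  "inv_letter a = (fst a, \<not> snd a)"

definition reduced :: "word \<Rightarrow> bool" where
  "reduced = successively (\<lambda>a b. b \<noteq> inv_letter a)"

fun lmult :: "nat \<times> bool \<Rightarrow> word \<Rightarrow> word" where
  "lmult a [] = [a]"
| "lmult a (b # w) = (if b = inv_letter a then w else a # b # w)"

definition free_group :: "nat \<Rightarrow> word monoid" where
  "free_group k =
     \<lparr>carrier = {w. reduced w \<and> fst ` set w \<subseteq> {..<k}}, mult = foldr lmult, one = []\<rparr>"

lemma inv_letter_inv_letter [simp]: "inv_letter (inv_letter a) = a"
  by (simp add: inv_letter_def)

lemma fst_inv_letter [simp]: "fst (inv_letter a) = fst a"
  by (simp add: inv_letter_def)

lemma inv_letter_neq [simp]: "inv_letter a \<noteq> a" "a \<noteq> inv_letter a"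
  by (auto simp: inv_letter_def prod_eq_iff)

lemma carrier_free_group:
  "w \<in> carrier (free_group k) \<longleftrightarrow> reduced w \<and> fst ` set w \<subseteq> {..<k}"
  by (simp add: free_group_def)

lemma mult_free_group [simp]: "u \<otimes>\<^bsub>free_group k\<^esub> v = foldr lmult u v"
  by (simp add: free_group_def)

lemma one_free_group [simp]: "\<one>\<^bsub>free_group k\<^esub> = []"
  by (simp add: free_group_def)

lemma reduced_Nil [simp]: "reduced []"
  by (simp add: reduced_def)

lemma reduced_Cons: "reduced (a # w) \<longleftrightarrow> w = [] \<or> hd w \<noteq> inv_letter a \<and> reduced w"
  by (auto simp: reduced_def successively_Cons)

lemma reduced_tl: "reduced (a # w) \<Longrightarrow> reduced w"
  by (auto simp: reduced_Cons)

lemma lmult_reduced: "reduced w \<Longrightarrow> reduced (lmult a w)"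
  by (cases w) (auto simp: reduced_Cons)

lemma lmult_inv: "reduced w \<Longrightarrow> lmult (inv_letter a) (lmult a w) = w"
proof (induction a w rule: lmult.induct)
  case (2 a b w)
  then show ?case by (cases w) (auto simp: reduced_Cons)
qed auto

lemma lmult_reduced_Cons: "reduced (a # w) \<Longrightarrow> lmult a w = a # w"
  by (cases w) (auto simp: reduced_Cons)

lemma set_lmult: "set (lmult a w) \<subseteq> insert a (set w)"
  by (cases w) auto

lemma foldr_lmult_closed:
  "reduced v \<Longrightarrow> reduced (foldr lmult u v) \<and> set (foldr lmult u v) \<subseteq> set u \<union> set v"
proof (induction u)
  case (Cons a u)
  then show ?case
    using lmult_reduced set_lmult[of a "foldr lmult u v"] by auto
qed auto

lemma foldr_lmult_lmult:
  assumes "reduced v"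
  shows "foldr lmult (lmult a u) v = lmult a (foldr lmult u v)"
proof (cases u)
  case (Cons b u')
  have "reduced (foldr lmult u' v)"
    using assms foldr_lmult_closed by blast
  then have "lmult a (lmult (inv_letter a) (foldr lmult u' v)) = foldr lmult u' v"
    using lmult_inv[of _ "inv_letter a"] by simp
  then show ?thesis
    using Cons by simp
qed auto

lemma foldr_lmult_assoc:
  "reduced w \<Longrightarrow> foldr lmult (foldr lmult u v) w = foldr lmult u (foldr lmult v w)"
  by (induction u) (auto simp: foldr_lmult_lmult)

lemma foldr_lmult_Nil: "reduced w \<Longrightarrow> foldr lmult w [] = w"
proof (induction w)
  case (Cons a w)
  then show ?case using lmult_reduced_Cons reduced_tl by simp
qed auto

lemma foldr_lmult_left_inv:
  "reduced v \<Longrightarrow> foldr lmult (rev (map inv_letter w)) (foldr lmult w v) = v"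
proof (induction w)
  case (Cons a w)
  then show ?case using lmult_inv foldr_lmult_closed by simp
qed auto

lemma group_free_group: "group (free_group k)"
proof (rule groupI)
  fix u v assume "u \<in> carrier (free_group k)" "v \<in> carrier (free_group k)"
  then show "u \<otimes>\<^bsub>free_group k\<^esub> v \<in> carrier (free_group k)"
    using foldr_lmult_closed[of v u] by (fastforce simp: carrier_free_group)
next
  fix w assume w: "w \<in> carrier (free_group k)"
  define z where "z = foldr lmult (rev (map inv_letter w)) []"
  have "z \<in> carrier (free_group k)"
    using w foldr_lmult_closed[of "[]" "rev (map inv_letter w)"]
    by (fastforce simp: carrier_free_group z_def)
  moreover have "foldr lmult z w = []"
    using w foldr_lmult_assoc[of w "rev (map inv_letter w)" "[]"]
      foldr_lmult_left_inv[of "[]" w] foldr_lmult_Nil[of w]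
    by (simp add: z_def carrier_free_group)
  ultimately show "\<exists>y\<in>carrier (free_group k). y \<otimes>\<^bsub>free_group k\<^esub> w = \<one>\<^bsub>free_group k\<^esub>"
    by auto
qed (auto simp: carrier_free_group foldr_lmult_assoc)


section \<open>Marked groups\<close>

definition marked_group :: "nat \<Rightarrow> ('a, 'b) monoid_scheme \<Rightarrow> 'a list \<Rightarrow> bool" where
  "marked_group k G S \<longleftrightarrow>
     group G \<and> length S = k \<and> set S \<subseteq> carrier G \<and> generate G (set S) = carrier G"

definition letter_value :: "('a, 'b) monoid_scheme \<Rightarrow> 'a list \<Rightarrow> nat \<times> bool \<Rightarrow> 'a" where
  "letter_value G S a = (if snd a then S ! fst a else inv\<^bsub>G\<^esub> (S ! fst a))"

definition word_value :: "('a, 'b) monoid_scheme \<Rightarrow> 'a list \<Rightarrow> word \<Rightarrow> 'a" where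
  "word_value G S w = foldr (\<lambda>a g. letter_value G S a \<otimes>\<^bsub>G\<^esub> g) w \<one>\<^bsub>G\<^esub>"

definition relations :: "('a, 'b) monoid_scheme \<Rightarrow> 'a list \<Rightarrow> word set" where
  "relations G S = kernel (free_group (length S)) G (word_value G S)"

text \<open>The marked group corresponding to a normal subgroup \<open>N\<close> of \<open>free_group k\<close> is
  \<open>free_group k Mod N\<close> with the following marking.\<close>

definition std_marking :: "nat \<Rightarrow> word set \<Rightarrow> word set list" where
  "std_marking k N = map (\<lambda>i. N #>\<^bsub>free_group k\<^esub> [(i, True)]) [0..<k]"

text \<open>Points are pairs \<open>(k, \<chi>)\<close> with \<open>\<chi>\<close> the characteristic function on \<open>free_group k\<close> of
  a normal subgroup. The lemmas \<open>relations_normal\<close>, \<open>marked_group_std_marking\<close>,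
  \<open>relations_std_marking\<close> and \<open>marked_iso_iff\<close> below show that these are exactly the marked
  groups up to marked isomorphism.\<close>

definition marked_point :: "nat \<Rightarrow> word set \<Rightarrow> nat \<times> (word \<Rightarrow> bool)" where
  "marked_point k N = (k, restrict (\<lambda>w. w \<in> N) (carrier (free_group k)))"

definition marked_groups :: "(nat \<times> (word \<Rightarrow> bool)) topology" where
  "marked_groups =
     sum_topology (\<lambda>k.
       subtopology (product_topology (\<lambda>_. discrete_topology UNIV) (carrier (free_group k)))
         {snd (marked_point k N) | N. N \<lhd> free_group k}) UNIV"

definition marked_groups_with :: "(word set monoid \<Rightarrow> bool) \<Rightarrow> (nat \<times> (word \<Rightarrow> bool)) set" where
  "marked_groups_with P = {marked_point k N | k N. N \<lhd> free_group k \<and> P (free_group k Mod N)}"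

lemma topspace_marked_groups:
  "topspace marked_groups = {marked_point k N | k N. N \<lhd> free_group k}"
  by (auto simp: marked_groups_def marked_point_def)

lemma marked_point_inject:
  assumes "M \<lhd> free_group k" "N \<lhd> free_group l" "marked_point k M = marked_point l N"
  shows "k = l \<and> M = N"
proof -
  have kl: "k = l" and eq: "\<And>w. w \<in> carrier (free_group k) \<Longrightarrow> w \<in> M \<longleftrightarrow> w \<in> N"
    using assms(3) by (auto simp: marked_point_def fun_eq_iff split: if_splits)
  moreover have "M \<subseteq> carrier (free_group k)" "N \<subseteq> carrier (free_group k)"
    using assms(1,2) kl by (simp_all add: normal_imp_subgroup subgroup.subset)
  ultimately show ?thesis by blast
qed

context group
begin

lemma letter_value_closed:
  "set S \<subseteq> carrier G \<Longrightarrow> fst a < length S \<Longrightarrow> letter_value G S a \<in> carrier G"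
  using nth_mem[of "fst a" S] by (simp add: letter_value_def subset_iff)

lemma word_value_closed:
  "set S \<subseteq> carrier G \<Longrightarrow> fst ` set w \<subseteq> {..<length S} \<Longrightarrow> word_value G S w \<in> carrier G"
  by (induction w) (auto simp: word_value_def letter_value_closed)

lemma word_value_lmult:
  assumes S: "set S \<subseteq> carrier G" and "fst ` set (a # w) \<subseteq> {..<length S}"
  shows "word_value G S (lmult a w) = letter_value G S a \<otimes> word_value G S w"
proof (cases "\<exists>w'. w = inv_letter a # w'")
  case True
  then obtain w' where w: "w = inv_letter a # w'" by blast
  have "word_value G S w' \<in> carrier G"
    using assms w by (intro word_value_closed) auto
  moreover have "S ! fst a \<in> carrier G"
    using assms by auto
  ultimately have
    "word_value G S w' = letter_value G S a \<otimes> (letter_value G S (inv_letter a) \<otimes> word_value G S w')"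
    by (auto simp: letter_value_def inv_letter_def m_assoc[symmetric])
  then show ?thesis
    using w by (simp add: word_value_def)
next
  case False
  then have "lmult a w = a # w" by (cases w) auto
  then show ?thesis by (simp add: word_value_def)
qed

lemma word_value_foldr:
  assumes S: "set S \<subseteq> carrier G" and "fst ` set u \<subseteq> {..<length S}"
    and v: "reduced v" "fst ` set v \<subseteq> {..<length S}"
  shows "word_value G S (foldr lmult u v) = word_value G S u \<otimes> word_value G S v"
  using assms(2)
proof (induction u)
  case Nil
  then show ?case using word_value_closed[OF S v(2)] by (simp add: word_value_def)
next
  case (Cons a u)
  have "fst ` set (foldr lmult u v) \<subseteq> {..<length S}"
    using foldr_lmult_closed[OF v(1), of u] v(2) Cons.prems by fastforce
  then have "word_value G S (foldr lmult (a # u) v) =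
      letter_value G S a \<otimes> (word_value G S u \<otimes> word_value G S v)"
    using Cons word_value_lmult[OF S, of a "foldr lmult u v"] by simp
  also have "\<dots> = (letter_value G S a \<otimes> word_value G S u) \<otimes> word_value G S v"
    using Cons.prems v S by (simp add: m_assoc letter_value_closed word_value_closed)
  finally show ?case by (simp add: word_value_def)
qed

lemma word_value_group_hom:
  assumes "set S \<subseteq> carrier G"
  shows "group_hom (free_group (length S)) G (word_value G S)"
proof -
  have "word_value G S \<in> hom (free_group (length S)) G"
    using assms
    using word_value_closed[OF assms] word_value_foldr[OF assms]
    by (simp add: hom_def carrier_free_group)
  then show ?thesis
    by (simp add: group_hom_def group_hom_axioms_def group_free_group is_group)
qed

lemma word_value_gen: "set S \<subseteq> carrier G \<Longrightarrow> i < length S \<Longrightarrow> word_value G S [(i, True)] = S ! i"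
  by (simp add: word_value_def letter_value_def subset_iff)

lemma word_value_surj:
  assumes "marked_group k G S"
  shows "word_value G S ` carrier (free_group k) = carrier G"
proof -
  have S: "set S \<subseteq> carrier G" "length S = k" "generate G (set S) = carrier G"
    using assms by (auto simp: marked_group_def)
  interpret h: group_hom "free_group k" G "word_value G S"
    using word_value_group_hom S by blast
  have "set S \<subseteq> word_value G S ` carrier (free_group k)"
  proof
    fix s assume "s \<in> set S"
    then obtain i where i: "i < length S" "s = S ! i"
      by (auto simp: in_set_conv_nth)
    then have "s = word_value G S [(i, True)]" "[(i, True)] \<in> carrier (free_group k)"
      using S word_value_gen by (auto simp: carrier_free_group reduced_Cons)
    then show "s \<in> word_value G S ` carrier (free_group k)"
      by blast
  qed
  then have "generate G (set S) \<subseteq> word_value G S ` carrier (free_group k)"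
    by (intro generate_subgroup_incl h.img_is_subgroup)
  then show ?thesis
    using S(3) by auto
qed

end

lemma relations_normal:
  assumes "marked_group k G S"
  shows "relations G S \<lhd> free_group k"
proof -
  interpret group G using assms by (simp add: marked_group_def)
  interpret h: group_hom "free_group k" G "word_value G S"
    using word_value_group_hom assms by (auto simp: marked_group_def)
  show ?thesis
    using h.normal_kernel assms by (simp add: relations_def marked_group_def)
qed

lemma word_value_std_marking:
  assumes "N \<lhd> free_group k" "w \<in> carrier (free_group k)"
  shows "word_value (free_group k Mod N) (std_marking k N) w = N #>\<^bsub>free_group k\<^esub> w"
proof -
  interpret N: normal N "free_group k" by fact
  have letter: "[a] \<in> carrier (free_group k)" if "fst a < k" for a
    using that by (simp add: carrier_free_group reduced_Cons)
  have inv: "inv\<^bsub>free_group k\<^esub> [(i, True)] = [(i, False)]" if "i < k" for i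
    using that letter[of "(i, True)"] letter[of "(i, False)"]
    by (intro N.inv_equality) (auto simp: inv_letter_def)
  have val: "letter_value (free_group k Mod N) (std_marking k N) a = N #>\<^bsub>free_group k\<^esub> [a]"
    if "fst a < k" for a
  proof (cases a)
    case (Pair i b)
    then have i: "i < k" using that by simp
    then have mem: "[(i, True)] \<in> carrier (free_group k)" using letter by simp
    then have "N #>\<^bsub>free_group k\<^esub> [(i, True)] \<in> carrier (free_group k Mod N)"
      by (auto simp: carrier_FactGroup)
    then have "inv\<^bsub>free_group k Mod N\<^esub> (N #>\<^bsub>free_group k\<^esub> [(i, True)]) =
        N #>\<^bsub>free_group k\<^esub> [(i, False)]"
      using N.inv_FactGroup N.rcos_inv[OF mem] inv[OF i] by simp
    then show ?thesis
      using Pair i by (simp add: letter_value_def std_marking_def)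
  qed
  show ?thesis
    using assms(2)
  proof (induction w)
    case Nil
    then show ?case
      using N.coset_mult_one[OF N.subset] by (simp add: word_value_def)
  next
    case (Cons a w)
    then have a: "fst a < k" and w: "w \<in> carrier (free_group k)" and r: "reduced (a # w)"
      using reduced_tl[of a w] by (simp_all add: carrier_free_group)
    have "word_value (free_group k Mod N) (std_marking k N) (a # w) =
        (N #>\<^bsub>free_group k\<^esub> [a]) <#>\<^bsub>free_group k\<^esub> (N #>\<^bsub>free_group k\<^esub> w)"
      using Cons.IH[OF w] val[OF a] by (simp add: word_value_def)
    also have "\<dots> = N #>\<^bsub>free_group k\<^esub> ([a] \<otimes>\<^bsub>free_group k\<^esub> w)"
      using N.rcos_sum letter[OF a] w by blast
    also have "[a] \<otimes>\<^bsub>free_group k\<^esub> w = a # w"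
      using lmult_reduced_Cons[OF r] by simp
    finally show ?case .
  qed
qed

lemma relations_std_marking:
  assumes "N \<lhd> free_group k"
  shows "relations (free_group k Mod N) (std_marking k N) = N"
proof -
  interpret N: normal N "free_group k" by fact
  have "w \<in> N \<longleftrightarrow> N #>\<^bsub>free_group k\<^esub> w = N" if "w \<in> carrier (free_group k)" for w
    using that N.rcos_self[OF that N.subgroup_axioms] N.rcos_const[OF group_free_group, of w]
    by blast
  then show ?thesis
    using N.subset word_value_std_marking[OF assms]
    by (auto simp: relations_def kernel_def std_marking_def)
qed

lemma marked_group_std_marking:
  assumes "N \<lhd> free_group k"
  shows "marked_group k (free_group k Mod N) (std_marking k N)"
proof -
  interpret N: normal N "free_group k" by fact
  interpret Q: group "free_group k Mod N" by (rule N.factorgroup_is_group)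
  let ?Q = "free_group k Mod N" and ?S = "std_marking k N"
  have S: "set ?S \<subseteq> carrier ?Q" "length ?S = k"
    by (auto simp: std_marking_def carrier_FactGroup carrier_free_group reduced_Cons)
  have "word_value ?Q ?S w \<in> generate ?Q (set ?S)" if "fst ` set w \<subseteq> {..<k}" for w
    using that
  proof (induction w)
    case (Cons a w)
    then have "?S ! fst a \<in> set ?S" using S(2) by auto
    then have "letter_value ?Q ?S a \<in> generate ?Q (set ?S)"
      by (auto simp: letter_value_def intro: generate.incl generate.inv)
    moreover have "word_value ?Q ?S w \<in> generate ?Q (set ?S)"
      using Cons by simp
    ultimately show ?case
      using generate.eng[of _ ?Q "set ?S"] by (simp add: word_value_def)
  qed (simp add: word_value_def generate.one[of ?Q, simplified])
  then have "carrier ?Q \<subseteq> generate ?Q (set ?S)"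
    using word_value_std_marking[OF assms]
    by (force simp: carrier_FactGroup carrier_free_group)
  then show ?thesis
    using S Q.generate_incl Q.is_group by (auto simp: marked_group_def)
qed

lemma marked_iso_iff:
  assumes "marked_group k G S" "marked_group k H T"
  shows "(\<exists>\<phi>\<in>iso G H. map \<phi> S = T) \<longleftrightarrow> relations G S = relations H T"
proof
  have S: "set S \<subseteq> carrier G" "length S = k" and T: "set T \<subseteq> carrier H" "length T = k"
    using assms by (auto simp: marked_group_def)
  interpret G: group G using assms by (simp add: marked_group_def)
  interpret H: group H using assms by (simp add: marked_group_def)
  interpret g: group_hom "free_group k" G "word_value G S"
    using G.word_value_group_hom S by blast
  interpret h: group_hom "free_group k" H "word_value H T"
    using H.word_value_group_hom T by blast
  {
    assume "\<exists>\<phi>\<in>iso G H. map \<phi> S = T"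
    then obtain \<phi> where \<phi>: "\<phi> \<in> iso G H" "map \<phi> S = T" by blast
    interpret p: group_hom G H \<phi>
      using \<phi> by (simp add: group_hom_def group_hom_axioms_def iso_def)
    have inj: "inj_on \<phi> (carrier G)"
      using \<phi> by (simp add: iso_def bij_betw_def)
    have letter: "\<phi> (letter_value G S a) = letter_value H T a" if "fst a < k" for a
    proof -
      have "S ! fst a \<in> carrier G" "\<phi> (S ! fst a) = T ! fst a"
        using that S nth_mem[of "fst a" S] \<phi>(2) by auto
      then show ?thesis
        using p.hom_inv by (simp add: letter_value_def)
    qed
    have val: "\<phi> (word_value G S w) = word_value H T w" if "fst ` set w \<subseteq> {..<k}" for w
      using that
    proof (induction w)
      case (Cons a w)
      then have "letter_value G S a \<in> carrier G" "word_value G S w \<in> carrier G"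
        using S G.letter_value_closed G.word_value_closed by auto
      then show ?case
        using Cons letter by (simp add: word_value_def)
    qed (simp add: word_value_def)
    have "word_value G S w = \<one>\<^bsub>G\<^esub> \<longleftrightarrow> word_value H T w = \<one>\<^bsub>H\<^esub>"
      if w: "w \<in> carrier (free_group k)" for w
    proof -
      have "\<phi> (word_value G S w) = word_value H T w"
        using val w by (simp add: carrier_free_group)
      then show ?thesis
        using inj_onD[OF inj, of "word_value G S w" "\<one>\<^bsub>G\<^esub>"] w by auto
    qed
    then show "relations G S = relations H T"
      using S(2) T(2) by (auto simp: relations_def kernel_def)
  next
    assume rel: "relations G S = relations H T"
    have eq: "word_value G S u = word_value G S v \<longleftrightarrow> word_value H T u = word_value H T v"
      if u: "u \<in> carrier (free_group k)" and v: "v \<in> carrier (free_group k)" for u v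
    proof -
      let ?w = "u \<otimes>\<^bsub>free_group k\<^esub> inv\<^bsub>free_group k\<^esub> v"
      have w: "?w \<in> carrier (free_group k)"
        using u v g.G.m_closed g.G.inv_closed by blast
      have "word_value G S ?w = \<one>\<^bsub>G\<^esub> \<longleftrightarrow> word_value H T ?w = \<one>\<^bsub>H\<^esub>"
        using rel w S(2) T(2) by (auto simp: relations_def kernel_def)
      moreover have "word_value G S ?w = word_value G S u \<otimes>\<^bsub>G\<^esub> inv\<^bsub>G\<^esub> word_value G S v"
        using u v g.G.inv_closed g.hom_mult g.hom_inv by metis
      moreover have "word_value H T ?w = word_value H T u \<otimes>\<^bsub>H\<^esub> inv\<^bsub>H\<^esub> word_value H T v"
        using u v g.G.inv_closed h.hom_mult h.hom_inv by metis
      ultimately show ?thesis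
        using u v G.inv_solve_right'[of "\<one>\<^bsub>G\<^esub>"] H.inv_solve_right'[of "\<one>\<^bsub>H\<^esub>"]
        by (metis G.l_one G.one_closed H.l_one H.one_closed g.hom_closed h.hom_closed)
    qed
    define \<psi> where "\<psi> x = inv_into (carrier (free_group k)) (word_value G S) x" for x
    define \<phi> where "\<phi> x = word_value H T (\<psi> x)" for x
    have surjG: "word_value G S ` carrier (free_group k) = carrier G"
      and surjH: "word_value H T ` carrier (free_group k) = carrier H"
      using G.word_value_surj H.word_value_surj assms by auto
    have \<psi>: "\<psi> x \<in> carrier (free_group k)" "word_value G S (\<psi> x) = x" if "x \<in> carrier G" for x
      using that surjG by (auto simp: \<psi>_def inv_into_into f_inv_into_f)
    have \<phi>: "\<phi> (word_value G S w) = word_value H T w" if "w \<in> carrier (free_group k)" for w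
      using that eq \<psi> unfolding \<phi>_def by (metis g.hom_closed)
    have "\<phi> \<in> hom G H"
    proof (rule homI)
      fix x y assume x: "x \<in> carrier G" and y: "y \<in> carrier G"
      show "\<phi> x \<in> carrier H" using x \<psi> by (simp add: \<phi>_def)
      have "\<phi> (x \<otimes>\<^bsub>G\<^esub> y) = \<phi> (word_value G S (\<psi> x \<otimes>\<^bsub>free_group k\<^esub> \<psi> y))"
        using x y \<psi> g.hom_mult by metis
      also have "\<dots> = word_value H T (\<psi> x \<otimes>\<^bsub>free_group k\<^esub> \<psi> y)"
        using x y \<psi> \<phi> g.G.m_closed by blast
      also have "\<dots> = \<phi> x \<otimes>\<^bsub>H\<^esub> \<phi> y"
        using x y \<psi> h.hom_mult by (metis \<phi>_def)
      finally show "\<phi> (x \<otimes>\<^bsub>G\<^esub> y) = \<phi> x \<otimes>\<^bsub>H\<^esub> \<phi> y" .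
    qed
    moreover have "inj_on \<phi> (carrier G)"
      using eq \<psi> by (metis \<phi>_def inj_onI)
    moreover have "\<phi> ` carrier G = carrier H"
      using surjG surjH \<phi> by (metis image_cong image_image)
    moreover have "map \<phi> S = T"
    proof (rule nth_equalityI)
      fix i assume "i < length (map \<phi> S)"
      then have i: "i < k" using S by simp
      then have "[(i, True)] \<in> carrier (free_group k)"
        by (simp add: carrier_free_group reduced_Cons)
      then show "map \<phi> S ! i = T ! i"
        using \<phi>[of "[(i, True)]"] i S T G.word_value_gen H.word_value_gen by simp
    qed (use S T in simp)
    ultimately show "\<exists>\<phi>\<in>iso G H. map \<phi> S = T"
      by (auto simp: iso_def bij_betw_def)
  }
qed


section \<open>Residual properties\<close>

definition residually :: "('a set monoid \<Rightarrow> bool) \<Rightarrow> 'a monoid \<Rightarrow> bool" where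
  "residually C G \<longleftrightarrow>
     (\<forall>g \<in> carrier G. g \<noteq> \<one>\<^bsub>G\<^esub> \<longrightarrow>
        (\<exists>N. N \<lhd> G \<and> C (G Mod N) \<and> N #>\<^bsub>G\<^esub> g \<noteq> \<one>\<^bsub>G Mod N\<^esub>))"

definition finite_group :: "'a monoid \<Rightarrow> bool" where
  "finite_group G \<longleftrightarrow> group G \<and> finite (carrier G)"

primrec lower_central :: "'a monoid \<Rightarrow> nat \<Rightarrow> 'a set" where
  "lower_central G 0 = carrier G"
| "lower_central G (Suc n) = generate G
     {x \<otimes>\<^bsub>G\<^esub> y \<otimes>\<^bsub>G\<^esub> inv\<^bsub>G\<^esub> x \<otimes>\<^bsub>G\<^esub> inv\<^bsub>G\<^esub> y | x y. x \<in> lower_central G n \<and> y \<in> carrier G}"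

definition nilpotent_group :: "'a monoid \<Rightarrow> bool" where
  "nilpotent_group G \<longleftrightarrow> group G \<and> (\<exists>n. lower_central G n = {\<one>\<^bsub>G\<^esub>})"

definition normal_closure :: "'a monoid \<Rightarrow> 'a set \<Rightarrow> 'a set" where
  "normal_closure G R = \<Inter>{N. N \<lhd> G \<and> R \<subseteq> N}"

definition finitely_presentable :: "'a monoid \<Rightarrow> bool" where
  "finitely_presentable G \<longleftrightarrow>
     group G \<and>
     (\<exists>m R. finite R \<and> R \<subseteq> carrier (free_group m) \<and>
        G \<cong> free_group m Mod normal_closure (free_group m) R)"

end

theory Submission
  imports Defs "HOL-Library.Poly_Mapping" "HOL-Library.Z2"
begin

text \<open>Upper bound: \<open>F / N\<close> is residually in one of the three classes iff every \<open>w \<notin> N\<close> is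
  avoided by some normal \<open>M \<supseteq> N\<close> of a certain kind. Finite and finitely presentable quotients
  correspond to countably many \<open>M\<close>, and \<open>N \<subseteq> M\<close> is a closed condition on \<open>N\<close>; for nilpotent
  quotients the condition is \<open>w \<notin> N \<gamma>\<^sub>c\<close> for some \<open>c\<close>, again closed for each \<open>c\<close>.

  Hardness: one reduction serves for all three classes. Let \<open>G\<close> be the group of matrices
  \<open>[[1, f, h], [0, x\<^sup>n, g], [0, 0, 1]]\<close> over \<open>R = \<int>/2[x, 1/x]\<close>, generated by \<open>a = 1 + e\<^sub>1\<^sub>2\<close>,
  \<open>b = 1 + e\<^sub>2\<^sub>3\<close> and \<open>t = diag(1, x, 1)\<close>. Its central subgroup \<open>1 + R e\<^sub>1\<^sub>3\<close> has the basis
  \<open>z\<^sub>i = [a, t\<^sup>i b t\<^sup>-\<^sup>i]\<close>, and for \<open>K \<subseteq> \<int>\<close> we divide by the span of the \<open>z\<^sub>i\<close> with \<open>i \<in> K\<close>. In each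
  finite, nilpotent or finitely presented quotient of \<open>G\<close> the images of the \<open>z\<^sub>i\<close> are periodic in \<open>i\<close>,
  so \<open>z\<^sub>i\<close> dies in all of them if \<open>K\<close> accumulates at \<open>i\<close> profinitely. Conversely, the quotients of
  \<open>G\<close> obtained by imposing \<open>x\<^sup>d = 1\<close> with \<open>d\<close> a power of two are finite and nilpotent, and they separate
  points if \<open>K\<close> is closed in the 2-adic topology. A \<open>\<Pi>\<^sup>0\<^sub>3\<close> set is given by infinitely many columns that
  all have to be finite; the \<open>n\<close>-th column is encoded by a sequence of exponents tending to \<open>2\<^sup>n\<close>.\<close>

section \<open>Free groups and residual properties\<close>

text \<open>Metabelian matrices alone could not carry such a reduction: a finitely generated
  metabelian group has only countably many normal subgroups. The central subgroup
  \<open>1 + R e_13\<close> is a vector space of infinite dimension all of whose subspaces are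
  normal, so \<open>K\<close> can be chosen freely. All periodicity comes from one kind of
  certificate: an element of the kernel whose matrix has \<open>t\<close>-exponent 0,
  \<open>f = 0\<close> and \<open>g = x^d - 1\<close>. Commutators of its
  \<open>t\<close>-conjugates with \<open>a\<close> identify \<open>z_(j+d)\<close> with
  \<open>z_j\<close> for all \<open>j\<close>. In a nilpotent quotient the certificate is
  \<open>[b, t, ..., t]\<close>, because \<open>(1 - x)^(2^r) = 1 - x^(2^r)\<close> in
  characteristic two; the same identity makes the quotients by \<open>x^d = 1\<close> nilpotent.
  Finite groups are finitely presentable, so the finitely presented quotients remain, where the
  period may be any positive integer. Hence the exponents of a column have to converge modulo every
  integer, which factorials achieve, while powers of two are enough to separate points.
  Characteristic two also gives the part of \<open>t\<close>-exponent 0 exponent 4, which rules out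
  HNN extensions that are not ascending.\<close>

lemma letter_closed: "i < k \<Longrightarrow> [(i, b)] \<in> carrier (free_group k)"
  by (simp add: carrier_free_group reduced_Cons)

lemma free_group_induct [consumes 1, case_names Nil Cons]:
  assumes "w \<in> carrier (free_group k)" and "P []"
    and "\<And>i b w. \<lbrakk>i < k; w \<in> carrier (free_group k); [(i, b)] \<otimes>\<^bsub>free_group k\<^esub> w = (i, b) # w; P w\<rbrakk>
      \<Longrightarrow> P ((i, b) # w)"
  shows "P w"
  using assms(1)
proof (induction w)
  case (Cons a w)
  obtain i b where a: "a = (i, b)" by force
  have w: "w \<in> carrier (free_group k)" and r: "reduced (a # w)" and i: "i < k"
    using Cons.prems reduced_tl[of a w] a by (auto simp: carrier_free_group)
  then show ?case
    using assms(3)[OF i w] Cons.IH lmult_reduced_Cons[OF r] a by simp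
qed (rule assms(2))

lemma inv_letter_free_group:
  "i < k \<Longrightarrow> inv\<^bsub>free_group k\<^esub> [(i, b)] = [(i, \<not> b)]"
  using group.inv_equality[OF group_free_group[of k], of "[(i, \<not> b)]" "[(i, b)]"]
  by (simp add: letter_closed inv_letter_def)

lemma free_group_hom_eqI:
  assumes "group_hom (free_group k) H f" "group_hom (free_group k) H g"
    and "\<And>i. i < k \<Longrightarrow> f [(i, True)] = g [(i, True)]"
    and "w \<in> carrier (free_group k)"
  shows "f w = g w"
proof -
  interpret f: group_hom "free_group k" H f by fact
  interpret g: group_hom "free_group k" H g by fact
  have letter: "f [(i, b)] = g [(i, b)]" if i: "i < k" for i b
  proof (cases b)
    case False
    have "f (inv\<^bsub>free_group k\<^esub> [(i, True)]) = g (inv\<^bsub>free_group k\<^esub> [(i, True)])"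
      using assms(3)[OF i] letter_closed[OF i] by simp
    then show ?thesis using inv_letter_free_group[OF i, of True] False by simp
  qed (use assms(3) i in simp)
  show ?thesis
    using assms(4)
  proof (induction rule: free_group_induct)
    case Nil
    then show ?case using f.hom_one g.hom_one by simp
  next
    case (Cons i b w)
    then have "f ((i, b) # w) = f [(i, b)] \<otimes>\<^bsub>H\<^esub> f w" "g ((i, b) # w) = g [(i, b)] \<otimes>\<^bsub>H\<^esub> g w"
      using f.hom_mult[OF letter_closed, of i w b] g.hom_mult[OF letter_closed, of i w b] by auto
    then show ?case using Cons letter by simp
  qed
qed

section \<open>Homomorphisms, cosets and the correspondence theorem\<close>

lemma (in group) word_value_hom:
  "set S \<subseteq> carrier G \<Longrightarrow> length S = k \<Longrightarrow> group_hom (free_group k) G (word_value G S)"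
  using word_value_group_hom by blast

lemma (in group_hom) normal_vimage:
  assumes "N \<lhd> H"
  shows "{x \<in> carrier G. h x \<in> N} \<lhd> G"
proof -
  interpret N: normal N H by fact
  have "subgroup {x \<in> carrier G. h x \<in> N} G"
    by (rule G.subgroupI) (auto intro: N.one_closed)
  then show ?thesis
    by (rule G.normal_invI) (simp add: N.inv_op_closed2)
qed

lemma (in group_hom) surj_normal_image:
  assumes "h ` carrier G = carrier H" "N \<lhd> G"
  shows "h ` N \<lhd> H"
proof -
  interpret N: normal N G by fact
  have sub: "subgroup (h ` N) H"
    using subgroup_img_is_subgroup N.subgroup_axioms by blast
  show ?thesis
  proof (rule H.normal_invI[OF sub])
    fix x y assume "x \<in> carrier H" "y \<in> h ` N"
    then obtain g n where g: "g \<in> carrier G" "x = h g" and n: "n \<in> N" "y = h n"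
      using assms(1) by blast
    then have "x \<otimes>\<^bsub>H\<^esub> y \<otimes>\<^bsub>H\<^esub> inv\<^bsub>H\<^esub> x = h (g \<otimes> n \<otimes> inv g)"
      using N.mem_carrier by simp
    then show "x \<otimes>\<^bsub>H\<^esub> y \<otimes>\<^bsub>H\<^esub> inv\<^bsub>H\<^esub> x \<in> h ` N"
      using N.inv_op_closed2 g n by blast
  qed
qed

context group
begin

lemma rcos_eq_subgroup_iff:
  "subgroup N G \<Longrightarrow> x \<in> carrier G \<Longrightarrow> N #> x = N \<longleftrightarrow> x \<in> N"
  using coset_join1 coset_join2 by blast

lemma rcos_eq_iff:
  assumes "N \<lhd> G" "x \<in> carrier G" "y \<in> carrier G"
  shows "N #> x = N #> y \<longleftrightarrow> x \<otimes> inv y \<in> N"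
proof -
  have N: "subgroup N G" using assms(1) by (rule normal_imp_subgroup)
  have "N #> x = N #> y \<longleftrightarrow> x \<in> N #> y"
    using rcos_self[OF assms(2) N] repr_independence[OF _ assms(3) N, of x] by auto
  then show ?thesis
    using subgroup.rcos_module[OF N is_group assms(3,2)] by simp
qed

lemma normal_hom_Mod:
  assumes "N \<lhd> G"
  shows "group_hom G (G Mod N) (\<lambda>x. N #> x)"
  using normal.r_coset_hom_Mod[OF assms] normal.factorgroup_is_group[OF assms]
  by (simp add: group_hom_def group_hom_axioms_def is_group)

lemma kernel_Mod: 
  assumes "N \<lhd> G"
  shows "kernel G (G Mod N) (\<lambda>x. N #> x) = N"
proof (rule Set.set_eqI)
  fix x
  show "x \<in> kernel G (G Mod N) (\<lambda>x. N #> x) \<longleftrightarrow> x \<in> N"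
    unfolding kernel_def
    using rcos_eq_subgroup_iff[of N x] normal_imp_subgroup[OF assms] subgroup.subset[of N G]
    by (cases "x \<in> carrier G") auto
qed

end

lemma normal_closure_normal:
  assumes "group G" "R \<subseteq> carrier G"
  shows "normal_closure G R \<lhd> G"
proof -
  interpret group G by fact
  have sub: "subgroup (normal_closure G R) G"
    unfolding normal_closure_def
    by (rule subgroups_Inter) (use assms normal_self normal_imp_subgroup in auto)
  then show ?thesis
    by (rule normal_invI) (auto simp: normal_closure_def intro: normal.inv_op_closed2)
qed

lemma normal_closure_incl: "R \<subseteq> normal_closure G R"
  by (auto simp: normal_closure_def)

lemma normal_closure_minimal: "N \<lhd> G \<Longrightarrow> R \<subseteq> N \<Longrightarrow> normal_closure G R \<subseteq> N"
  by (auto simp: normal_closure_def)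

text \<open>Correspondence theorem: a quotient of \<open>F Mod N\<close> is a quotient of
  \<open>F\<close> whose kernel contains \<open>N\<close>. Stating the property through kernels in
  the fixed group \<open>F\<close> removes the iterated quotients and makes the relevant
  \<open>M\<close> countable objects or closed conditions later.\<close>

lemma residually_Mod_iff:
  fixes F :: "'a monoid" and C :: "'a set set monoid \<Rightarrow> bool"
  assumes F: "group F" and N: "N \<lhd> F"
    and C: "\<And>Q h. \<lbrakk>group_hom F Q h; h ` carrier F = carrier Q\<rbrakk> \<Longrightarrow> C Q \<longleftrightarrow> D (kernel F Q h)"
  shows "residually C (F Mod N) \<longleftrightarrow>
    (\<forall>w \<in> carrier F - N. \<exists>M. M \<lhd> F \<and> N \<subseteq> M \<and> w \<notin> M \<and> D M)"
proof -
  interpret F: group F by fact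
  let ?Q = "F Mod N"
  interpret \<pi>: group_hom F ?Q "\<lambda>x. N #>\<^bsub>F\<^esub> x" using F.normal_hom_Mod[OF N] .
  have surj: "(\<lambda>x. N #>\<^bsub>F\<^esub> x) ` carrier F = carrier ?Q"
    by (simp add: carrier_FactGroup)
  have Nsub: "subgroup N F" using N by (rule normal_imp_subgroup)
  have N_one: "N #>\<^bsub>F\<^esub> x = N" if "x \<in> N" for x
    using that F.rcos_eq_subgroup_iff[OF Nsub] subgroup.subset[OF Nsub] by blast
  have pull: "C (?Q Mod K) \<longleftrightarrow> D {w \<in> carrier F. N #>\<^bsub>F\<^esub> w \<in> K}" if K: "K \<lhd> ?Q" for K
  proof -
    interpret \<kappa>: group_hom ?Q "?Q Mod K" "\<lambda>x. K #>\<^bsub>?Q\<^esub> x" using \<pi>.H.normal_hom_Mod[OF K] .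
    let ?h = "\<lambda>w. K #>\<^bsub>?Q\<^esub> (N #>\<^bsub>F\<^esub> w)"
    have "group_hom F (?Q Mod K) ?h"
      using \<pi>.group_hom_axioms \<kappa>.group_hom_axioms
      by (auto simp: group_hom_def group_hom_axioms_def hom_def Pi_iff)
    moreover have "?h ` carrier F = carrier (?Q Mod K)"
      using surj by (auto simp: carrier_FactGroup image_image)
    moreover have "kernel F (?Q Mod K) ?h = {w \<in> carrier F. N #>\<^bsub>F\<^esub> w \<in> K}"
      unfolding kernel_def using \<pi>.H.rcos_eq_subgroup_iff[OF normal_imp_subgroup[OF K]]
      by (intro Collect_cong conj_cong refl) simp
    ultimately show ?thesis using C by metis
  qed
  show ?thesis
  proof
    assume res: "residually C ?Q"
    show "\<forall>w \<in> carrier F - N. \<exists>M. M \<lhd> F \<and> N \<subseteq> M \<and> w \<notin> M \<and> D M"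
    proof
      fix w assume w: "w \<in> carrier F - N"
      then have "N #>\<^bsub>F\<^esub> w \<noteq> \<one>\<^bsub>?Q\<^esub>"
        using F.rcos_eq_subgroup_iff[OF Nsub] by auto
      then obtain K where K: "K \<lhd> ?Q" "C (?Q Mod K)" "K #>\<^bsub>?Q\<^esub> (N #>\<^bsub>F\<^esub> w) \<noteq> \<one>\<^bsub>?Q Mod K\<^esub>"
        using res w \<pi>.hom_closed unfolding residually_def by blast
      let ?M = "{w \<in> carrier F. N #>\<^bsub>F\<^esub> w \<in> K}"
      have "N \<in> K"
        using K(1) subgroup.one_closed[OF normal_imp_subgroup] by fastforce
      then have "N \<subseteq> ?M"
        using N_one subgroup.subset[OF Nsub] by auto
      moreover have "w \<notin> ?M"
        using K w \<pi>.H.rcos_eq_subgroup_iff[OF normal_imp_subgroup[OF K(1)]] by auto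
      ultimately show "\<exists>M. M \<lhd> F \<and> N \<subseteq> M \<and> w \<notin> M \<and> D M"
        using \<pi>.normal_vimage[OF K(1)] pull[OF K(1)] K(2) by blast
    qed
  next
    assume M: "\<forall>w \<in> carrier F - N. \<exists>M. M \<lhd> F \<and> N \<subseteq> M \<and> w \<notin> M \<and> D M"
    show "residually C ?Q"
      unfolding residually_def
    proof (intro ballI impI)
      fix g assume g: "g \<in> carrier ?Q" "g \<noteq> \<one>\<^bsub>?Q\<^esub>"
      then obtain w where w: "w \<in> carrier F" "g = N #>\<^bsub>F\<^esub> w" using surj by blast
      with g have "w \<notin> N" using N_one by auto
      then obtain M where M: "M \<lhd> F" "N \<subseteq> M" "w \<notin> M" "D M" using M w by blast
      interpret M: normal M F by fact
      define K where "K = (\<lambda>x. N #>\<^bsub>F\<^esub> x) ` M"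
      have K: "K \<lhd> ?Q" unfolding K_def by (rule \<pi>.surj_normal_image[OF surj M(1)])
      \<comment> \<open>This is where \<open>N \<subseteq> M\<close> enters: it keeps the preimage
        of \<open>K\<close> from being larger than \<open>M\<close>.\<close>
      have pre: "x \<in> M" if x: "x \<in> carrier F" "N #>\<^bsub>F\<^esub> x \<in> K" for x
      proof -
        obtain m where m: "m \<in> M" "N #>\<^bsub>F\<^esub> x = N #>\<^bsub>F\<^esub> m" using x(2) by (auto simp: K_def)
        then have "x \<otimes>\<^bsub>F\<^esub> inv\<^bsub>F\<^esub> m \<in> M"
          using F.rcos_eq_iff[OF N] x M.mem_carrier M(2) by blast
        then have "(x \<otimes>\<^bsub>F\<^esub> inv\<^bsub>F\<^esub> m) \<otimes>\<^bsub>F\<^esub> m \<in> M" using m M.m_closed by blast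
        then show ?thesis using x m M.mem_carrier[OF m(1)] by (simp add: F.m_assoc)
      qed
      then have vim: "{w \<in> carrier F. N #>\<^bsub>F\<^esub> w \<in> K} = M"
        using M.subset by (auto simp: K_def)
      have "C (?Q Mod K)" using pull[OF K] vim M(4) by simp
      moreover have "K #>\<^bsub>?Q\<^esub> g \<noteq> \<one>\<^bsub>?Q Mod K\<^esub>"
        using \<pi>.H.rcos_eq_subgroup_iff[OF normal_imp_subgroup[OF K] g(1)] pre[of w] w M(3) by auto
      ultimately show "\<exists>K. K \<lhd> ?Q \<and> C (?Q Mod K) \<and> K #>\<^bsub>?Q\<^esub> g \<noteq> \<one>\<^bsub>?Q Mod K\<^esub>"
        using K by blast
    qed
  qed
qed

text \<open>From here on words are handled through the group laws; unfolding products to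
  \<open>foldr lmult\<close> or to set products of cosets would hide these laws from the
  simplifier.\<close>

declare mult_free_group [simp del] one_free_group [simp del]
  mult_FactGroup [simp del] one_FactGroup [simp del]

lemma (in group) cancel_inv_left:
  assumes "x \<in> carrier G" "y \<in> carrier G"
  shows "inv x \<otimes> (x \<otimes> y) = y" "x \<otimes> (inv x \<otimes> y) = y"
  using assms by (simp_all add: m_assoc[symmetric])

section \<open>Kernels of maps onto finite and finitely presentable groups\<close>

definition normally_finitely_generated :: "'a monoid \<Rightarrow> 'a set \<Rightarrow> bool" where
  "normally_finitely_generated G M \<longleftrightarrow>
     (\<exists>R. finite R \<and> R \<subseteq> carrier G \<and> M = normal_closure G R)"

text \<open>A finite group is presented by its multiplication table. Modulo the table, a word can be
  absorbed letter by letter into the chosen representative \<open>s (h w)\<close> of its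
  image.\<close>

lemma finite_image_imp_kernel_normally_finitely_generated:
  assumes h: "group_hom (free_group k) Q h" and fin: "finite (h ` carrier (free_group k))"
  shows "normally_finitely_generated (free_group k) (kernel (free_group k) Q h)"
proof -
  let ?F = "free_group k"
  interpret h: group_hom ?F Q h by fact
  define s where "s q = inv_into (carrier ?F) h q" for q
  have s: "s q \<in> carrier ?F" "h (s q) = q" if "q \<in> h ` carrier ?F" for q
    using that by (auto simp: s_def inv_into_into f_inv_into_f)
  define r where "r i b q = [(i, b)] \<otimes>\<^bsub>?F\<^esub> s q \<otimes>\<^bsub>?F\<^esub> inv\<^bsub>?F\<^esub> s (h [(i, b)] \<otimes>\<^bsub>Q\<^esub> q)" for i b q
  \<comment> \<open>The section \<open>s\<close> need not send the identity to the empty word, so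
    its value there is a relator of its own.\<close>
  define R where "R = insert (s \<one>\<^bsub>Q\<^esub>) ((\<lambda>(i, b, q). r i b q) ` ({..<k} \<times> UNIV \<times> h ` carrier ?F))"
  have im: "h x \<otimes>\<^bsub>Q\<^esub> q \<in> h ` carrier ?F" if "x \<in> carrier ?F" "q \<in> h ` carrier ?F" for x q
    using that by (auto simp flip: h.hom_mult)
  have one: "\<one>\<^bsub>Q\<^esub> \<in> h ` carrier ?F"
    using imageI[OF h.G.one_closed, of h] by simp
  have "r i b q \<in> kernel ?F Q h" if i: "i < k" and q: "q \<in> h ` carrier ?F" for i b q
  proof -
    note c = letter_closed[OF i, of b] s[OF q] s[OF im[OF letter_closed[OF i] q], of b]
    moreover have "q \<in> carrier Q" using q by auto
    ultimately show ?thesis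
      by (simp add: r_def kernel_def)
  qed
  then have R_sub: "R \<subseteq> kernel ?F Q h"
    using s[OF one] by (auto simp: R_def kernel_def)
  then have RF: "R \<subseteq> carrier ?F" by (auto simp: kernel_def)
  define M where "M = normal_closure ?F R"
  interpret M: normal M ?F
    unfolding M_def by (rule normal_closure_normal[OF group_free_group RF])
  have RM: "R \<subseteq> M" unfolding M_def by (rule normal_closure_incl)
  have key: "w \<otimes>\<^bsub>?F\<^esub> inv\<^bsub>?F\<^esub> s (h w) \<in> M" if "w \<in> carrier ?F" for w
    using that
  proof (induction rule: free_group_induct)
    case Nil
    have "s \<one>\<^bsub>Q\<^esub> \<in> M" using RM by (auto simp: R_def)
    then have "\<one>\<^bsub>?F\<^esub> \<otimes>\<^bsub>?F\<^esub> inv\<^bsub>?F\<^esub> s (h \<one>\<^bsub>?F\<^esub>) \<in> M"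
      using s[OF one] M.m_inv_closed by simp
    then show ?case by (simp only: one_free_group)
  next
    case (Cons i b w)
    have i: "i < k" and w: "w \<in> carrier ?F" by fact+
    let ?a = "[(i, b)]" and ?u = "s (h w)" and ?v = "s (h [(i, b)] \<otimes>\<^bsub>Q\<^esub> h w)"
    have a: "?a \<in> carrier ?F" using letter_closed[OF i] .
    have u: "?u \<in> carrier ?F" and v: "?v \<in> carrier ?F" using s(1) im a w by auto
    have "r i b (h w) \<in> R"
      unfolding R_def using i w by (intro insertI2 image_eqI[of _ _ "(i, b, h w)"]) auto
    then have "r i b (h w) \<in> M" using RM by blast
    moreover have "?a \<otimes>\<^bsub>?F\<^esub> (w \<otimes>\<^bsub>?F\<^esub> inv\<^bsub>?F\<^esub> ?u) \<otimes>\<^bsub>?F\<^esub> inv\<^bsub>?F\<^esub> ?a \<in> M"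
      using M.inv_op_closed2[OF a Cons.IH] .
    ultimately have "?a \<otimes>\<^bsub>?F\<^esub> (w \<otimes>\<^bsub>?F\<^esub> inv\<^bsub>?F\<^esub> ?u) \<otimes>\<^bsub>?F\<^esub> inv\<^bsub>?F\<^esub> ?a \<otimes>\<^bsub>?F\<^esub>
        (?a \<otimes>\<^bsub>?F\<^esub> ?u \<otimes>\<^bsub>?F\<^esub> inv\<^bsub>?F\<^esub> ?v) \<in> M"
      unfolding r_def using M.m_closed by blast
    moreover have "?a \<otimes>\<^bsub>?F\<^esub> (w \<otimes>\<^bsub>?F\<^esub> inv\<^bsub>?F\<^esub> ?u) \<otimes>\<^bsub>?F\<^esub> inv\<^bsub>?F\<^esub> ?a \<otimes>\<^bsub>?F\<^esub>
        (?a \<otimes>\<^bsub>?F\<^esub> ?u \<otimes>\<^bsub>?F\<^esub> inv\<^bsub>?F\<^esub> ?v) = ?a \<otimes>\<^bsub>?F\<^esub> w \<otimes>\<^bsub>?F\<^esub> inv\<^bsub>?F\<^esub> ?v"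
      using a u v w by (simp add: h.G.m_assoc h.G.cancel_inv_left)
    moreover have "h (?a \<otimes>\<^bsub>?F\<^esub> w) = h ?a \<otimes>\<^bsub>Q\<^esub> h w" using a w by simp
    ultimately show ?case using Cons.hyps by metis
  qed
  have "kernel ?F Q h \<subseteq> M"
  proof
    fix w assume w: "w \<in> kernel ?F Q h"
    then have "w \<otimes>\<^bsub>?F\<^esub> inv\<^bsub>?F\<^esub> s \<one>\<^bsub>Q\<^esub> \<in> M" using key[of w] by (auto simp: kernel_def)
    moreover have s1: "s \<one>\<^bsub>Q\<^esub> \<in> M" using RM by (auto simp: R_def)
    ultimately have "w \<otimes>\<^bsub>?F\<^esub> inv\<^bsub>?F\<^esub> s \<one>\<^bsub>Q\<^esub> \<otimes>\<^bsub>?F\<^esub> s \<one>\<^bsub>Q\<^esub> \<in> M" by (rule M.m_closed)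
    then show "w \<in> M"
      using w M.mem_carrier[OF s1] by (simp add: kernel_def h.G.m_assoc)
  qed
  moreover have "M \<subseteq> kernel ?F Q h"
    unfolding M_def by (rule normal_closure_minimal[OF h.normal_kernel R_sub])
  moreover have "finite R" using fin by (simp add: R_def)
  ultimately show ?thesis
    using RF unfolding normally_finitely_generated_def M_def by blast
qed

text \<open>Finite presentability does not depend on the finite generating set (Tietze).
  \<open>\<alpha>\<close> and \<open>\<beta>\<close> rewrite the generators of either marking in
  terms of the other; a word \<open>w\<close> of the kernel is congruent to
  \<open>\<alpha> (\<beta> w)\<close>, where \<open>\<beta> w\<close> is a consequence of
  \<open>R\<close>.\<close>

lemma finitely_presentable_imp_kernel_normally_finitely_generated:
  assumes h: "group_hom (free_group k) Q h" "h ` carrier (free_group k) = carrier Q"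
    and fp: "finitely_presentable Q"
  shows "normally_finitely_generated (free_group k) (kernel (free_group k) Q h)"
proof -
  let ?F = "free_group k"
  obtain m R where R: "finite R" "R \<subseteq> carrier (free_group m)"
      "Q \<cong> free_group m Mod normal_closure (free_group m) R"
    using fp by (auto simp: finitely_presentable_def)
  let ?E = "free_group m"
  define N where "N = normal_closure ?E R"
  have N: "N \<lhd> ?E" unfolding N_def by (rule normal_closure_normal[OF group_free_group R(2)])
  obtain \<psi> where \<psi>: "\<psi> \<in> iso Q (?E Mod N)" using R(3) by (auto simp: is_iso_def N_def)
  interpret h: group_hom ?F Q h by fact
  interpret \<pi>: group_hom ?E "?E Mod N" "\<lambda>x. N #>\<^bsub>?E\<^esub> x"
    by (rule group.normal_hom_Mod[OF group_free_group N])
  interpret \<psi>: group_hom Q "?E Mod N" \<psi>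
    using \<psi> by (auto simp: group_hom_def group_hom_axioms_def iso_def h.H.is_group \<pi>.H.is_group)
  define g where "g w = \<psi> (h w)" for w
  have inj: "inj_on \<psi> (carrier Q)" and sur: "\<psi> ` carrier Q = carrier (?E Mod N)"
    using \<psi> by (auto simp: iso_def bij_betw_def)
  interpret g: group_hom ?F "?E Mod N" g
    by (auto simp: group_hom_def group_hom_axioms_def hom_def g_def h.G.is_group \<pi>.H.is_group)
  have gker: "kernel ?F (?E Mod N) g = kernel ?F Q h"
    using inj_onD[OF inj, of _ "\<one>\<^bsub>Q\<^esub>"] unfolding kernel_def g_def
    by (intro Collect_cong conj_cong refl) (metis \<psi>.hom_one h.H.one_closed h.hom_closed)
  have gsur: "g ` carrier ?F = carrier (?E Mod N)"
    using sur h(2) by (auto simp: g_def image_image[symmetric])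
  have "\<exists>u \<in> carrier ?F. g u = N #>\<^bsub>?E\<^esub> [(j, True)]" if "j < m" for j
    using gsur \<pi>.hom_closed[OF letter_closed[OF that]] by (metis (no_types, lifting) imageE)
  then obtain u where u: "\<And>j. j < m \<Longrightarrow> u j \<in> carrier ?F"
      "\<And>j. j < m \<Longrightarrow> g (u j) = N #>\<^bsub>?E\<^esub> [(j, True)]" by metis
  have "\<exists>y \<in> carrier ?E. N #>\<^bsub>?E\<^esub> y = g [(i, True)]" if "i < k" for i
    using g.hom_closed[OF letter_closed[OF that, of True]] unfolding carrier_FactGroup
    by (metis (no_types, lifting) imageE)
  then obtain y where y: "\<And>i. i < k \<Longrightarrow> y i \<in> carrier ?E"
      "\<And>i. i < k \<Longrightarrow> N #>\<^bsub>?E\<^esub> y i = g [(i, True)]" by metis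
  define \<alpha> where "\<alpha> = word_value ?F (map u [0..<m])"
  define \<beta> where "\<beta> = word_value ?E (map y [0..<k])"
  interpret \<alpha>: group_hom ?E ?F \<alpha>
    unfolding \<alpha>_def by (rule h.G.word_value_hom) (use u in auto)
  interpret \<beta>: group_hom ?F ?E \<beta>
    unfolding \<beta>_def by (rule \<pi>.G.word_value_hom) (use y in auto)
  have \<alpha>: "\<alpha> [(j, True)] = u j" if "j < m" for j
    unfolding \<alpha>_def using h.G.word_value_gen[of "map u [0..<m]" j] that u
    by (simp add: image_subset_iff)
  have \<beta>: "\<beta> [(i, True)] = y i" if "i < k" for i
    unfolding \<beta>_def using \<pi>.G.word_value_gen[of "map y [0..<k]" i] that y
    by (simp add: image_subset_iff)
  have g\<alpha>: "g (\<alpha> w) = N #>\<^bsub>?E\<^esub> w" if "w \<in> carrier ?E" for w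
  proof (rule free_group_hom_eqI[OF _ \<pi>.group_hom_axioms _ that])
    show "group_hom ?E (?E Mod N) (\<lambda>w. g (\<alpha> w))"
      by (auto simp: group_hom_def group_hom_axioms_def hom_def \<pi>.G.is_group \<pi>.H.is_group)
  qed (use \<alpha> u in auto)
  have \<pi>\<beta>: "N #>\<^bsub>?E\<^esub> \<beta> w = g w" if "w \<in> carrier ?F" for w
  proof (rule free_group_hom_eqI[OF _ g.group_hom_axioms _ that])
    show "group_hom ?F (?E Mod N) (\<lambda>w. N #>\<^bsub>?E\<^esub> \<beta> w)"
      using \<pi>.hom_mult \<pi>.hom_closed
      by (auto simp: group_hom_def group_hom_axioms_def hom_def h.G.is_group \<pi>.H.is_group)
  qed (use \<beta> y in auto)
  \<comment> \<open>The translated relators send \<open>N\<close> into the closure of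
    \<open>S\<close>; the second family makes \<open>\<alpha>\<close> after \<open>\<beta>\<close>
    the identity on generators, hence everywhere, modulo that closure.\<close>
  define S where "S = \<alpha> ` R \<union> (\<lambda>i. [(i, True)] \<otimes>\<^bsub>?F\<^esub> inv\<^bsub>?F\<^esub> \<alpha> (y i)) ` {..<k}"
  have "S \<subseteq> kernel ?F (?E Mod N) g"
  proof -
    have "\<alpha> r \<in> kernel ?F (?E Mod N) g" if "r \<in> R" for r
    proof -
      have "r \<in> N" unfolding N_def using normal_closure_incl[of R ?E] that by blast
      then have "N #>\<^bsub>?E\<^esub> r = N"
        using \<pi>.G.rcos_eq_subgroup_iff[OF normal_imp_subgroup[OF N]] R(2) that by auto
      then show ?thesis using R(2) that by (simp add: kernel_def one_FactGroup g\<alpha> subset_iff)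
    qed
    moreover have "[(i, True)] \<otimes>\<^bsub>?F\<^esub> inv\<^bsub>?F\<^esub> \<alpha> (y i) \<in> kernel ?F (?E Mod N) g" if i: "i < k" for i
    proof -
      have "g (\<alpha> (y i)) = g [(i, True)]" using g\<alpha>[OF y(1)[OF i]] y(2)[OF i] by simp
      then show ?thesis
        using letter_closed[OF i, of True] y(1)[OF i]
        by (simp add: kernel_def)
    qed
    ultimately show ?thesis by (auto simp: S_def)
  qed
  then have S_ker: "S \<subseteq> kernel ?F Q h" and SF: "S \<subseteq> carrier ?F"
    unfolding gker by (auto simp: kernel_def)
  define M where "M = normal_closure ?F S"
  have M: "M \<lhd> ?F" unfolding M_def by (rule normal_closure_normal[OF group_free_group SF])
  have SM: "S \<subseteq> M" unfolding M_def by (rule normal_closure_incl)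
  interpret \<kappa>: group_hom ?F "?F Mod M" "\<lambda>x. M #>\<^bsub>?F\<^esub> x" by (rule h.G.normal_hom_Mod[OF M])
  have \<kappa>: "M #>\<^bsub>?F\<^esub> \<alpha> (\<beta> w) = M #>\<^bsub>?F\<^esub> w" if "w \<in> carrier ?F" for w
  proof (rule free_group_hom_eqI[OF _ \<kappa>.group_hom_axioms _ that])
    show "group_hom ?F (?F Mod M) (\<lambda>w. M #>\<^bsub>?F\<^esub> \<alpha> (\<beta> w))"
      using \<kappa>.hom_mult \<kappa>.hom_closed
      by (auto simp: group_hom_def group_hom_axioms_def hom_def h.G.is_group \<kappa>.H.is_group)
    fix i assume i: "i < k"
    have "[(i, True)] \<otimes>\<^bsub>?F\<^esub> inv\<^bsub>?F\<^esub> \<alpha> (y i) \<in> M" using SM i by (auto simp: S_def)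
    then show "M #>\<^bsub>?F\<^esub> \<alpha> (\<beta> [(i, True)]) = M #>\<^bsub>?F\<^esub> [(i, True)]"
      using h.G.rcos_eq_iff[OF M letter_closed[OF i, of True] \<alpha>.hom_closed[OF y(1)[OF i]]] \<beta>[OF i]
      by simp
  qed
  have "N \<subseteq> {x \<in> carrier ?E. \<alpha> x \<in> M}"
    unfolding N_def
    by (rule normal_closure_minimal[OF \<alpha>.normal_vimage[OF M]]) (use R(2) SM in \<open>auto simp: S_def\<close>)
  then have \<alpha>N: "\<alpha> v \<in> M" if "v \<in> N" for v using that by blast
  have \<beta>N: "\<beta> w \<in> N" if "w \<in> kernel ?F Q h" for w
  proof -
    have w: "w \<in> carrier ?F" "g w = N" using that gker by (auto simp: kernel_def one_FactGroup)
    then show ?thesis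
      using \<pi>\<beta>[OF w(1)] \<pi>.G.rcos_eq_subgroup_iff[OF normal_imp_subgroup[OF N] \<beta>.hom_closed[OF w(1)]]
      by simp
  qed
  have "w \<in> M" if "w \<in> kernel ?F Q h" for w
  proof -
    have w: "w \<in> carrier ?F" using that by (auto simp: kernel_def)
    have "\<alpha> (\<beta> w) \<in> M" using \<alpha>N[OF \<beta>N[OF that]] .
    then have "M #>\<^bsub>?F\<^esub> \<alpha> (\<beta> w) = M"
      using h.G.rcos_eq_subgroup_iff[OF normal_imp_subgroup[OF M]] w \<alpha>.hom_closed \<beta>.hom_closed by simp
    then show "w \<in> M"
      using \<kappa>[OF w] h.G.rcos_eq_subgroup_iff[OF normal_imp_subgroup[OF M] w] by simp
  qed
  moreover have "M \<subseteq> kernel ?F Q h"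
    unfolding M_def by (rule normal_closure_minimal[OF h.normal_kernel S_ker])
  ultimately have "kernel ?F Q h = M" by blast
  moreover have "finite S" using R(1) by (simp add: S_def)
  ultimately show ?thesis
    using SF unfolding normally_finitely_generated_def M_def by blast
qed

lemma finitely_presentable_iff_kernel:
  assumes "group_hom (free_group k) Q h" "h ` carrier (free_group k) = carrier Q"
  shows "finitely_presentable Q \<longleftrightarrow>
    normally_finitely_generated (free_group k) (kernel (free_group k) Q h)"
proof
  interpret h: group_hom "free_group k" Q h by fact
  assume "normally_finitely_generated (free_group k) (kernel (free_group k) Q h)"
  moreover have "Q \<cong> free_group k Mod kernel (free_group k) Q h"
    using h.FactGroup_iso_set[OF assms(2)] normal.factorgroup_is_group[OF h.normal_kernel]
      group.iso_sym is_isoI by blast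
  ultimately show "finitely_presentable Q"
    using h.H.is_group unfolding finitely_presentable_def normally_finitely_generated_def by metis
qed (use assms finitely_presentable_imp_kernel_normally_finitely_generated in blast)

lemma finite_group_iff_kernel:
  assumes "group_hom F Q h" "h ` carrier F = carrier Q"
  shows "finite_group Q \<longleftrightarrow> finite (carrier (F Mod kernel F Q h))"
proof -
  interpret h: group_hom F Q h by fact
  show ?thesis
    using h.FactGroup_iso_set[OF assms(2)] iso_finite[OF is_isoI] h.H.is_group
    by (auto simp: finite_group_def)
qed

section \<open>The lower central series under surjections\<close>

lemma lower_central_normal:
  fixes G (structure)
  assumes "group G"
  shows "lower_central G n \<lhd> G"
proof (induction n)
  case 0
  then show ?case using group.normal_self[OF assms] by simp
next
  case (Suc n)
  interpret group G by fact
  interpret L: normal "lower_central G n" G by fact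
  show ?case
    unfolding lower_central.simps
  proof (rule normal_generateI)
    fix h g
    assume "h \<in> {x \<otimes> y \<otimes> inv x \<otimes> inv y |x y. x \<in> lower_central G n \<and> y \<in> carrier G}"
      and g: "g \<in> carrier G"
    then obtain x y where h: "h = x \<otimes> y \<otimes> inv x \<otimes> inv y"
      and x: "x \<in> lower_central G n" and y: "y \<in> carrier G" by blast
    have "x \<in> carrier G" using x L.mem_carrier by blast
    then have "g \<otimes> h \<otimes> inv g = (g \<otimes> x \<otimes> inv g) \<otimes> (g \<otimes> y \<otimes> inv g) \<otimes> inv (g \<otimes> x \<otimes> inv g) \<otimes> inv (g \<otimes> y \<otimes> inv g)"
      using g y h by (simp add: m_assoc inv_mult_group cancel_inv_left)
    moreover have "g \<otimes> x \<otimes> inv g \<in> lower_central G n" using L.inv_op_closed2 g x by blast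
    moreover have "g \<otimes> y \<otimes> inv g \<in> carrier G" using g y by blast
    ultimately show "g \<otimes> h \<otimes> inv g \<in> {x \<otimes> y \<otimes> inv x \<otimes> inv y |x y. x \<in> lower_central G n \<and> y \<in> carrier G}"
      by blast
  qed (use L.mem_carrier in auto)
qed

lemma lower_central_image:
  assumes "group_hom G H h" "h ` carrier G = carrier H"
  shows "lower_central H n = h ` lower_central G n"
proof (induction n)
  case 0
  then show ?case using assms by simp
next
  case (Suc n)
  interpret h: group_hom G H h by fact
  have sub: "lower_central G n \<subseteq> carrier G"
    using lower_central_normal[OF h.G.is_group] normal_imp_subgroup subgroup.subset by blast
  let ?K = "{x \<otimes>\<^bsub>G\<^esub> y \<otimes>\<^bsub>G\<^esub> inv\<^bsub>G\<^esub> x \<otimes>\<^bsub>G\<^esub> inv\<^bsub>G\<^esub> y |x y. x \<in> lower_central G n \<and> y \<in> carrier G}"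
  have eq: "h (x \<otimes>\<^bsub>G\<^esub> y \<otimes>\<^bsub>G\<^esub> inv\<^bsub>G\<^esub> x \<otimes>\<^bsub>G\<^esub> inv\<^bsub>G\<^esub> y) = h x \<otimes>\<^bsub>H\<^esub> h y \<otimes>\<^bsub>H\<^esub> inv\<^bsub>H\<^esub> h x \<otimes>\<^bsub>H\<^esub> inv\<^bsub>H\<^esub> h y"
    if "x \<in> lower_central G n" "y \<in> carrier G" for x y
    using that sub by (simp add: subset_iff)
  have "{x \<otimes>\<^bsub>H\<^esub> y \<otimes>\<^bsub>H\<^esub> inv\<^bsub>H\<^esub> x \<otimes>\<^bsub>H\<^esub> inv\<^bsub>H\<^esub> y |x y. x \<in> lower_central H n \<and> y \<in> carrier H} = h ` ?K"
  proof (intro equalityI subsetI)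
    fix z assume "z \<in> {x \<otimes>\<^bsub>H\<^esub> y \<otimes>\<^bsub>H\<^esub> inv\<^bsub>H\<^esub> x \<otimes>\<^bsub>H\<^esub> inv\<^bsub>H\<^esub> y |x y. x \<in> lower_central H n \<and> y \<in> carrier H}"
    then obtain x' y' where xy': "x' \<in> h ` lower_central G n" "y' \<in> h ` carrier G"
        "z = x' \<otimes>\<^bsub>H\<^esub> y' \<otimes>\<^bsub>H\<^esub> inv\<^bsub>H\<^esub> x' \<otimes>\<^bsub>H\<^esub> inv\<^bsub>H\<^esub> y'"
      unfolding Suc.IH assms(2) by blast
    then obtain x y where xy: "x \<in> lower_central G n" "y \<in> carrier G"
        "z = h x \<otimes>\<^bsub>H\<^esub> h y \<otimes>\<^bsub>H\<^esub> inv\<^bsub>H\<^esub> h x \<otimes>\<^bsub>H\<^esub> inv\<^bsub>H\<^esub> h y"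
      by blast
    then show "z \<in> h ` ?K"
      unfolding eq[OF xy(1,2), symmetric] by blast
  next
    fix z assume "z \<in> h ` ?K"
    then obtain x y where xy: "x \<in> lower_central G n" "y \<in> carrier G"
        "z = h x \<otimes>\<^bsub>H\<^esub> h y \<otimes>\<^bsub>H\<^esub> inv\<^bsub>H\<^esub> h x \<otimes>\<^bsub>H\<^esub> inv\<^bsub>H\<^esub> h y"
      using eq by blast
    then have "h x \<in> lower_central H n" "h y \<in> carrier H" using Suc.IH by auto
    then show "z \<in> {x \<otimes>\<^bsub>H\<^esub> y \<otimes>\<^bsub>H\<^esub> inv\<^bsub>H\<^esub> x \<otimes>\<^bsub>H\<^esub> inv\<^bsub>H\<^esub> y |x y. x \<in> lower_central H n \<and> y \<in> carrier H}"
      using xy by blast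
  qed
  moreover have "?K \<subseteq> carrier G" using sub by (auto simp: subset_iff)
  ultimately show ?case using h.generate_img[of ?K] by simp
qed

lemma nilpotent_group_iff_kernel:
  assumes "group_hom F Q h" "h ` carrier F = carrier Q"
  shows "nilpotent_group Q \<longleftrightarrow> (\<exists>c. lower_central F c \<subseteq> kernel F Q h)"
proof -
  interpret h: group_hom F Q h by fact
  have "lower_central Q c = {\<one>\<^bsub>Q\<^esub>} \<longleftrightarrow> lower_central F c \<subseteq> kernel F Q h" for c
  proof -
    have L: "subgroup (lower_central F c) F"
      using lower_central_normal[OF h.G.is_group] normal_imp_subgroup by blast
    have "h ` lower_central F c = {\<one>\<^bsub>Q\<^esub>} \<longleftrightarrow> (\<forall>x \<in> lower_central F c. h x = \<one>\<^bsub>Q\<^esub>)"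
      using subgroup.one_closed[OF L] by auto
    then show ?thesis
      using subgroup.subset[OF L] lower_central_image[OF assms] by (auto simp: kernel_def)
  qed
  then show ?thesis using h.H.is_group by (simp add: nilpotent_group_def)
qed

section \<open>The Borel hierarchy on the space of marked groups\<close>

lemma pi0_in_3_iff:
  "pi0_in X 3 A \<longleftrightarrow> A \<subseteq> topspace X \<and>
     (countable union_of (\<lambda>T. T \<subseteq> topspace X \<and> fsigma_in X (topspace X - T))) (topspace X - A)"
  unfolding pi0_in_def using sigma0_in_2[of X] by (simp add: numeral_3_eq_3 numeral_2_eq_2)

text \<open>Second countability leaves only countably many clopen sets to unite, and subtracting the
  finitely many earlier ones from each keeps them clopen.\<close>

lemma open_disjoint_clopens:
  assumes Y: "second_countable Y" "Y dim_le 0" and U: "openin Y U"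
  obtains D :: "nat \<Rightarrow> 'a set" where "\<And>j. openin Y (D j)" "\<And>j. closedin Y (D j)"
    "disjoint_family D" "U = (\<Union>j. D j)"
proof -
  obtain \<B> where \<B>: "countable \<B>" "\<And>V. V \<in> \<B> \<Longrightarrow> openin Y V"
      "\<And>U x. openin Y U \<Longrightarrow> x \<in> U \<Longrightarrow> \<exists>V \<in> \<B>. x \<in> V \<and> V \<subseteq> U"
    using Y(1) unfolding second_countable_def by metis
  have base: "\<exists>C. closedin Y C \<and> openin Y C \<and> x \<in> C \<and> C \<subseteq> U" if "x \<in> U" for x
    using Y(2) U that unfolding dimension_le_0_neighbourhood_base_of_clopen neighbourhood_base_of
    by (metis subsetD)
  \<comment> \<open>Basic sets need not be clopen. Those that fit into some clopen subset of
    \<open>U\<close> still cover \<open>U\<close>, and each selects one such clopen set.\<close>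
  define \<V> where "\<V> = {V \<in> \<B>. \<exists>C. closedin Y C \<and> openin Y C \<and> V \<subseteq> C \<and> C \<subseteq> U}"
  have "\<forall>V \<in> \<V>. \<exists>C. closedin Y C \<and> openin Y C \<and> V \<subseteq> C \<and> C \<subseteq> U" by (auto simp: \<V>_def)
  then obtain c where c: "\<And>V. V \<in> \<V> \<Longrightarrow> closedin Y (c V) \<and> openin Y (c V) \<and> V \<subseteq> c V \<and> c V \<subseteq> U"
    by metis
  \<comment> \<open>The empty set ensures that an enumeration exists even if no basic set
    qualifies.\<close>
  define \<C> where "\<C> = insert {} (c ` \<V>)"
  have "countable \<C>" unfolding \<C>_def \<V>_def using \<B>(1) by auto
  then obtain e :: "nat \<Rightarrow> 'a set" where e: "range e = \<C>"
    using uncountable_def[of \<C>] by (auto simp: \<C>_def)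
  have clopen: "closedin Y (e n)" "openin Y (e n)" "e n \<subseteq> U" for n
  proof -
    have "e n \<in> \<C>" using e by blast
    then show "closedin Y (e n)" "openin Y (e n)" "e n \<subseteq> U" unfolding \<C>_def using c by auto
  qed
  have "U \<subseteq> (\<Union>n. e n)"
  proof
    fix x assume x: "x \<in> U"
    then obtain C where C: "closedin Y C" "openin Y C" "x \<in> C" "C \<subseteq> U" using base by blast
    then obtain V where "V \<in> \<B>" "x \<in> V" "V \<subseteq> C" using \<B>(3) by blast
    with C have "V \<in> \<V>" "x \<in> V" by (auto simp: \<V>_def)
    then have "x \<in> \<Union>\<C>" using c unfolding \<C>_def by blast
    then show "x \<in> (\<Union>n. e n)" using e by blast
  qed
  then have U_eq: "U = (\<Union>n. e n)" using clopen(3) by blast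
  have "openin Y (\<Union>i<j. e i)" "closedin Y (\<Union>i<j. e i)" for j
    using clopen by (auto intro!: closedin_Union)
  then have "openin Y (disjointed e j)" "closedin Y (disjointed e j)" for j
    using clopen unfolding disjointed_def atLeast0LessThan by (simp_all add: openin_diff closedin_diff)
  then show thesis
    using that[of "disjointed e"] disjoint_family_disjointed[of e] UN_disjointed_eq[of e] U_eq by auto
qed

text \<open>The normal form that the reduction encodes. The complement of \<open>B\<close> is a
  union of G-delta sets \<open>T n\<close>, and the complement of \<open>T n\<close> is an
  increasing union of closed sets \<open>C m\<close>; so \<open>y\<close> lies in \<open>T n\<close>
  iff it avoids infinitely many of the \<open>C m\<close>.\<close>

lemma pi0_in_3_clopens:
  assumes Y: "zero_dim_polish_space Y" and B: "pi0_in Y 3 B"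
  obtains V :: "nat \<Rightarrow> nat \<Rightarrow> 'a set" where "\<And>n p. openin Y (V n p)" "\<And>n p. closedin Y (V n p)"
    "B = {y \<in> topspace Y. \<forall>n. finite {p. y \<in> V n p}}"
proof -
  have Y': "second_countable Y" "Y dim_le 0" using Y by (auto simp: zero_dim_polish_space_def)
  let ?Q = "\<lambda>T. T \<subseteq> topspace Y \<and> fsigma_in Y (topspace Y - T)"
  obtain \<U> where \<U>: "countable \<U>" "\<U> \<subseteq> Collect ?Q" "\<Union>\<U> = topspace Y - B"
    using B unfolding pi0_in_3_iff union_of_def by (elim conjE exE) (rule that)
  have BY: "B \<subseteq> topspace Y" using B by (simp add: pi0_in_def)
  have "fsigma_in Y (topspace Y)" by (simp add: closed_imp_fsigma_in)
  with \<U> have \<U>': "countable (insert {} \<U>)" "insert {} \<U> \<subseteq> Collect ?Q" by auto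
  obtain T :: "nat \<Rightarrow> 'a set" where T: "range T = insert {} \<U>"
    using \<U>'(1) uncountable_def[of "insert {} \<U>"] by auto
  then have T_un: "(\<Union>n. T n) = topspace Y - B" using \<U>(3) by simp
  have TQ: "?Q (T n)" for n
  proof -
    have "T n \<in> insert {} \<U>" using T by blast
    then show ?thesis using \<U>'(2) by blast
  qed
  have "\<exists>V :: nat \<Rightarrow> 'a set. (\<forall>p. openin Y (V p) \<and> closedin Y (V p)) \<and>
      (\<forall>y \<in> topspace Y. y \<in> T n \<longleftrightarrow> infinite {p. y \<in> V p})" for n
  proof -
    obtain C :: "nat \<Rightarrow> 'a set" where C: "\<And>m. closedin Y (C m)" "\<And>m. C m \<subseteq> C (Suc m)"
        "(\<Union>m. C m) = topspace Y - T n"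
      using TQ[of n] unfolding fsigma_in_ascending by metis
    have "\<exists>D :: nat \<Rightarrow> 'a set. (\<forall>j. openin Y (D j) \<and> closedin Y (D j)) \<and> disjoint_family D \<and>
        topspace Y - C m = (\<Union>j. D j)" for m
      using open_disjoint_clopens[OF Y', of "topspace Y - C m"] C(1) by (metis closedin_def)
    then obtain D :: "nat \<Rightarrow> nat \<Rightarrow> 'a set" where D: "\<And>m j. openin Y (D m j)" "\<And>m j. closedin Y (D m j)"
        "\<And>m. disjoint_family (D m)" "\<And>m. topspace Y - C m = (\<Union>j. D m j)"
      by metis
    define V where "V p = D (fst (prod_decode p)) (snd (prod_decode p))" for p
    have "y \<in> T n \<longleftrightarrow> infinite {p. y \<in> V p}" if y: "y \<in> topspace Y" for y
    proof -
      \<comment> \<open>Disjointness of the pieces of a single open set: each \<open>m\<close> with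
        \<open>y \<notin> C m\<close> is counted exactly once, so infinitely many \<open>p\<close>
        cannot arise from finitely many \<open>m\<close>.\<close>
      have inj: "inj_on (fst \<circ> prod_decode) {p. y \<in> V p}"
      proof (rule inj_onI)
        fix p q assume pq: "p \<in> {p. y \<in> V p}" "q \<in> {p. y \<in> V p}"
          and eq: "(fst \<circ> prod_decode) p = (fst \<circ> prod_decode) q"
        obtain m i j where "prod_decode p = (m, i)" "prod_decode q = (m, j)"
          using eq by (metis comp_apply prod.collapse)
        moreover from this have "y \<in> D m i \<inter> D m j" using pq by (simp add: V_def)
        ultimately have "prod_decode p = prod_decode q"
          using D(3)[of m] by (metis UNIV_I disjoint_family_on_def empty_iff)
        then show "p = q" by (metis prod_decode_inverse)
      qed
      have im: "(fst \<circ> prod_decode) ` {p. y \<in> V p} = {m. y \<notin> C m}"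
      proof (intro Set.set_eqI iffI)
        fix m assume "m \<in> (fst \<circ> prod_decode) ` {p. y \<in> V p}"
        then obtain j where "y \<in> D m j" by (auto simp: V_def)
        then show "m \<in> {m. y \<notin> C m}" using D(4)[of m] by blast
      next
        fix m assume "m \<in> {m. y \<notin> C m}"
        then obtain j where "y \<in> D m j" using D(4)[of m] y by blast
        then show "m \<in> (fst \<circ> prod_decode) ` {p. y \<in> V p}"
          by (intro image_eqI[of _ _ "prod_encode (m, j)"]) (auto simp: V_def)
      qed
      have "infinite {p. y \<in> V p} \<longleftrightarrow> infinite {m. y \<notin> C m}"
        using finite_image_iff[OF inj] im by simp
      also have "\<dots> \<longleftrightarrow> (\<forall>m. y \<notin> C m)"
      proof
        assume "infinite {m. y \<notin> C m}"
        show "\<forall>m. y \<notin> C m"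
        proof (intro allI notI)
          fix m assume "y \<in> C m"
          then have "m' < m" if "y \<notin> C m'" for m'
            using that lift_Suc_mono_le[of C m m', OF C(2)] by (cases "m \<le> m'") auto
          then have "{m. y \<notin> C m} \<subseteq> {..<m}" by auto
          then show False using \<open>infinite _\<close> finite_subset by blast
        qed
      qed simp
      also have "\<dots> \<longleftrightarrow> y \<in> T n" using C(3) y by blast
      finally show ?thesis by simp
    qed
    moreover have "openin Y (V p)" "closedin Y (V p)" for p
      using D by (auto simp: V_def)
    ultimately show ?thesis by blast
  qed
  then obtain V :: "nat \<Rightarrow> nat \<Rightarrow> 'a set" where V: "\<And>n p. openin Y (V n p)" "\<And>n p. closedin Y (V n p)"
      "\<And>n y. y \<in> topspace Y \<Longrightarrow> y \<in> T n \<longleftrightarrow> infinite {p. y \<in> V n p}"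
    by metis
  have "B = {y \<in> topspace Y. \<forall>n. finite {p. y \<in> V n p}}"
  proof -
    have "y \<in> B \<longleftrightarrow> (\<forall>n. finite {p. y \<in> V n p})" if "y \<in> topspace Y" for y
    proof -
      have "y \<in> B \<longleftrightarrow> (\<forall>n. y \<notin> T n)" using T_un that by blast
      then show ?thesis using V(3)[OF that] by simp
    qed
    then show ?thesis using BY by blast
  qed
  then show thesis using that V(1,2) by blast
qed

section \<open>Clopen sets of marked groups and the upper bound\<close>

definition points_containing :: "nat \<Rightarrow> word \<Rightarrow> (nat \<times> (word \<Rightarrow> bool)) set" where
  "points_containing k w = {marked_point k N |N. N \<lhd> free_group k \<and> w \<in> N}"

lemma marked_point_in_points_containing_iff:
  assumes "N \<lhd> free_group k"
  shows "marked_point k N \<in> points_containing l w \<longleftrightarrow> k = l \<and> w \<in> N"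
  using assms marked_point_inject[OF assms] unfolding points_containing_def by blast

lemma
  assumes "w \<in> carrier (free_group k)"
  shows openin_points_containing: "openin marked_groups (points_containing k w)"
    and closedin_points_containing: "closedin marked_groups (points_containing k w)"
proof -
  let ?P = "\<lambda>l. product_topology (\<lambda>_. discrete_topology (UNIV :: bool set)) (carrier (free_group l))"
  let ?T = "\<lambda>l. {snd (marked_point l N) |N. N \<lhd> free_group l}"
  let ?X = "\<lambda>l. subtopology (?P l) (?T l)"
  have open_eval: "openin (?P k) {\<xi> \<in> topspace (?P k). \<xi> w = b}" for b
    using openin_continuous_map_preimage[OF continuous_map_product_projection[OF assms], of "\<lambda>_. discrete_topology UNIV" "{b}"]
    by simp
  have "{\<xi>. (l, \<xi>) \<in> points_containing k w} = (if l = k then {\<xi> \<in> topspace (?P k). \<xi> w = True} \<inter> ?T k else {})" for l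
    using assms by (auto simp: points_containing_def marked_point_def)
  then have "openin (?X l) {\<xi>. (l, \<xi>) \<in> points_containing k w}" for l
    using open_eval[of True] by (auto simp: openin_subtopology_Int)
  moreover have "points_containing k w \<subseteq> topspace marked_groups"
    by (auto simp: points_containing_def topspace_marked_groups)
  moreover from this have "points_containing k w \<subseteq> Sigma UNIV (topspace \<circ> ?X)"
    by (simp add: marked_groups_def)
  ultimately show "openin marked_groups (points_containing k w)"
    by (simp add: marked_groups_def openin_sum_topology)
  have eq: "{\<xi>. (l, \<xi>) \<in> topspace marked_groups - points_containing k w} =
      (if l = k then {\<xi> \<in> topspace (?P k). \<xi> w = False} \<inter> ?T k else topspace (?X l))" for l
    using assms by (auto simp: points_containing_def topspace_marked_groups marked_point_def)
  have "openin (?X l) {\<xi>. (l, \<xi>) \<in> topspace marked_groups - points_containing k w}" for l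
  proof (cases "l = k")
    case True
    then show ?thesis unfolding eq using open_eval[of False] by (simp add: openin_subtopology_Int)
  next
    case False
    then show ?thesis unfolding eq by (simp only: if_False openin_topspace)
  qed
  then have "openin marked_groups (topspace marked_groups - points_containing k w)"
    by (auto simp: marked_groups_def openin_sum_topology)
  then show "closedin marked_groups (points_containing k w)"
    using \<open>points_containing k w \<subseteq> topspace marked_groups\<close> by (simp add: closedin_def)
qed

text \<open>For fixed \<open>k\<close> and \<open>w\<close>, membership of \<open>w\<close> in
  \<open>N\<close> is clopen and \<open>N \<inter> W = {}\<close> is an intersection of clopen
  conditions, hence closed. So each word imposes an F-sigma condition, and there are countably many
  words. Disjointness is general enough to express both \<open>N \<subseteq> M\<close> and the
  avoidance of a lower central term.\<close>

lemma pi0_in_3_marked_groups: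
  assumes "\<And>k w. countable (\<W> k w)"
  shows "pi0_in marked_groups 3 {marked_point k N |k N. N \<lhd> free_group k \<and>
    (\<forall>w \<in> carrier (free_group k) - N. \<exists>W \<in> \<W> k w. N \<inter> W = {})}" (is "pi0_in _ 3 ?A")
proof -
  let ?X = "marked_groups"
  define C where "C k W = {marked_point k N |N. N \<lhd> free_group k \<and> N \<inter> W = {}}" for k W
  \<comment> \<open>The points of level \<open>k\<close> at which the condition fails for
    \<open>w\<close>; since \<open>[]\<close> is the identity, \<open>points_containing k []\<close>
    is the whole level.\<close>
  define T where "T k w = points_containing k [] - points_containing k w - \<Union>(C k ` \<W> k w)" for k w
  have sub: "subgroup N (free_group k)" if "N \<lhd> free_group k" for N k
    using that by (rule normal_imp_subgroup)
  have Nil: "[] \<in> N" if "N \<lhd> free_group k" for N k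
    using subgroup.one_closed[OF sub[OF that]] by (simp only: one_free_group)
  have all: "points_containing k [] = {marked_point k N |N. N \<lhd> free_group k}" for k
    using Nil by (auto simp: points_containing_def)
  have Nil_in: "[] \<in> carrier (free_group k)" for k by (simp add: carrier_free_group)
  have C_iff: "marked_point k N \<in> C l W \<longleftrightarrow> k = l \<and> N \<inter> W = {}" if "N \<lhd> free_group k" for k N l W
    using that marked_point_inject[OF that] unfolding C_def by blast
  have closedC: "closedin ?X (C k W)" for k W
  proof -
    let ?U = "\<Union>w \<in> W \<inter> carrier (free_group k). points_containing k w"
    have D: "N \<inter> W = {} \<longleftrightarrow> (\<forall>w \<in> W \<inter> carrier (free_group k). w \<notin> N)" if "N \<lhd> free_group k" for N
      using subgroup.subset[OF sub[OF that]] by blast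
    have "C k W = {marked_point k N |N. N \<lhd> free_group k \<and> (\<forall>w \<in> W \<inter> carrier (free_group k). w \<notin> N)}"
      unfolding C_def by (intro Collect_cong ex_cong1 conj_cong refl) (rule D)
    also have "\<dots> = points_containing k [] - ?U"
      unfolding all by (auto simp: marked_point_in_points_containing_iff)
    finally have "C k W = points_containing k [] - ?U" .
    moreover have "openin ?X ?U"
      by (auto intro: openin_points_containing)
    ultimately show ?thesis
      using closedin_points_containing[OF Nil_in] by (simp add: closedin_diff)
  qed
  have fs: "fsigma_in ?X (topspace ?X - T k w)" if w: "w \<in> carrier (free_group k)" for k w
  proof -
    have "\<Union>(C k ` \<W> k w) \<subseteq> topspace ?X" "points_containing k w \<subseteq> topspace ?X"
      by (auto simp: C_def points_containing_def topspace_marked_groups)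
    then have eq: "topspace ?X - T k w =
        (topspace ?X - points_containing k []) \<union> points_containing k w \<union> \<Union>(C k ` \<W> k w)"
      by (auto simp: T_def)
    have "closedin ?X (topspace ?X - points_containing k [])"
      using openin_points_containing[OF Nil_in] by (simp add: closedin_diff)
    moreover have "fsigma_in ?X (\<Union>(C k ` \<W> k w))"
      by (rule fsigma_in_Union) (use assms closed_imp_fsigma_in[OF closedC] in auto)
    ultimately show ?thesis
      unfolding eq using closedin_points_containing[OF w]
      by (simp add: fsigma_in_Un closed_imp_fsigma_in)
  qed
  have T_sub: "T k w \<subseteq> topspace ?X" for k w
    unfolding T_def all by (auto simp: topspace_marked_groups)
  have eq: "topspace ?X - ?A = (\<Union>(k, w) \<in> Sigma UNIV (\<lambda>k. carrier (free_group k)). T k w)"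
    (is "?L = ?R")
  proof
    show "?L \<subseteq> ?R"
    proof
      fix x assume "x \<in> ?L"
      then obtain k N where x: "x = marked_point k N" "N \<lhd> free_group k" "x \<notin> ?A"
        by (auto simp: topspace_marked_groups)
      then obtain w where w: "w \<in> carrier (free_group k) - N" "\<And>W. W \<in> \<W> k w \<Longrightarrow> N \<inter> W \<noteq> {}"
        by blast
      have "x \<in> T k w"
        using x(1,2) w Nil by (auto simp: T_def marked_point_in_points_containing_iff C_iff)
      then show "x \<in> ?R" using w by auto
    qed
    show "?R \<subseteq> ?L"
    proof
      fix x assume "x \<in> ?R"
      then obtain k w where w: "w \<in> carrier (free_group k)" "x \<in> T k w" by auto
      then obtain N where N: "x = marked_point k N" "N \<lhd> free_group k" unfolding T_def all by auto
      have "w \<notin> N" "\<And>W. W \<in> \<W> k w \<Longrightarrow> N \<inter> W \<noteq> {}"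
        using w(2) N by (auto simp: T_def marked_point_in_points_containing_iff C_iff)
      moreover have "x \<in> topspace ?X" using N by (auto simp: topspace_marked_groups)
      moreover have "x \<notin> ?A"
      proof
        assume "x \<in> ?A"
        then obtain l M where M: "marked_point k N = marked_point l M" "M \<lhd> free_group l"
            "\<And>w. w \<in> carrier (free_group l) - M \<Longrightarrow> \<exists>W \<in> \<W> l w. M \<inter> W = {}"
          using N(1) by auto
        then have "k = l" "N = M" using marked_point_inject[OF N(2) M(2,1)] by auto
        then show False using M(3)[of w] w(1) \<open>w \<notin> N\<close> calculation(2) by blast
      qed
      ultimately show "x \<in> ?L" by blast
    qed
  qed
  let ?I = "Sigma UNIV (\<lambda>k. carrier (free_group k))"
  show ?thesis
    unfolding pi0_in_3_iff union_of_def
  proof (intro conjI exI[of _ "(\<lambda>(k, w). T k w) ` ?I"])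
    show "?A \<subseteq> topspace ?X" by (auto simp: topspace_marked_groups)
    show "countable ((\<lambda>(k, w). T k w) ` ?I)" by simp
    show "(\<lambda>(k, w). T k w) ` ?I \<subseteq> {S. S \<subseteq> topspace ?X \<and> fsigma_in ?X (topspace ?X - S)}"
      using fs T_sub by (simp add: image_subset_iff split_beta)
    show "\<Union> ((\<lambda>(k, w). T k w) ` ?I) = topspace ?X - ?A" using eq by simp
  qed
qed

lemma continuous_map_marked_point:
  assumes N: "\<And>y. N y \<lhd> free_group k"
    and clopen: "\<And>w. w \<in> carrier (free_group k) \<Longrightarrow>
      openin Y {y \<in> topspace Y. w \<in> N y} \<and> openin Y {y \<in> topspace Y. w \<notin> N y}"
  shows "continuous_map Y marked_groups (\<lambda>y. marked_point k (N y))"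
proof -
  let ?P = "product_topology (\<lambda>_. discrete_topology (UNIV :: bool set)) (carrier (free_group k))"
  let ?T = "{snd (marked_point k N) |N. N \<lhd> free_group k}"
  have "continuous_map Y (discrete_topology UNIV) (\<lambda>y. w \<in> N y)" if w: "w \<in> carrier (free_group k)" for w
  proof (rule continuous_map_openin_preimage_eq[THEN iffD2], intro conjI allI impI)
    fix U :: "bool set"
    have "topspace Y \<inter> (\<lambda>y. w \<in> N y) -` U = (if True \<in> U then {y \<in> topspace Y. w \<in> N y} else {}) \<union>
        (if False \<in> U then {y \<in> topspace Y. w \<notin> N y} else {})"
    proof (rule Set.set_eqI)
      fix y
      show "y \<in> topspace Y \<inter> (\<lambda>y. w \<in> N y) -` U \<longleftrightarrow>
          y \<in> (if True \<in> U then {y \<in> topspace Y. w \<in> N y} else {}) \<union>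
            (if False \<in> U then {y \<in> topspace Y. w \<notin> N y} else {})"
        by (cases "w \<in> N y") auto
    qed
    then show "openin Y (topspace Y \<inter> (\<lambda>y. w \<in> N y) -` U)"
      using clopen[OF w] by (simp add: openin_Un)
  qed auto
  then have "continuous_map Y (subtopology ?P ?T) (\<lambda>y. snd (marked_point k (N y)))"
    using N by (auto simp: continuous_map_in_subtopology continuous_map_componentwise marked_point_def
        extensional_def)
  moreover have "continuous_map (subtopology ?P ?T) marked_groups (\<lambda>\<xi>. (k, \<xi>))"
    unfolding marked_groups_def by (rule continuous_map_component_injection) simp
  ultimately have "continuous_map Y marked_groups ((\<lambda>\<xi>. (k, \<xi>)) \<circ> (\<lambda>y. snd (marked_point k (N y))))"
    by (rule continuous_map_compose)
  then show ?thesis by (simp add: comp_def marked_point_def)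
qed

lemma finite_index_normally_finitely_generated:
  assumes M: "M \<lhd> free_group k" and fin: "finite (carrier (free_group k Mod M))"
  shows "normally_finitely_generated (free_group k) M"
proof -
  have "group_hom (free_group k) (free_group k Mod M) (\<lambda>x. M #>\<^bsub>free_group k\<^esub> x)"
    by (rule group.normal_hom_Mod[OF group_free_group M])
  from finite_image_imp_kernel_normally_finitely_generated[OF this] show ?thesis
    using fin group.kernel_Mod[OF group_free_group M] by (simp add: carrier_FactGroup)
qed

lemma residually_finite_iff:
  assumes "N \<lhd> free_group k"
  shows "residually finite_group (free_group k Mod N) \<longleftrightarrow> (\<forall>w \<in> carrier (free_group k) - N.
    \<exists>M. M \<lhd> free_group k \<and> N \<subseteq> M \<and> w \<notin> M \<and> finite (carrier (free_group k Mod M)))"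
  by (rule residually_Mod_iff[OF group_free_group assms]) (rule finite_group_iff_kernel)

lemma residually_nilpotent_iff:
  assumes "N \<lhd> free_group k"
  shows "residually nilpotent_group (free_group k Mod N) \<longleftrightarrow> (\<forall>w \<in> carrier (free_group k) - N.
    \<exists>M. M \<lhd> free_group k \<and> N \<subseteq> M \<and> w \<notin> M \<and> (\<exists>c. lower_central (free_group k) c \<subseteq> M))"
  by (rule residually_Mod_iff[OF group_free_group assms]) (rule nilpotent_group_iff_kernel)

lemma residually_finitely_presentable_iff:
  assumes "N \<lhd> free_group k"
  shows "residually finitely_presentable (free_group k Mod N) \<longleftrightarrow> (\<forall>w \<in> carrier (free_group k) - N.
    \<exists>M. M \<lhd> free_group k \<and> N \<subseteq> M \<and> w \<notin> M \<and> normally_finitely_generated (free_group k) M)"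
  by (rule residually_Mod_iff[OF group_free_group assms]) (rule finitely_presentable_iff_kernel)

lemma countable_normally_finitely_generated:
  "countable {M. normally_finitely_generated (free_group k) M}"
proof -
  have "countable (normal_closure (free_group k) ` {R :: word set. finite R})"
    using countable_Collect_finite by (rule countable_image)
  then show ?thesis
    by (rule countable_subset[rotated]) (auto simp: normally_finitely_generated_def)
qed

text \<open>\<open>N \<subseteq> M\<close> is disjointness from the complement of \<open>M\<close>,
  and \<open>D\<close> admits only countably many \<open>M\<close>, one for each finite set of
  normal generators.\<close>

lemma pi0_in_3_residually:
  fixes D :: "nat \<Rightarrow> word set \<Rightarrow> bool"
  assumes iff: "\<And>k N. N \<lhd> free_group k \<Longrightarrow> P (free_group k Mod N) \<longleftrightarrow>
      (\<forall>w \<in> carrier (free_group k) - N. \<exists>M. M \<lhd> free_group k \<and> N \<subseteq> M \<and> w \<notin> M \<and> D k M)"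
    and D: "\<And>k M. M \<lhd> free_group k \<Longrightarrow> D k M \<Longrightarrow> normally_finitely_generated (free_group k) M"
  shows "pi0_in marked_groups 3 (marked_groups_with P)"
proof -
  define \<W> where "\<W> k w = (\<lambda>M. carrier (free_group k) - M) ` {M. M \<lhd> free_group k \<and> w \<notin> M \<and> D k M}" for k w
  have "countable (\<W> k w)" for k w
    unfolding \<W>_def using D
    by (intro countable_image countable_subset[OF _ countable_normally_finitely_generated[of k]]) auto
  moreover have "P (free_group k Mod N) \<longleftrightarrow> (\<forall>w \<in> carrier (free_group k) - N. \<exists>W \<in> \<W> k w. N \<inter> W = {})"
    if N: "N \<lhd> free_group k" for k N
  proof -
    have "N \<inter> (carrier (free_group k) - M) = {} \<longleftrightarrow> N \<subseteq> M" for M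
      using subgroup.subset[OF normal_imp_subgroup[OF N]] by blast
    then show ?thesis unfolding iff[OF N] \<W>_def by (intro ball_cong refl) auto
  qed
  then have "marked_groups_with P = {marked_point k N |k N. N \<lhd> free_group k \<and>
      (\<forall>w \<in> carrier (free_group k) - N. \<exists>W \<in> \<W> k w. N \<inter> W = {})}"
    unfolding marked_groups_with_def by (intro Collect_cong ex_cong1 conj_cong refl)
  ultimately show ?thesis using pi0_in_3_marked_groups[of \<W>] by simp
qed

text \<open>For each \<open>c\<close> there is a least candidate \<open>M\<close>, the product of
  \<open>N\<close> with the \<open>c\<close>-th lower central term, so the index \<open>c\<close>
  can stand for all \<open>M\<close>. The word \<open>w\<close> avoids this product iff no
  \<open>w\<close> times the inverse of \<open>v\<close>, with \<open>v\<close> in that term, lies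
  in \<open>N\<close>.\<close>

lemma pi0_in_3_residually_nilpotent:
  "pi0_in marked_groups 3 (marked_groups_with (residually nilpotent_group))"
proof -
  define \<W> where "\<W> k w = range (\<lambda>c. (\<lambda>v. w \<otimes>\<^bsub>free_group k\<^esub> inv\<^bsub>free_group k\<^esub> v) ` lower_central (free_group k) c)" for k w
  have "residually nilpotent_group (free_group k Mod N) \<longleftrightarrow>
      (\<forall>w \<in> carrier (free_group k) - N. \<exists>W \<in> \<W> k w. N \<inter> W = {})"
    if N: "N \<lhd> free_group k" for k N
    unfolding residually_nilpotent_iff[OF N]
  proof (intro ball_cong refl)
    fix w assume "w \<in> carrier (free_group k) - N"
    then have w: "w \<in> carrier (free_group k)" by simp
    let ?F = "free_group k"
    interpret \<pi>: group_hom ?F "?F Mod N" "\<lambda>x. N #>\<^bsub>?F\<^esub> x"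
      by (rule group.normal_hom_Mod[OF group_free_group N])
    show "(\<exists>M. M \<lhd> ?F \<and> N \<subseteq> M \<and> w \<notin> M \<and> (\<exists>c. lower_central ?F c \<subseteq> M)) \<longleftrightarrow>
        (\<exists>W \<in> \<W> k w. N \<inter> W = {})" (is "?L \<longleftrightarrow> ?R")
    proof
      assume ?L
      then obtain M c where M: "M \<lhd> ?F" "N \<subseteq> M" "w \<notin> M" "lower_central ?F c \<subseteq> M" by blast
      interpret M: normal M ?F by fact
      have "w \<otimes>\<^bsub>?F\<^esub> inv\<^bsub>?F\<^esub> v \<notin> N" if v: "v \<in> lower_central ?F c" for v
      proof
        assume "w \<otimes>\<^bsub>?F\<^esub> inv\<^bsub>?F\<^esub> v \<in> N"
        then have "w \<otimes>\<^bsub>?F\<^esub> inv\<^bsub>?F\<^esub> v \<otimes>\<^bsub>?F\<^esub> v \<in> M" using M v by (blast intro: M.m_closed)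
        moreover have "v \<in> carrier ?F" using M(4) v M.mem_carrier by blast
        ultimately show False using M(3) w by (simp add: \<pi>.G.m_assoc)
      qed
      then show ?R unfolding \<W>_def by blast
    next
      assume ?R
      then obtain c where c: "\<And>v. v \<in> lower_central ?F c \<Longrightarrow> w \<otimes>\<^bsub>?F\<^esub> inv\<^bsub>?F\<^esub> v \<notin> N"
        unfolding \<W>_def by blast
      let ?L = "lower_central ?F c"
      interpret L: normal ?L ?F by (rule lower_central_normal[OF group_free_group])
      interpret N: normal N ?F by (rule N)
      \<comment> \<open>\<open>?M\<close> is the product of \<open>N\<close> and \<open>?L\<close>,
        written as the preimage of an image so that normality comes from the general lemmas.\<close>
      let ?K = "(\<lambda>x. N #>\<^bsub>?F\<^esub> x) ` ?L" and ?M = "{x \<in> carrier ?F. N #>\<^bsub>?F\<^esub> x \<in> (\<lambda>x. N #>\<^bsub>?F\<^esub> x) ` ?L}"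
      have "?K \<lhd> ?F Mod N"
        by (rule \<pi>.surj_normal_image[OF _ L.normal_axioms]) (simp add: carrier_FactGroup)
      then have "?M \<lhd> ?F" by (rule \<pi>.normal_vimage)
      moreover have "?L \<subseteq> ?M" using L.subset by blast
      moreover have "N \<subseteq> ?M"
      proof
        fix x assume x: "x \<in> N"
        then have "N #>\<^bsub>?F\<^esub> x = N #>\<^bsub>?F\<^esub> \<one>\<^bsub>?F\<^esub>"
          using \<pi>.G.rcos_eq_iff[OF N, of x "\<one>\<^bsub>?F\<^esub>"] N.mem_carrier by simp
        then show "x \<in> ?M" using L.one_closed N.mem_carrier[OF x] by blast
      qed
      moreover have "w \<notin> ?M"
        using c \<pi>.G.rcos_eq_iff[OF N w] L.mem_carrier by blast
      ultimately show "\<exists>M. M \<lhd> ?F \<and> N \<subseteq> M \<and> w \<notin> M \<and> (\<exists>c. lower_central ?F c \<subseteq> M)"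
        by blast
    qed
  qed
  then have "marked_groups_with (residually nilpotent_group) = {marked_point k N |k N. N \<lhd> free_group k \<and>
      (\<forall>w \<in> carrier (free_group k) - N. \<exists>W \<in> \<W> k w. N \<inter> W = {})}"
    unfolding marked_groups_with_def by (intro Collect_cong ex_cong1 conj_cong refl)
  moreover have "countable (\<W> k w)" for k w unfolding \<W>_def by simp
  ultimately show ?thesis using pi0_in_3_marked_groups[of \<W>] by simp
qed

section \<open>Laurent polynomials over the field with two elements\<close>

type_synonym laurent = "int \<Rightarrow>\<^sub>0 bit"

abbreviation X :: "int \<Rightarrow> laurent" where
  "X i \<equiv> Poly_Mapping.single i 1"

lemma X_add: "X (i + j) = X i * X j"
  by (simp add: mult_single)

lemma X_mult_inverse: "X i * X (- i) = 1"
  by (simp add: mult_single)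

lemma laurent_two: "(2 :: laurent) = 0"
proof -
  have "(1 :: laurent) + 1 = 0"
    by (rule poly_mapping_eqI) (simp only: lookup_add, simp)
  then show ?thesis by simp
qed

lemma laurent_add_self: "f + f = (0 :: laurent)"
  using laurent_two by (simp add: mult_2[symmetric] del: mult_2)

lemma laurent_uminus: "- f = (f :: laurent)"
  using laurent_add_self[of f] by (simp add: minus_unique)

lemma laurent_diff: "f - g = f + (g :: laurent)"
  using laurent_uminus[of g] by (metis diff_conv_add_uminus)

lemma lookup_laurent: "k \<in> Poly_Mapping.keys f \<Longrightarrow> Poly_Mapping.lookup f k = (1 :: bit)"
  by (simp add: in_keys_iff)

lemma laurent_keys_inject: "Poly_Mapping.keys f = Poly_Mapping.keys g \<Longrightarrow> f = (g :: laurent)"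
  by (rule poly_mapping_eqI) (metis in_keys_iff bit_not_one_iff)

lemma finite_laurent_keys_subset:
  assumes "finite S"
  shows "finite {f :: laurent. Poly_Mapping.keys f \<subseteq> S}"
proof (rule finite_imageD)
  show "finite (Poly_Mapping.keys ` {f :: laurent. Poly_Mapping.keys f \<subseteq> S})"
    using assms by (rule finite_subset[rotated, OF finite_Pow_iff[THEN iffD2]]) auto
  show "inj_on Poly_Mapping.keys {f :: laurent. Poly_Mapping.keys f \<subseteq> S}"
    by (rule inj_onI) (rule laurent_keys_inject)
qed

text \<open>Every nonzero coefficient is 1, so adding monomials one at a time reaches every
  polynomial.\<close>

lemma laurent_induct [case_names zero add]:
  assumes "P 0" and add: "\<And>f k. P f \<Longrightarrow> P (f + X k)"
  shows "P (f :: laurent)"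
proof (induction f rule: update_induct)
  case const
  then show ?case by (rule assms(1))
next
  case (update f k v)
  have "Poly_Mapping.update k v f = f + X k"
    using update by (intro poly_mapping_eqI) (auto simp: lookup_update lookup_add lookup_single when_def in_keys_iff)
  then show ?case using add update by simp
qed

lemma X_minus_one_dvd: "(X d - 1) dvd (X (d * m) - 1)"
proof -
  have nat: "(X d - 1) dvd (X (d * int n) - 1)" for n
  proof (induction n)
    case (Suc n)
    have eq: "X (d * int (Suc n)) - 1 = X d * (X (d * int n) - 1) + (X d - 1)"
      by (simp add: X_add[symmetric] right_diff_distrib ring_distribs del: single_one)
    show ?case unfolding eq by (intro dvd_add dvd_mult Suc dvd_refl)
  qed simp
  show ?thesis
  proof (cases "m \<ge> 0")
    case True
    then show ?thesis using nat[of "nat m"] by simp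
  next
    case False
    have "X (d * m) - 1 = - X (d * m) * (X (d * - m) - 1)"
      using X_mult_inverse[of "d * m"] by (simp add: right_diff_distrib)
    then show ?thesis using nat[of "nat (- m)"] False by simp
  qed
qed

text \<open>Frobenius. It identifies \<open>(X 1 - 1) ^ 2 ^ r\<close>, which measures depth in the
  lower central series, with \<open>X (2 ^ r) - 1\<close>, which measures periodicity.\<close>

lemma one_plus_X_power: "(1 + X 1) ^ 2 ^ r = 1 + X (2 ^ r)"
proof (induction r)
  case (Suc r)
  have sq: "X (2 ^ r) * X (2 ^ r) = X (2 ^ Suc r)" by (simp flip: X_add)
  have "(1 + X 1) ^ 2 ^ Suc r = (1 + X (2 ^ r)) * (1 + X (2 ^ r))"
    using Suc by (simp add: power_mult power2_eq_square mult.commute[of 2])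
  also have "\<dots> = 1 + X (2 ^ r) * X (2 ^ r) + 2 * X (2 ^ r)"
    by (simp only: distrib_left distrib_right mult_1 mult_1_right mult_2 add.assoc add.left_commute add.commute)
  finally show ?case by (simp add: laurent_two sq)
qed simp

section \<open>Reduction of Laurent polynomials modulo \<open>X d - 1\<close>\<close>

text \<open>The coefficient at the class of \<open>i\<close> after passing to the quotient by
  \<open>X d - 1\<close>, the group ring of the integers modulo \<open>d\<close>. It serves as an
  additive test that refutes divisibility.\<close>

definition residue_sum :: "int \<Rightarrow> int \<Rightarrow> laurent \<Rightarrow> bit" where
  "residue_sum d i f = (\<Sum>k \<in> Poly_Mapping.keys f. if d dvd k - i then Poly_Mapping.lookup f k else 0)"

lemma residue_sum_add: "residue_sum d i (f + g) = residue_sum d i f + residue_sum d i g"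
  unfolding residue_sum_def
  by (rule setsum_keys_plus_distrib[of "\<lambda>k v. if d dvd k - i then v else 0"]) auto

lemma residue_sum_X: "residue_sum d i (X k) = (if d dvd k - i then 1 else 0)"
  by (simp add: residue_sum_def)

lemma residue_sum_shift: "residue_sum d i (X d * f) = residue_sum d i f"
proof (induction f rule: laurent_induct)
  case (add f k)
  have "d dvd d + k - i \<longleftrightarrow> d dvd k - i"
    by (metis add_diff_eq dvd_add_triv_left_iff)
  then show ?case
    using add by (simp add: distrib_left residue_sum_add residue_sum_X flip: X_add)
qed (simp add: residue_sum_def)

lemma residue_sum_dvd:
  assumes "(X d - 1) dvd f"
  shows "residue_sum d i f = 0"
proof -
  obtain q where "f = (X d - 1) * q" using assms by (rule dvdE)
  then have "f = X d * q + q" by (simp add: laurent_diff distrib_right)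
  then show ?thesis by (simp add: residue_sum_add residue_sum_shift)
qed

lemma residue_sum_eq_0: "(\<And>k. k \<in> Poly_Mapping.keys f \<Longrightarrow> \<not> d dvd k - i) \<Longrightarrow> residue_sum d i f = 0"
  unfolding residue_sum_def by (rule sum.neutral) auto

lemma residue_sum_eq_1:
  assumes "i \<in> Poly_Mapping.keys f" and "\<And>k. k \<in> Poly_Mapping.keys f \<Longrightarrow> k \<noteq> i \<Longrightarrow> \<not> d dvd k - i"
  shows "residue_sum d i f = 1"
proof -
  have "residue_sum d i f = (\<Sum>k \<in> {i}. if d dvd k - i then Poly_Mapping.lookup f k else 0)"
    unfolding residue_sum_def using assms by (intro sum.mono_neutral_right) auto
  then show ?thesis using lookup_laurent[OF assms(1)] by simp
qed

lemma reduced_residue_exists: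
  assumes "d > 0"
  shows "\<exists>g. Poly_Mapping.keys g \<subseteq> {0..<d} \<and> (X d - 1) dvd (f - g)"
proof (induction f rule: laurent_induct)
  case zero
  show ?case by (rule exI[of _ 0]) simp
next
  case (add f k)
  then obtain g where g: "Poly_Mapping.keys g \<subseteq> {0..<d}" "(X d - 1) dvd (f - g)" by blast
  have "X k - X (k mod d) = X (k mod d) * (X (d * (k div d)) - 1)"
    by (simp add: right_diff_distrib flip: X_add)
  then have "(X d - 1) dvd (X k - X (k mod d))"
    using X_minus_one_dvd[of d "k div d"] by simp
  then have "(X d - 1) dvd ((f - g) + (X k - X (k mod d)))" using g(2) by (rule dvd_add[rotated])
  then have "(X d - 1) dvd (f + X k - (g + X (k mod d)))" by (simp add: algebra_simps)
  moreover have "Poly_Mapping.keys (g + X (k mod d)) \<subseteq> {0..<d}"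
    using keys_add[of g "X (k mod d)"] g(1) assms by auto
  ultimately show ?case by blast
qed

section \<open>A central extension of a lamplighter group\<close>

type_synonym hall = "int \<times> laurent \<times> laurent \<times> laurent"

text \<open>The quadruple \<open>(n, f, g, h)\<close> is the matrix with rows \<open>1, f, h\<close>
  and \<open>0, X n, g\<close> and \<open>0, 0, 1\<close>. Storing \<open>n\<close> instead of
  \<open>X n\<close> makes the exponent of \<open>t\<close> the first component, which is
  additive.\<close>

fun hall_mult :: "hall \<Rightarrow> hall \<Rightarrow> hall" where
  "hall_mult (n, f, g, h) (n', f', g', h') =
     (n + n', f' + f * X n', g + X n * g', h + h' + f * g')"

definition hall_group :: "hall monoid" where
  "hall_group = \<lparr>carrier = UNIV, mult = hall_mult, one = (0, 0, 0, 0)\<rparr>"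

lemma carrier_hall [simp]: "carrier hall_group = UNIV"
  and mult_hall [simp]: "x \<otimes>\<^bsub>hall_group\<^esub> y = hall_mult x y"
  and one_hall [simp]: "\<one>\<^bsub>hall_group\<^esub> = (0, 0, 0, 0)"
  by (simp_all add: hall_group_def)

lemma X_cancel: "X n * (X (- n) * f) = f" "X (- n) * (X n * f) = f"
  by (simp_all add: mult.assoc[symmetric] flip: X_add)

definition hall_inv :: "hall \<Rightarrow> hall" where
  "hall_inv = (\<lambda>(n, f, g, h). (- n, - f * X (- n), - X (- n) * g, - h + f * X (- n) * g))"

lemma group_hall: "group hall_group"
proof (rule groupI)
  fix x :: hall
  obtain n f g h where "x = (n, f, g, h)" by (cases x)
  then have "hall_mult (hall_inv x) x = (0, 0, 0, 0)"
    by (simp add: hall_inv_def X_cancel algebra_simps flip: X_add)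
  then show "\<exists>y \<in> carrier hall_group. y \<otimes>\<^bsub>hall_group\<^esub> x = \<one>\<^bsub>hall_group\<^esub>"
    by (intro bexI[of _ "hall_inv x"]) simp_all
next
  fix x y z :: hall
  show "x \<otimes>\<^bsub>hall_group\<^esub> y \<otimes>\<^bsub>hall_group\<^esub> z = x \<otimes>\<^bsub>hall_group\<^esub> (y \<otimes>\<^bsub>hall_group\<^esub> z)"
    by (cases x; cases y; cases z) (simp add: X_add algebra_simps)
qed auto

interpretation hall: group hall_group
  by (rule group_hall)

lemma inv_hall: "inv\<^bsub>hall_group\<^esub> (n, f, g, h) = (- n, - f * X (- n), - X (- n) * g, - h + f * X (- n) * g)"
  by (rule hall.inv_equality) (simp_all add: X_cancel algebra_simps flip: X_add)

text \<open>Two special cases drive everything: powers of \<open>t\<close> scale \<open>f\<close> by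
  \<open>X (- p)\<close> and \<open>g\<close> by \<open>X p\<close> and leave \<open>h\<close> alone
  when \<open>n = 0\<close>, and elements with \<open>n = 0\<close>, \<open>f = 0\<close>,
  \<open>g = 0\<close> are fixed, so they are central.\<close>

lemma hall_conj:
  "(p, F, G, H) \<otimes>\<^bsub>hall_group\<^esub> (n, f, g, h) \<otimes>\<^bsub>hall_group\<^esub> inv\<^bsub>hall_group\<^esub> (p, F, G, H) =
    (n, X (- p) * (f + F * (X n - 1)), X p * g - (X n - 1) * G,
     h + F * g - X (- p) * F * G * (X n - 1) - X (- p) * f * G)"
proof -
  have "X (- p) * X (n + p) = X n" "X (n + p) * X (- p) = X n" by (simp_all flip: X_add)
  then show ?thesis
    by (simp add: inv_hall algebra_simps)
qed

lemma hall_comm: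
  "(0, f, g, h) \<otimes>\<^bsub>hall_group\<^esub> (p, F, G, H) \<otimes>\<^bsub>hall_group\<^esub> inv\<^bsub>hall_group\<^esub> (0, f, g, h)
      \<otimes>\<^bsub>hall_group\<^esub> inv\<^bsub>hall_group\<^esub> (p, F, G, H) =
    (0, f * (1 - X (- p)), g * (1 - X p), f * g * (1 - X p) - F * g + X (- p) * f * G)"
proof -
  have inv: "inv\<^bsub>hall_group\<^esub> (0, f, g, h) = (0, - f, - g, - h + f * g)"
    by (simp add: inv_hall)
  have "(0, f, g, h) \<otimes>\<^bsub>hall_group\<^esub> (p, F, G, H) \<otimes>\<^bsub>hall_group\<^esub> inv\<^bsub>hall_group\<^esub> (0, f, g, h)
      \<otimes>\<^bsub>hall_group\<^esub> inv\<^bsub>hall_group\<^esub> (p, F, G, H) =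
    (0, f, g, h) \<otimes>\<^bsub>hall_group\<^esub> ((p, F, G, H) \<otimes>\<^bsub>hall_group\<^esub> inv\<^bsub>hall_group\<^esub> (0, f, g, h)
      \<otimes>\<^bsub>hall_group\<^esub> inv\<^bsub>hall_group\<^esub> (p, F, G, H))"
    by (simp add: hall.m_assoc del: mult_hall)
  also have "\<dots> = (0, f * (1 - X (- p)), g * (1 - X p), f * g * (1 - X p) - F * g + X (- p) * f * G)"
    unfolding inv hall_conj by (simp add: algebra_simps)
  finally show ?thesis .
qed

lemma hall_t_power: "(1, 0, 0, 0) [^]\<^bsub>hall_group\<^esub> (i :: int) = (i, 0, 0, 0)"
proof -
  have "(1, 0, 0, 0) [^]\<^bsub>hall_group\<^esub> n = (int n, 0, 0, 0)" for n :: nat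
    by (induction n) simp_all
  then show ?thesis by (cases "i < 0") (simp_all add: int_pow_def2 inv_hall)
qed

section \<open>The map from the free group on three generators\<close>

definition to_hall :: "word \<Rightarrow> hall" where
  "to_hall = word_value hall_group [(0, 1, 0, 0), (0, 0, 1, 0), (1, 0, 0, 0)]"

abbreviation F3 :: "word monoid" where
  "F3 \<equiv> free_group 3"

interpretation to_hall: group_hom F3 hall_group to_hall
  unfolding to_hall_def by (rule hall.word_value_hom) auto

abbreviation wa :: word where "wa \<equiv> [(0, True)]"
abbreviation wb :: word where "wb \<equiv> [(Suc 0, True)]"
abbreviation wt :: word where "wt \<equiv> [(2, True)]"

lemma to_hall_gens: "to_hall wa = (0, 1, 0, 0)" "to_hall wb = (0, 0, 1, 0)" "to_hall wt = (1, 0, 0, 0)"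
  by (simp_all add: to_hall_def hall.word_value_gen)

lemma gens_closed [simp]: "wa \<in> carrier F3" "wb \<in> carrier F3" "wt \<in> carrier F3"
  by (simp_all add: letter_closed)

definition conj_t :: "int \<Rightarrow> word \<Rightarrow> word" where
  "conj_t i w = wt [^]\<^bsub>F3\<^esub> i \<otimes>\<^bsub>F3\<^esub> w \<otimes>\<^bsub>F3\<^esub> inv\<^bsub>F3\<^esub> (wt [^]\<^bsub>F3\<^esub> i)"

lemma conj_t_closed: "w \<in> carrier F3 \<Longrightarrow> conj_t i w \<in> carrier F3"
  by (simp add: conj_t_def)

lemma to_hall_t_power: "to_hall (wt [^]\<^bsub>F3\<^esub> (i :: int)) = (i, 0, 0, 0)"
  by (simp add: to_hall.hom_int_pow to_hall_gens hall_t_power)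

lemma to_hall_conj_t:
  assumes "w \<in> carrier F3" "to_hall w = (0, f, g, h)"
  shows "to_hall (conj_t i w) = (0, X (- i) * f, X i * g, h)"
  using assms
  by (simp add: conj_t_def to_hall_t_power hall_conj del: mult_hall)

definition commutator :: "('a, 'b) monoid_scheme \<Rightarrow> 'a \<Rightarrow> 'a \<Rightarrow> 'a" where
  "commutator G x y = x \<otimes>\<^bsub>G\<^esub> y \<otimes>\<^bsub>G\<^esub> inv\<^bsub>G\<^esub> x \<otimes>\<^bsub>G\<^esub> inv\<^bsub>G\<^esub> y"

lemma (in group) commutator_closed: "x \<in> carrier G \<Longrightarrow> y \<in> carrier G \<Longrightarrow> commutator G x y \<in> carrier G"
  by (simp add: commutator_def)

lemma (in group_hom) hom_commutator:
  "x \<in> carrier G \<Longrightarrow> y \<in> carrier G \<Longrightarrow> h (commutator G x y) = commutator H (h x) (h y)"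
  by (simp add: commutator_def)

lemma (in normal) commutator_mem:
  assumes "x \<in> H" "y \<in> carrier G"
  shows "commutator G x y \<in> H"
proof -
  have "x \<otimes> (y \<otimes> inv x \<otimes> inv y) \<in> H"
    using assms inv_op_closed2 m_inv_closed m_closed by blast
  then show ?thesis
    using assms mem_carrier[OF assms(1)] by (simp add: commutator_def m_assoc)
qed

lemma commutator_hall:
  "commutator hall_group (0, f, g, h) (p, F, G, H) =
    (0, f * (1 - X (- p)), g * (1 - X p), f * g * (1 - X p) - F * g + X (- p) * f * G)"
  unfolding commutator_def by (rule hall_comm)

definition central_word :: "int \<Rightarrow> word" where
  "central_word i = commutator F3 wa (conj_t i wb)"

lemma central_word_closed: "central_word i \<in> carrier F3"
  unfolding central_word_def by (intro to_hall.G.commutator_closed conj_t_closed gens_closed)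

lemma to_hall_central_word: "to_hall (central_word i) = (0, 0, 0, X i)"
  unfolding central_word_def
  by (simp add: to_hall.hom_commutator conj_t_closed to_hall_conj_t[OF _ to_hall_gens(2)] to_hall_gens
      commutator_hall)

text \<open>The kernel of the map from \<open>F3\<close> to the matrix group modulo the span of the
  \<open>z_i\<close> with \<open>i \<in> K\<close>; \<open>K = {}\<close> gives the relations of the
  matrix group itself.\<close>

definition hall_relations :: "int set \<Rightarrow> word set" where
  "hall_relations K = {w \<in> carrier F3. to_hall w \<in> {(0, 0, 0, h) |h. Poly_Mapping.keys h \<subseteq> K}}"

text \<open>The subgroup divided out is central, so no invariance of \<open>K\<close> under shifts
  is required.\<close>

lemma hall_relations_normal: "hall_relations K \<lhd> F3"
proof -
  let ?Z = "{(0 :: int, 0 :: laurent, 0 :: laurent, h :: laurent) |h. Poly_Mapping.keys h \<subseteq> K}"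
  have "subgroup ?Z hall_group"
  proof (rule hall.subgroupI)
    show "?Z \<noteq> {}" by (auto intro: exI[of _ 0])
  next
    fix x assume "x \<in> ?Z"
    then show "inv\<^bsub>hall_group\<^esub> x \<in> ?Z" by (auto simp: inv_hall laurent_uminus)
  next
    fix x y assume "x \<in> ?Z" "y \<in> ?Z"
    then obtain h h' where "x = (0, 0, 0, h)" "y = (0, 0, 0, h')" "Poly_Mapping.keys h \<subseteq> K" "Poly_Mapping.keys h' \<subseteq> K"
      by blast
    then show "x \<otimes>\<^bsub>hall_group\<^esub> y \<in> ?Z" using keys_add[of h h'] by auto
  qed simp
  then have "?Z \<lhd> hall_group"
    by (rule hall.normal_invI) (auto simp: hall_conj simp del: mult_hall)
  then show ?thesis unfolding hall_relations_def by (rule to_hall.normal_vimage)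
qed

section \<open>The lower central series of the matrix group\<close>

text \<open>The entry \<open>h\<close> lags one power behind: a commutator multiplies
  \<open>f\<close> and \<open>g\<close> by a multiple of \<open>X 1 - 1\<close>, but contributes
  \<open>F * g\<close> and \<open>f * G\<close> to \<open>h\<close> without a new factor. At
  \<open>j = 0\<close> truncated subtraction imposes no condition on \<open>h\<close>.\<close>

definition filtration :: "nat \<Rightarrow> hall set" where
  "filtration j = {(0, f, g, h) |f g h. (X 1 - 1) ^ j dvd f \<and> (X 1 - 1) ^ j dvd g \<and> (X 1 - 1) ^ (j - 1) dvd h}"

lemma filtration_subgroup: "subgroup (filtration j) hall_group"
proof (rule hall.subgroupI)
  have dvd: "(X 1 - 1) ^ (j - 1) dvd f * g" if "(X 1 - 1) ^ j dvd f" for f g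
    using that by (meson dvd_mult2 dvd_trans le_imp_power_dvd diff_le_self)
  fix x y assume "x \<in> filtration j" and "y \<in> filtration j"
  then show "x \<otimes>\<^bsub>hall_group\<^esub> y \<in> filtration j"
    using dvd by (auto simp: filtration_def)
next
  have dvd: "(X 1 - 1) ^ (j - 1) dvd f * g" if "(X 1 - 1) ^ j dvd f" for f g
    using that by (meson dvd_mult2 dvd_trans le_imp_power_dvd diff_le_self)
  fix x assume "x \<in> filtration j"
  then show "inv\<^bsub>hall_group\<^esub> x \<in> filtration j"
    using dvd by (auto simp: filtration_def inv_hall)
qed (auto simp: filtration_def)

lemma commutator_filtration:
  assumes "x \<in> filtration j"
  shows "commutator hall_group x y \<in> filtration (Suc j)"
proof -
  obtain f g h where x: "x = (0, f, g, h)" and dvd: "(X 1 - 1) ^ j dvd f" "(X 1 - 1) ^ j dvd g"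
    using assms by (auto simp: filtration_def)
  obtain p F G H where y: "y = (p, F, G, H)" by (cases y)
  have E: "(X 1 - 1) dvd (1 - X q)" for q
  proof -
    have "(X 1 - 1) dvd - (1 - X q)" using X_minus_one_dvd[of 1 q] by simp
    then show ?thesis by (simp only: dvd_minus_iff)
  qed
  have "(X 1 - 1) ^ Suc j dvd f * (1 - X (- p))" "(X 1 - 1) ^ Suc j dvd g * (1 - X p)"
    unfolding power_Suc2 by (intro mult_dvd_mono dvd E)+
  moreover have "(X 1 - 1) ^ j dvd f * g * (1 - X p) - F * g + X (- p) * f * G"
    using dvd by (intro dvd_add dvd_diff) (auto intro: dvd_mult dvd_mult2)
  ultimately show ?thesis unfolding x y commutator_hall filtration_def by auto
qed

text \<open>The index shifts by one because the first commutator is spent on removing the exponent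
  of \<open>t\<close>; the full group does not lie in \<open>filtration 0\<close>.\<close>

lemma lower_central_hall: "lower_central hall_group (Suc j) \<subseteq> filtration j"
proof (induction j)
  case 0
  have "x \<otimes>\<^bsub>hall_group\<^esub> y \<otimes>\<^bsub>hall_group\<^esub> inv\<^bsub>hall_group\<^esub> x \<otimes>\<^bsub>hall_group\<^esub> inv\<^bsub>hall_group\<^esub> y \<in> filtration 0" for x y
    by (cases x; cases y) (simp add: inv_hall filtration_def)
  then show ?case
    unfolding lower_central.simps
    by (intro hall.generate_subgroup_incl filtration_subgroup) blast
next
  case (Suc j)
  show ?case
    unfolding lower_central.simps(2)[of _ "Suc j"]
    by (intro hall.generate_subgroup_incl filtration_subgroup)
      (use Suc commutator_filtration in \<open>auto simp: commutator_def simp del: mult_hall\<close>)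
qed

text \<open>The variant of \<open>lower_central_image\<close> for a map that has not been shown to
  be onto, such as \<open>to_hall\<close>.\<close>

lemma lower_central_hom:
  assumes "group_hom G H h"
  shows "h ` lower_central G n \<subseteq> lower_central H n"
proof (induction n)
  case 0
  then show ?case using assms by (auto simp: group_hom.hom_closed)
next
  case (Suc n)
  interpret h: group_hom G H h by fact
  have sub: "lower_central G n \<subseteq> carrier G"
    using lower_central_normal[OF h.G.is_group] normal_imp_subgroup subgroup.subset by blast
  let ?K = "{x \<otimes>\<^bsub>G\<^esub> y \<otimes>\<^bsub>G\<^esub> inv\<^bsub>G\<^esub> x \<otimes>\<^bsub>G\<^esub> inv\<^bsub>G\<^esub> y |x y. x \<in> lower_central G n \<and> y \<in> carrier G}"
  have "h (x \<otimes>\<^bsub>G\<^esub> y \<otimes>\<^bsub>G\<^esub> inv\<^bsub>G\<^esub> x \<otimes>\<^bsub>G\<^esub> inv\<^bsub>G\<^esub> y) \<in> lower_central H (Suc n)"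
    if xy: "x \<in> lower_central G n" "y \<in> carrier G" for x y
  proof -
    have x: "x \<in> carrier G" "h x \<in> lower_central H n" "h y \<in> carrier H" using xy Suc.IH sub by auto
    have "h (x \<otimes>\<^bsub>G\<^esub> y \<otimes>\<^bsub>G\<^esub> inv\<^bsub>G\<^esub> x \<otimes>\<^bsub>G\<^esub> inv\<^bsub>G\<^esub> y) =
        h x \<otimes>\<^bsub>H\<^esub> h y \<otimes>\<^bsub>H\<^esub> inv\<^bsub>H\<^esub> h x \<otimes>\<^bsub>H\<^esub> inv\<^bsub>H\<^esub> h y"
      using x(1) xy(2) by simp
    then show ?thesis using x(2,3) unfolding lower_central.simps by (intro generate.incl) blast
  qed
  then have "h ` ?K \<subseteq> lower_central H (Suc n)" by blast
  moreover have "subgroup (lower_central H (Suc n)) H"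
    using lower_central_normal[OF h.H.is_group] normal_imp_subgroup by blast
  ultimately have "generate H (h ` ?K) \<subseteq> lower_central H (Suc n)"
    by (rule h.H.generate_subgroup_incl)
  moreover have "?K \<subseteq> carrier G" using sub by (auto simp: subset_iff)
  ultimately show ?case using h.generate_img[of ?K] by simp
qed

section \<open>Finite nilpotent quotients that separate points\<close>

text \<open>The kernel of imposing \<open>x^d = 1\<close> and killing the \<open>z_i\<close> with
  \<open>i \<in> K\<close>: the exponent is read modulo \<open>d\<close>, the entries modulo
  \<open>X d - 1\<close>, and the central entry moreover only up to a polynomial \<open>z\<close>
  supported in \<open>K\<close>.\<close>

definition congruence_subgroup :: "int \<Rightarrow> int set \<Rightarrow> hall set" where
  "congruence_subgroup d K = {(n, f, g, h) |n f g h. d dvd n \<and> (X d - 1) dvd f \<and> (X d - 1) dvd g \<and>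
     (\<exists>z. Poly_Mapping.keys z \<subseteq> K \<and> (X d - 1) dvd (h - z))}"

lemma X_minus_one_dvd': "d dvd n \<Longrightarrow> (X d - 1) dvd (X n - 1)"
  using X_minus_one_dvd by (metis dvdE)

lemma congruence_subgroupI:
  assumes "d dvd n" "(X d - 1) dvd f" "(X d - 1) dvd g" "Poly_Mapping.keys z \<subseteq> K" "(X d - 1) dvd (h - z)"
  shows "(n, f, g, h) \<in> congruence_subgroup d K"
  using assms unfolding congruence_subgroup_def by blast

lemma congruence_subgroup_normal: "congruence_subgroup d K \<lhd> hall_group"
proof -
  \<comment> \<open>Lets each divisibility be shown for a visible combination of known multiples,
    with the equality left to ring arithmetic.\<close>
  have dvd: "P dvd a" if "P dvd b" "a = b" for P a b :: laurent
    using that by simp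
  have "subgroup (congruence_subgroup d K) hall_group"
  proof (rule hall.subgroupI)
    have "(0, 0, 0, 0) \<in> congruence_subgroup d K"
      by (rule congruence_subgroupI[of _ _ _ _ 0]) simp_all
    then show "congruence_subgroup d K \<noteq> {}" by blast
  next
    fix x assume "x \<in> congruence_subgroup d K"
    then obtain n f g h z where x: "x = (n, f, g, h)" "d dvd n" "(X d - 1) dvd f" "(X d - 1) dvd g"
      and z: "Poly_Mapping.keys z \<subseteq> K" "(X d - 1) dvd (h - z)"
      by (auto simp: congruence_subgroup_def)
    have "(X d - 1) dvd (- h + f * X (- n) * g - z)"
    proof (rule dvd)
      show "(X d - 1) dvd (f * (X (- n) * g) - (h - z))" by (rule dvd_diff[OF dvd_mult2[OF x(3)] z(2)])
      show "- h + f * X (- n) * g - z = f * (X (- n) * g) - (h - z)"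
        by (simp only: laurent_diff laurent_uminus) (simp add: algebra_simps)
    qed
    then show "inv\<^bsub>hall_group\<^esub> x \<in> congruence_subgroup d K"
      unfolding x(1) inv_hall by (intro congruence_subgroupI[OF _ _ _ z(1)]) (use x in simp_all)
  next
    fix x y assume "x \<in> congruence_subgroup d K" "y \<in> congruence_subgroup d K"
    then obtain n f g h z n' f' g' h' z' where
      x: "x = (n, f, g, h)" "d dvd n" "(X d - 1) dvd f" "(X d - 1) dvd g"
        "Poly_Mapping.keys z \<subseteq> K" "(X d - 1) dvd (h - z)" and
      y: "y = (n', f', g', h')" "d dvd n'" "(X d - 1) dvd f'" "(X d - 1) dvd g'"
        "Poly_Mapping.keys z' \<subseteq> K" "(X d - 1) dvd (h' - z')"
      by (auto simp: congruence_subgroup_def)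
    have "(X d - 1) dvd (h + h' + f * g' - (z + z'))"
    proof (rule dvd)
      show "(X d - 1) dvd ((h - z) + (h' - z') + f * g')" using x y by (intro dvd_add dvd_mult2)
    qed (simp add: algebra_simps)
    moreover have "Poly_Mapping.keys (z + z') \<subseteq> K" using keys_add[of z z'] x(5) y(5) by blast
    ultimately show "x \<otimes>\<^bsub>hall_group\<^esub> y \<in> congruence_subgroup d K"
      unfolding x(1) y(1) mult_hall hall_mult.simps
      by (intro congruence_subgroupI dvd_add dvd_mult[OF y(4)] dvd_mult2[OF x(3)] x y)
  qed simp
  then show ?thesis
  proof (rule hall.normal_invI)
    fix y x :: hall assume "x \<in> congruence_subgroup d K"
    then obtain n f g h z where x: "x = (n, f, g, h)" "d dvd n" "(X d - 1) dvd f" "(X d - 1) dvd g"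
      and z: "Poly_Mapping.keys z \<subseteq> K" "(X d - 1) dvd (h - z)"
      by (auto simp: congruence_subgroup_def)
    obtain p F G H where y: "y = (p, F, G, H)" by (cases y)
    have n: "(X d - 1) dvd (X n - 1)" using x(2) by (rule X_minus_one_dvd')
    have "(X d - 1) dvd (h + F * g - X (- p) * F * G * (X n - 1) - X (- p) * f * G - z)"
    proof (rule dvd)
      show "(X d - 1) dvd ((h - z) + F * g - X (- p) * F * G * (X n - 1) - X (- p) * f * G)"
        by (intro dvd_diff[OF dvd_diff[OF dvd_add[OF z(2)]]] dvd_mult[OF x(4)] dvd_mult[OF n]
            dvd_mult2[OF dvd_mult[OF x(3)]])
    qed (simp add: algebra_simps)
    moreover have "(X d - 1) dvd (X (- p) * (f + F * (X n - 1)))" "(X d - 1) dvd (X p * g - (X n - 1) * G)"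
      by (rule dvd_mult[OF dvd_add[OF x(3) dvd_mult[OF n]]], rule dvd_diff[OF dvd_mult[OF x(4)] dvd_mult2[OF n]])
    ultimately show "y \<otimes>\<^bsub>hall_group\<^esub> x \<otimes>\<^bsub>hall_group\<^esub> inv\<^bsub>hall_group\<^esub> y \<in> congruence_subgroup d K"
      unfolding x(1) y hall_conj by (intro congruence_subgroupI[OF x(2) _ _ z(1)])
  qed
qed

lemma finite_image_of_factor:
  assumes "finite (r ` A)" and "\<And>x y. x \<in> A \<Longrightarrow> y \<in> A \<Longrightarrow> r x = r y \<Longrightarrow> g x = g y"
  shows "finite (g ` A)"
proof -
  have "g ` A \<subseteq> (\<lambda>v. g (inv_into A r v)) ` (r ` A)"
  proof
    fix z assume "z \<in> g ` A"
    then obtain x where x: "x \<in> A" "z = g x" by blast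
    then have "inv_into A r (r x) \<in> A" "r (inv_into A r (r x)) = r x"
      by (auto intro: inv_into_into f_inv_into_f)
    then show "z \<in> (\<lambda>v. g (inv_into A r v)) ` (r ` A)" using assms(2) x by (metis imageI)
  qed
  then show ?thesis using assms(1) finite_subset by blast
qed

lemma congruence_subgroup_finite_index:
  assumes d: "d > 0"
  shows "finite (carrier (F3 Mod {w \<in> carrier F3. to_hall w \<in> congruence_subgroup d K}))" (is "finite (carrier (F3 Mod ?M))")
proof -
  have M: "?M \<lhd> F3" by (rule to_hall.normal_vimage[OF congruence_subgroup_normal])
  obtain red where red: "\<And>f. Poly_Mapping.keys (red f) \<subseteq> {0..<d}" "\<And>f. (X d - 1) dvd (f - red f)"
    using reduced_residue_exists[OF d] by metis
  \<comment> \<open>Not a homomorphism, only an invariant with finitely many values that is fine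
    enough to determine the coset.\<close>
  define \<rho> where "\<rho> = (\<lambda>(n :: int, f, g, h). (n mod d, red f, red g, red h))"
  let ?R = "{f :: laurent. Poly_Mapping.keys f \<subseteq> {0..<d}}"
  have "range \<rho> \<subseteq> {0..<d} \<times> ?R \<times> ?R \<times> ?R"
    using red(1) d by (auto simp: \<rho>_def)
  moreover have "finite ({0..<d} \<times> ?R \<times> ?R \<times> ?R)" by (simp add: finite_laurent_keys_subset)
  ultimately have fin: "finite (range \<rho>)" by (rule finite_subset)
  have same: "x \<otimes>\<^bsub>hall_group\<^esub> inv\<^bsub>hall_group\<^esub> y \<in> congruence_subgroup d K" if "\<rho> x = \<rho> y" for x y
  proof -
    obtain n f g h where x: "x = (n, f, g, h)" by (cases x)
    obtain n' f' g' h' where y: "y = (n', f', g', h')" by (cases y)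
    have red_eq: "(X d - 1) dvd (f - f')" if "red f = red f'" for f f'
    proof -
      have "f - f' = (f - red f) - (f' - red f')" using that by simp
      then show ?thesis using red(2) by (metis dvd_diff)
    qed
    have f: "(X d - 1) dvd (f - f')" and g: "(X d - 1) dvd (g - g')" and h: "(X d - 1) dvd (h - h')"
      and "n mod d = n' mod d"
      using that red_eq by (auto simp: \<rho>_def x y)
    then have n: "d dvd n - n'" by (simp add: mod_eq_dvd_iff)
    then have Xn: "(X d - 1) dvd (X (n - n') - 1)" by (rule X_minus_one_dvd')
    have "x \<otimes>\<^bsub>hall_group\<^esub> inv\<^bsub>hall_group\<^esub> y = (n - n', X (- n') * (f - f'), (g - g') - (X (n - n') - 1) * g',
        (h - h') - (f - f') * (X (- n') * g'))"
      using X_add[of n "- n'"] unfolding x y by (simp add: inv_hall algebra_simps)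
    moreover have "(X d - 1) dvd (X (- n') * (f - f'))" using f by (rule dvd_mult)
    moreover have "(X d - 1) dvd ((g - g') - (X (n - n') - 1) * g')" by (rule dvd_diff[OF g dvd_mult2[OF Xn]])
    moreover have "(X d - 1) dvd ((h - h') - (f - f') * (X (- n') * g') - 0)"
      unfolding diff_zero by (rule dvd_diff[OF h dvd_mult2[OF f]])
    moreover have "Poly_Mapping.keys (0 :: laurent) \<subseteq> K" by simp
    ultimately show ?thesis using n congruence_subgroupI by metis
  qed
  have "finite ((\<lambda>w. ?M #>\<^bsub>F3\<^esub> w) ` carrier F3)"
  proof (rule finite_image_of_factor[of "\<lambda>w. \<rho> (to_hall w)"])
    show "finite ((\<lambda>w. \<rho> (to_hall w)) ` carrier F3)" by (rule finite_subset[OF _ fin]) auto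
    fix u v assume u: "u \<in> carrier F3" and v: "v \<in> carrier F3" and "\<rho> (to_hall u) = \<rho> (to_hall v)"
    then have "to_hall (u \<otimes>\<^bsub>F3\<^esub> inv\<^bsub>F3\<^esub> v) \<in> congruence_subgroup d K"
      using same by (simp del: mult_hall)
    then have "u \<otimes>\<^bsub>F3\<^esub> inv\<^bsub>F3\<^esub> v \<in> ?M" using u v by simp
    then show "?M #>\<^bsub>F3\<^esub> u = ?M #>\<^bsub>F3\<^esub> v" using to_hall.G.rcos_eq_iff[OF M u v] by simp
  qed
  then show ?thesis by (simp add: carrier_FactGroup)
qed

lemma lower_central_congruence_subgroup:
  "\<exists>c. lower_central F3 c \<subseteq> {w \<in> carrier F3. to_hall w \<in> congruence_subgroup (2 ^ r) K}"
proof -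
  have eq: "(X 1 - 1) ^ 2 ^ r = X (2 ^ r) - 1"
    using one_plus_X_power[of r] by (simp add: laurent_diff add.commute)
  have pow: "(X 1 - 1) ^ 2 ^ r dvd f" if "(X 1 - 1) ^ Suc (2 ^ r) dvd f" for f
    using that by (rule dvd_trans[rotated]) (simp add: le_imp_power_dvd)
  \<comment> \<open>One level beyond \<open>2 ^ r\<close>, because \<open>filtration\<close> grants
    \<open>h\<close> one power fewer than \<open>f\<close> and \<open>g\<close>.\<close>
  have "filtration (Suc (2 ^ r)) \<subseteq> congruence_subgroup (2 ^ r) K"
  proof
    fix x assume "x \<in> filtration (Suc (2 ^ r))"
    then obtain f g h where x: "x = (0, f, g, h)" "(X 1 - 1) ^ Suc (2 ^ r) dvd f" "(X 1 - 1) ^ Suc (2 ^ r) dvd g"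
        "(X 1 - 1) ^ 2 ^ r dvd h"
      unfolding filtration_def by auto
    have "(X (2 ^ r) - 1) dvd f" "(X (2 ^ r) - 1) dvd g" "(X (2 ^ r) - 1) dvd (h - 0)"
      using pow[OF x(2)] pow[OF x(3)] x(4) unfolding eq by simp_all
    then show "x \<in> congruence_subgroup (2 ^ r) K"
      unfolding x(1) by (intro congruence_subgroupI[of _ _ _ _ 0]) simp_all
  qed
  then have "to_hall ` lower_central F3 (Suc (Suc (2 ^ r))) \<subseteq> congruence_subgroup (2 ^ r) K"
    using lower_central_hom[OF to_hall.group_hom_axioms, of "Suc (Suc (2 ^ r))"] lower_central_hall[of "Suc (2 ^ r)"] by blast
  moreover have "lower_central F3 (Suc (Suc (2 ^ r))) \<subseteq> carrier F3"
    using lower_central_normal[OF group_free_group] normal_imp_subgroup subgroup.subset by blast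
  ultimately show ?thesis by blast
qed

text \<open>A nonzero difference divisible by \<open>2 ^ r'\<close> has absolute value at least
  \<open>2 ^ r' > r'\<close>, so any \<open>r\<close> at least the sum of the distances to
  \<open>i\<close> works.\<close>

lemma finite_2adic_separation:
  fixes S :: "int set"
  assumes "finite S"
  obtains r :: nat where "\<And>s r'. s \<in> S \<Longrightarrow> r \<le> r' \<Longrightarrow> s \<noteq> i \<Longrightarrow> \<not> 2 ^ r' dvd s - i"
proof -
  define B where "B = (\<Sum>s \<in> S. \<bar>s - i\<bar>)"
  have B: "\<bar>s - i\<bar> \<le> B" if "s \<in> S" for s
    unfolding B_def by (rule member_le_sum[OF that, of "\<lambda>s. \<bar>s - i\<bar>"]) (use assms in auto)
  have "\<not> 2 ^ r' dvd s - i" if s: "s \<in> S" "nat B \<le> r'" "s \<noteq> i" for s r'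
  proof
    assume "2 ^ r' dvd s - i"
    then have "(2 ^ r' :: int) \<le> \<bar>s - i\<bar>" using s(3) dvd_imp_le_int[of "s - i" "2 ^ r'"] by simp
    also have "\<dots> \<le> int r'" using B[OF s(1)] s(2) by linarith
    also have "\<dots> < 2 ^ r'" by (rule of_nat_less_two_power)
    finally show False by simp
  qed
  then show thesis using that by blast
qed

text \<open>The hypothesis says that \<open>K\<close> is 2-adically closed. If
  \<open>i \<notin> K\<close> occurs in \<open>h\<close>, a high power of two isolates
  \<open>i\<close> both from \<open>K\<close> and from the other exponents of \<open>h\<close>; the
  residue sum at \<open>i\<close> is then 1 on \<open>h\<close> and 0 on every polynomial supported
  in \<open>K\<close>.\<close>

lemma residually_congruence:
  assumes closed: "\<And>i. i \<notin> K \<Longrightarrow> \<exists>r :: nat. \<forall>k \<in> K. \<not> 2 ^ r dvd k - i"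
    and x: "x \<notin> {(0, 0, 0, h) |h. Poly_Mapping.keys h \<subseteq> K}"
  shows "\<exists>r. x \<notin> congruence_subgroup (2 ^ r) K"
proof -
  obtain n f g h where xeq: "x = (n, f, g, h)" by (cases x)
  have nonzero: "\<exists>r. \<not> (X (2 ^ r) - 1) dvd f" if f: "f \<noteq> 0" for f
  proof -
    obtain i where i: "i \<in> Poly_Mapping.keys f" using f by (metis ex_in_conv keys_eq_empty)
    obtain r where "\<And>s. s \<in> Poly_Mapping.keys f \<Longrightarrow> s \<noteq> i \<Longrightarrow> \<not> 2 ^ r dvd s - i"
      using finite_2adic_separation[OF finite_keys, of f i] by (metis order_refl)
    then have "residue_sum (2 ^ r) i f = 1" using i by (intro residue_sum_eq_1)
    then show ?thesis using residue_sum_dvd[of "2 ^ r" f i] by auto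
  qed
  consider "n \<noteq> 0" | "f \<noteq> 0" | "g \<noteq> 0" | "n = 0" "f = 0" "g = 0" by blast
  then show ?thesis
  proof cases
    case 1
    obtain r where "\<not> 2 ^ r dvd n - 0"
      using finite_2adic_separation[of "{n}" 0] 1 by (metis finite.emptyI finite.insertI insertI1 order_refl)
    then show ?thesis unfolding xeq congruence_subgroup_def by auto
  next
    case 2
    then show ?thesis using nonzero[of f] unfolding xeq congruence_subgroup_def by auto
  next
    case 3
    then show ?thesis using nonzero[of g] unfolding xeq congruence_subgroup_def by auto
  next
    case 4
    then obtain i where i: "i \<in> Poly_Mapping.keys h" "i \<notin> K" using x xeq by blast
    obtain r0 :: nat where r0: "\<And>k. k \<in> K \<Longrightarrow> \<not> 2 ^ r0 dvd k - i" using closed[OF i(2)] by blast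
    obtain r1 where r1: "\<And>s r'. s \<in> Poly_Mapping.keys h \<Longrightarrow> r1 \<le> r' \<Longrightarrow> s \<noteq> i \<Longrightarrow> \<not> 2 ^ r' dvd s - i"
      using finite_2adic_separation[OF finite_keys, of h i] by metis
    define r where "r = max r0 r1"
    have r: "\<not> 2 ^ r dvd k - i" if "k \<in> K" for k
      using r0[OF that] dvd_trans[OF le_imp_power_dvd[of r0 r 2], of "k - i"] by (auto simp: r_def)
    have "\<not> (X (2 ^ r) - 1) dvd (h - z)" if z: "Poly_Mapping.keys z \<subseteq> K" for z
    proof
      assume "(X (2 ^ r) - 1) dvd (h - z)"
      then have "residue_sum (2 ^ r) i (h - z) = 0" by (rule residue_sum_dvd)
      moreover have "residue_sum (2 ^ r) i h = 1"
        using i(1) r1[of _ r] by (intro residue_sum_eq_1) (auto simp: r_def)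
      moreover have "residue_sum (2 ^ r) i z = 0" using z r by (intro residue_sum_eq_0) auto
      ultimately show False unfolding laurent_diff residue_sum_add by simp
    qed
    then show ?thesis unfolding xeq congruence_subgroup_def by blast
  qed
qed

lemma hall_relations_subset_congruence:
  "hall_relations K \<subseteq> {w \<in> carrier F3. to_hall w \<in> congruence_subgroup d K}"
proof -
  have "(0, 0, 0, h) \<in> congruence_subgroup d K" if "Poly_Mapping.keys h \<subseteq> K" for h
    by (rule congruence_subgroupI[OF _ _ _ that]) simp_all
  then show ?thesis unfolding hall_relations_def by auto
qed

lemma hall_quotient_residually:
  assumes closed: "\<And>i. i \<notin> K \<Longrightarrow> \<exists>r :: nat. \<forall>k \<in> K. \<not> 2 ^ r dvd k - i"
    and w: "w \<in> carrier F3 - hall_relations K"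
  shows "\<exists>M. M \<lhd> F3 \<and> hall_relations K \<subseteq> M \<and> w \<notin> M \<and> finite (carrier (F3 Mod M)) \<and>
    (\<exists>c. lower_central F3 c \<subseteq> M)"
proof -
  have "to_hall w \<notin> {(0, 0, 0, h) |h. Poly_Mapping.keys h \<subseteq> K}"
    using w by (simp add: hall_relations_def)
  then obtain r where "to_hall w \<notin> congruence_subgroup (2 ^ r) K"
    using residually_congruence[OF closed] by blast
  then show ?thesis
    using to_hall.normal_vimage[OF congruence_subgroup_normal[of "2 ^ r" K]]
      hall_relations_subset_congruence[of K "2 ^ r"] congruence_subgroup_finite_index[of "2 ^ r" K]
      lower_central_congruence_subgroup[of r K]
    by (intro exI[of _ "{w \<in> carrier F3. to_hall w \<in> congruence_subgroup (2 ^ r) K}"]) auto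
qed

section \<open>Periodicity of the central elements in quotients\<close>

text \<open>Commutators of the \<open>t\<close>-conjugates of \<open>v\<close> with \<open>a\<close>
  identify neighbours at distance \<open>d\<close> among the \<open>z_j\<close>. These
  identifications telescope from \<open>i\<close> to \<open>i + d * int m\<close>, where the central
  element is killed.\<close>

lemma central_word_mem:
  assumes M: "M \<lhd> F3" and rel: "hall_relations K \<subseteq> M"
    and v: "v \<in> M" "to_hall v = (0, 0, X d - 1, h)" and K: "i + d * int m \<in> K"
  shows "central_word i \<in> M"
proof -
  interpret M: normal M F3 by fact
  have step: "\<exists>u \<in> M. to_hall u = (0, 0, 0, X (j + d) + X j)" for j
  proof -
    have c: "conj_t j v \<in> M" unfolding conj_t_def by (rule M.inv_op_closed2) (use v in simp_all)
    have "to_hall (conj_t j v) = (0, 0, X j * (X d - 1), h)"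
      using to_hall_conj_t[OF M.mem_carrier[OF v(1)] v(2)] by simp
    then have "to_hall (commutator F3 (conj_t j v) wa) = (0, 0, 0, - (X j * (X d - 1)))"
      using M.mem_carrier[OF c] by (simp add: to_hall.hom_commutator to_hall_gens commutator_hall)
    also have "- (X j * (X d - 1)) = X (j + d) + X j"
      by (simp add: laurent_uminus laurent_diff distrib_left X_add)
    finally show ?thesis using M.commutator_mem[OF c gens_closed(1)] by blast
  qed
  have "\<exists>u \<in> M. to_hall u = (0, 0, 0, X (i + d * int m) + X i)"
  proof (induction m)
    case 0
    have "to_hall \<one>\<^bsub>F3\<^esub> = (0, 0, 0, X (i + d * int 0) + X i)"
      by (simp add: laurent_two)
    then show ?case using M.one_closed by blast
  next
    case (Suc m)
    then obtain u where u: "u \<in> M" "to_hall u = (0, 0, 0, X (i + d * int m) + X i)" by blast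
    obtain u' where u': "u' \<in> M" "to_hall u' = (0, 0, 0, X (i + d * int m + d) + X (i + d * int m))"
      using step by blast
    have "X (i + d * int m + d) + X (i + d * int m) + (X (i + d * int m) + X i) =
        X (i + d * int (Suc m)) + X i"
    proof -
      have "a + b + (b + c) = a + c" for a b c :: laurent
        using laurent_add_self[of b] by (metis add.assoc add_0)
      then show ?thesis by (simp add: distrib_left add_ac)
    qed
    then have "to_hall (u' \<otimes>\<^bsub>F3\<^esub> u) = (0, 0, 0, X (i + d * int (Suc m)) + X i)"
      using u u' M.mem_carrier by simp
    then show ?case using M.m_closed[OF u'(1) u(1)] by blast
  qed
  then obtain u where u: "u \<in> M" "to_hall u = (0, 0, 0, X (i + d * int m) + X i)" by blast
  note uc = M.mem_carrier[OF u(1)]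
  have "X (i + d * int m) + X i + X i = X (i + d * int m)"
    using laurent_add_self[of "X i"] by (simp only: add.assoc add_0_right)
  \<comment> \<open>Only the image of \<open>u\<close> is known, so \<open>u\<close> cannot be
    compared with central words directly; the product has its image in the killed span and thus lies
    in \<open>hall_relations K\<close>.\<close>
  then have "to_hall (u \<otimes>\<^bsub>F3\<^esub> central_word i) = (0, 0, 0, X (i + d * int m))"
    using u(2) uc central_word_closed by (simp add: to_hall_central_word)
  then have "u \<otimes>\<^bsub>F3\<^esub> central_word i \<in> hall_relations K"
    using uc central_word_closed K by (simp add: hall_relations_def)
  then have "inv\<^bsub>F3\<^esub> u \<otimes>\<^bsub>F3\<^esub> (u \<otimes>\<^bsub>F3\<^esub> central_word i) \<in> M"
    using rel u(1) by (blast intro: M.m_closed M.m_inv_closed)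
  then show ?thesis
    using uc central_word_closed by (simp add: to_hall.G.cancel_inv_left)
qed

text \<open>The iterated commutators \<open>[b, t, ..., t]\<close> have
  \<open>g = (1 - X 1) ^ j\<close> and lie in \<open>M\<close> from \<open>j = c\<close> on. At
  \<open>j = 2 ^ c\<close>, which is at least \<open>c\<close>, Frobenius gives the required
  form.\<close>

lemma nilpotent_periodic:
  assumes M: "M \<lhd> F3" and c: "lower_central F3 c \<subseteq> M"
  shows "\<exists>d>0. \<exists>v \<in> M. \<exists>h. to_hall v = (0, 0, X d - 1, h)"
proof -
  interpret M: normal M F3 by fact
  define v where "v = rec_nat wb (\<lambda>_ w. commutator F3 w wt)"
  have v_simps: "v 0 = wb" "v (Suc j) = commutator F3 (v j) wt" for j by (simp_all add: v_def)
  have v_closed: "v j \<in> carrier F3" for j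
    by (induction j) (simp_all add: v_simps to_hall.G.commutator_closed)
  have v_hall: "to_hall (v j) = (0, 0, (1 - X 1) ^ j, 0)" for j
    by (induction j) (simp_all add: v_simps to_hall_gens to_hall.hom_commutator v_closed commutator_hall
        mult.commute)
  have v_lower: "v j \<in> lower_central F3 j" for j
  proof (induction j)
    case (Suc j)
    then show ?case unfolding v_simps commutator_def lower_central.simps
      by (intro generate.incl) (use gens_closed in blast)
  qed (simp add: v_simps)
  have v_M: "v j \<in> M" if "c \<le> j" for j
    using that
  proof (induction j rule: nat_induct_at_least)
    case base
    then show ?case using v_lower c by blast
  next
    case (Suc j)
    then show ?case unfolding v_simps by (intro M.commutator_mem gens_closed)
  qed
  have "(1 - X 1) ^ 2 ^ c = X (2 ^ c) - 1"
    using one_plus_X_power[of c] by (simp add: laurent_diff add.commute)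
  then have "to_hall (v (2 ^ c)) = (0, 0, X (2 ^ c) - 1, 0)" using v_hall by simp
  moreover have "v (2 ^ c) \<in> M" by (rule v_M) simp
  ultimately show ?thesis by (intro exI[of _ "2 ^ c"]) auto
qed

section \<open>Finitely presented quotients\<close>

text \<open>Left multiplication by \<open>C\<close> and by its conjugate under \<open>T\<close> are
  free actions on \<open>B\<close>, with equally many orbits since the two subgroups have the same
  finite order. Any matching of orbits and base points therefore yields an equivariant
  bijection.\<close>

lemma (in group) twisted_bijection:
  assumes B: "subgroup B G" "finite B" and T: "T \<in> carrier G"
    and C_def: "C = {q \<in> B. T \<otimes> q \<otimes> inv T \<in> B}"
  obtains \<tau> where "bij_betw \<tau> B B"
    "\<And>c x. c \<in> C \<Longrightarrow> x \<in> B \<Longrightarrow> \<tau> (c \<otimes> x) = T \<otimes> c \<otimes> inv T \<otimes> \<tau> x"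
proof -
  interpret B: subgroup B G by fact
  let ?H = "G\<lparr>carrier := B\<rparr>"
  interpret H: group ?H by (rule B.subgroup_is_group[OF is_group])
  define k where "k q = T \<otimes> q \<otimes> inv T" for q
  have k_closed: "k q \<in> carrier G" if "q \<in> carrier G" for q using that T by (simp add: k_def)
  have k_mult: "k (p \<otimes> q) = k p \<otimes> k q" if "p \<in> carrier G" "q \<in> carrier G" for p q
    using that T by (simp add: k_def m_assoc cancel_inv_left)
  have k_inv: "k (inv q) = inv (k q)" if "q \<in> carrier G" for q
    using that T by (simp add: k_def m_assoc inv_mult_group)
  have k_inj: "p = q" if "k p = k q" "p \<in> carrier G" "q \<in> carrier G" for p q
    using that T by (simp add: k_def)
  define D where "D = k ` C"
  have C_iff: "q \<in> C \<longleftrightarrow> q \<in> B \<and> k q \<in> B" for q by (simp add: C_def k_def)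
  have C: "subgroup C ?H"
  proof (rule H.subgroupI)
    have "\<one> \<in> C" using T by (simp add: C_def)
    then show "C \<noteq> {}" by blast
  next
    fix a assume a: "a \<in> C"
    then have "inv\<^bsub>?H\<^esub> a = inv a" using m_inv_consistent[OF B(1)] C_iff by blast
    then show "inv\<^bsub>?H\<^esub> a \<in> C" using a k_inv[of a] by (simp add: C_iff)
  next
    fix a b assume "a \<in> C" "b \<in> C"
    then show "a \<otimes>\<^bsub>?H\<^esub> b \<in> C" using k_mult[of a b] by (simp add: C_iff)
  qed (auto simp: C_iff)
  have D: "subgroup D ?H"
  proof (rule H.subgroupI)
    have "\<one> \<in> C" using T by (simp add: C_def)
    then show "D \<noteq> {}" by (auto simp: D_def)
  next
    fix a assume "a \<in> D"
    then obtain c where c: "c \<in> C" "a = k c" by (auto simp: D_def)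
    then have "inv\<^bsub>?H\<^esub> a = k (inv c)" using m_inv_consistent[OF B(1), of a] C_iff k_inv[of c] by simp
    moreover have "inv c \<in> C" using c k_inv[of c] by (simp add: C_iff)
    ultimately show "inv\<^bsub>?H\<^esub> a \<in> D" by (simp add: D_def)
  next
    fix a b assume "a \<in> D" "b \<in> D"
    then obtain c c' where c: "c \<in> C" "a = k c" "c' \<in> C" "b = k c'" by (auto simp: D_def)
    then have "a \<otimes> b = k (c \<otimes> c')" using k_mult[of c c'] C_iff by simp
    moreover have "c \<otimes> c' \<in> C" using c k_mult[of c c'] by (simp add: C_iff)
    ultimately show "a \<otimes>\<^bsub>?H\<^esub> b \<in> D" by (simp add: D_def)
  qed (auto simp: D_def C_iff)
  have rc: "P #>\<^bsub>?H\<^esub> x = P #> x" for P x by (simp add: r_coset_def)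
  have card_CD: "card D = card C"
    unfolding D_def using k_inj C_iff by (intro card_image inj_onI) auto
  have "finite C" "C \<noteq> {}" using B(2) C C_iff subgroup.one_closed[OF C] by (auto intro: finite_subset)
  then have "card (rcosets\<^bsub>?H\<^esub> C) = card (rcosets\<^bsub>?H\<^esub> D)"
    using H.lagrange[OF C] H.lagrange[OF D] card_CD
    by (metis card_gt_0_iff mult_right_cancel not_gr_zero)
  moreover have "finite (rcosets\<^bsub>?H\<^esub> C)" "finite (rcosets\<^bsub>?H\<^esub> D)"
    using B(2) by (auto simp: RCOSETS_def)
  ultimately obtain \<sigma> where \<sigma>: "bij_betw \<sigma> (rcosets\<^bsub>?H\<^esub> C) (rcosets\<^bsub>?H\<^esub> D)"
    using finite_same_card_bij by blast
  define s where "s P = (SOME x. x \<in> P)" for P :: "'a set"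
  have s: "s P \<in> P" "P \<subseteq> B" if P: "P \<in> rcosets\<^bsub>?H\<^esub> J" and J: "subgroup J ?H" for P J
  proof -
    obtain x where x: "x \<in> B" "P = J #> x" using P by (auto simp: RCOSETS_def rc)
    have "x \<in> P" using H.rcos_self[of x J] x J by (simp add: rc)
    then show "s P \<in> P" unfolding s_def by (rule someI)
    show "P \<subseteq> B" using x subgroup.subset[OF J] by (auto simp: r_coset_def)
  qed
  define cs where "cs x = C #> x" for x
  have cs: "cs x \<in> rcosets\<^bsub>?H\<^esub> C" "x \<in> cs x" if "x \<in> B" for x
    using that H.rcos_self[of x C] C by (auto simp: cs_def RCOSETS_def rc)
  define u where "u x = x \<otimes> inv (s (cs x))" for x
  have sB: "s (cs x) \<in> B" if "x \<in> B" for x using s[OF cs(1)[OF that] C] by blast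
  have u: "u x \<in> C" "u x \<otimes> s (cs x) = x" if x: "x \<in> B" for x
  proof -
    obtain c where c: "c \<in> C" "s (cs x) = c \<otimes> x"
      using s(1)[OF cs(1)[OF x] C] by (auto simp: cs_def r_coset_def)
    have cG: "c \<in> carrier G" using c(1) C_iff by auto
    then have "u x = inv c" using c(2) x by (simp add: u_def inv_mult_group cancel_inv_left)
    moreover have "inv c \<in> C" using c cG k_inv[of c] by (simp add: C_iff)
    ultimately show "u x \<in> C" by simp
    show "u x \<otimes> s (cs x) = x" using sB[OF x] x by (simp add: u_def m_assoc)
  qed
  define t where "t x = s (\<sigma> (cs x))" for x
  have \<sigma>cs: "\<sigma> (cs x) \<in> rcosets\<^bsub>?H\<^esub> D" if "x \<in> B" for x
    using \<sigma> cs(1)[OF that] by (auto simp: bij_betw_def)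
  have tB: "t x \<in> B" if "x \<in> B" for x
    using s[OF \<sigma>cs[OF that] D] by (auto simp: t_def)
  \<comment> \<open>Write \<open>x\<close> as an element of \<open>C\<close> times the base point of
    its coset, conjugate the first factor by \<open>T\<close>, and carry the base point along
    \<open>\<sigma>\<close>.\<close>
  define \<tau> where "\<tau> x = k (u x) \<otimes> t x" for x
  have \<tau>B: "\<tau> x \<in> B" if "x \<in> B" for x
    using u(1)[OF that] tB[OF that] by (simp add: \<tau>_def C_iff)
  have \<tau>_coset: "D #> \<tau> x = \<sigma> (cs x)" if x: "x \<in> B" for x
  proof -
    obtain y where y: "y \<in> B" "\<sigma> (cs x) = D #>\<^bsub>?H\<^esub> y" using \<sigma>cs[OF x] by (auto simp: RCOSETS_def)
    have tx: "t x \<in> D #>\<^bsub>?H\<^esub> y" using s(1)[OF \<sigma>cs[OF x] D] y(2) by (simp add: t_def)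
    have ku: "k (u x) \<in> D" using u(1)[OF x] by (simp add: D_def)
    have "D #>\<^bsub>?H\<^esub> \<tau> x = D #>\<^bsub>?H\<^esub> k (u x) #>\<^bsub>?H\<^esub> t x"
      using H.coset_mult_assoc[of D "k (u x)" "t x"] subgroup.subset[OF D] tB[OF x] ku
      by (auto simp: \<tau>_def)
    also have "D #>\<^bsub>?H\<^esub> k (u x) = D" using H.coset_join2[OF _ D ku] subgroup.subset[OF D] ku by auto
    also have "D #>\<^bsub>?H\<^esub> t x = D #>\<^bsub>?H\<^esub> y" using H.repr_independence[OF tx _ D] y(1) by simp
    finally show ?thesis using y(2) by (simp add: rc)
  qed
  have \<tau>_twist: "\<tau> (c \<otimes> x) = k c \<otimes> \<tau> x" if c: "c \<in> C" and x: "x \<in> B" for c x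
  proof -
    have cB: "c \<in> B" using c C_iff by simp
    have "cs (c \<otimes> x) = cs x"
    proof -
      have "C #>\<^bsub>?H\<^esub> (c \<otimes>\<^bsub>?H\<^esub> x) = C #>\<^bsub>?H\<^esub> c #>\<^bsub>?H\<^esub> x"
        using H.coset_mult_assoc[of C c x] subgroup.subset[OF C] cB x by simp
      also have "C #>\<^bsub>?H\<^esub> c = C" using H.coset_join2[OF _ C c] cB by simp
      finally show ?thesis by (simp add: cs_def rc)
    qed
    moreover from this have "u (c \<otimes> x) = c \<otimes> u x"
      using cB x sB[OF x] by (simp add: u_def m_assoc)
    moreover have "u x \<in> carrier G" using u(1)[OF x] C_iff by auto
    ultimately show ?thesis
      using cB tB[OF x] k_closed k_mult[of c "u x"] by (simp add: \<tau>_def t_def m_assoc)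
  qed
  have "inj_on \<tau> B"
  proof (rule inj_onI)
    fix x y assume x: "x \<in> B" and y: "y \<in> B" and eq: "\<tau> x = \<tau> y"
    then have "\<sigma> (cs x) = \<sigma> (cs y)" using \<tau>_coset by metis
    then have cs_eq: "cs x = cs y" using \<sigma> cs(1) x y by (auto simp: bij_betw_def dest: inj_onD)
    then have "t x = t y" by (simp add: t_def)
    moreover have uG: "u x \<in> carrier G" "u y \<in> carrier G" using u(1) x y C_iff by auto
    moreover have "t y \<in> carrier G" using tB[OF y] by simp
    ultimately have "k (u x) = k (u y)" using eq k_closed by (simp add: \<tau>_def)
    then have "u x = u y" using k_inj uG by blast
    then show "x = y" using u(2) x y cs_eq by metis
  qed
  then have "bij_betw \<tau> B B"
    using endo_inj_surj[OF B(2), of \<tau>] \<tau>B by (auto simp: bij_betw_def)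
  then show thesis using that \<tau>_twist by (simp add: k_def)
qed

definition bij_group :: "('a \<Rightarrow> 'a) monoid" where
  "bij_group = \<lparr>carrier = {p. bij p}, mult = (\<circ>), one = id\<rparr>"

lemma group_bij_group: "group bij_group"
proof (rule groupI)
  fix p :: "'a \<Rightarrow> 'a" assume "p \<in> carrier bij_group"
  then have "inv_into UNIV p \<in> carrier bij_group" "inv_into UNIV p \<circ> p = id"
    by (auto simp: bij_group_def bij_imp_bij_inv bij_is_inj)
  then show "\<exists>q \<in> carrier bij_group. q \<otimes>\<^bsub>bij_group\<^esub> p = \<one>\<^bsub>bij_group\<^esub>"
    by (auto simp: bij_group_def)
qed (auto simp: bij_group_def bij_comp comp_assoc)

text \<open>Points over elements outside \<open>B\<close> stay fixed, so the maps are bijections of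
  the whole type and form elements of \<open>bij_group\<close>.\<close>

definition sheet_mult :: "('a, 'b) monoid_scheme \<Rightarrow> 'a set \<Rightarrow> 'a \<Rightarrow> 'a \<times> int \<Rightarrow> 'a \<times> int" where
  "sheet_mult G B q = (\<lambda>(x, n). (if x \<in> B then q \<otimes>\<^bsub>G\<^esub> x else x, n))"

text \<open>A finitely presented (locally finite)-by-\<open>\<int>\<close> group is an HNN extension of a finite group \<open>B\<close>
  with stable letter \<open>T\<close> and \<open>C = B \<inter> T\<inverse> B T\<close>. If \<open>C \<noteq> B\<close>, a permutation representation on \<open>B \<times> \<int>\<close>
  replaces the normal form theorem: \<open>T\<close> climbs one sheet exactly over \<open>C\<close>. This intertwines the left
  multiplications by \<open>c \<in> C\<close> and \<open>T c T\<inverse>\<close>, but for \<open>g \<in> B - C\<close> the group generated by \<open>B\<close> and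
  \<open>T g T\<inverse>\<close> moves between the sheets, so that it is infinite.\<close>

definition sheet_shift :: "'a set \<Rightarrow> 'a set \<Rightarrow> ('a \<Rightarrow> 'a) \<Rightarrow> 'a \<times> int \<Rightarrow> 'a \<times> int" where
  "sheet_shift B C \<tau> = (\<lambda>(x, n). (if x \<in> B then \<tau> x else x, n + of_bool (x \<in> C)))"

lemma (in group) sheet_mult_comp:
  assumes "subgroup B G" "p \<in> B" "q \<in> B"
  shows "sheet_mult G B p \<circ> sheet_mult G B q = sheet_mult G B (p \<otimes> q)"
proof -
  interpret B: subgroup B G by fact
  show ?thesis using assms by (auto simp: sheet_mult_def fun_eq_iff m_assoc)
qed

lemma (in group) sheet_mult_one: "subgroup B G \<Longrightarrow> sheet_mult G B \<one> = id"
  using subgroup.mem_carrier[of B G] by (auto simp: sheet_mult_def fun_eq_iff)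

lemma (in group) sheet_mult_bij:
  assumes "subgroup B G" "q \<in> B"
  shows "bij (sheet_mult G B q)"
proof -
  interpret B: subgroup B G by fact
  have "inv q \<otimes> q = \<one>" "q \<otimes> inv q = \<one>" using assms(2) by auto
  then show ?thesis
    using sheet_mult_comp[OF assms(1), of "inv q" q] sheet_mult_comp[OF assms(1), of q "inv q"]
      assms(2) sheet_mult_one[OF assms(1)]
    by (intro o_bij[of "sheet_mult G B (inv q)"]) simp_all
qed

lemma sheet_shift_bij:
  assumes "bij_betw \<tau> B B"
  shows "bij (sheet_shift B C \<tau>)"
proof -
  define \<tau>' where "\<tau>' x = (if x \<in> B then \<tau> x else x)" for x
  have "bij_betw \<tau>' (B \<union> - B) (B \<union> - B)"
  proof (rule bij_betw_combine)
    show "bij_betw \<tau>' B B" using assms by (subst bij_betw_cong[of B \<tau>' \<tau>]) (auto simp: \<tau>'_def)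
    show "bij_betw \<tau>' (- B) (- B)"
      by (subst bij_betw_cong[of _ \<tau>' id]) (auto simp: \<tau>'_def)
  qed auto
  then have bij: "bij \<tau>'" by simp
  define v where "v = inv_into UNIV \<tau>'"
  have v: "v (\<tau>' x) = x" "\<tau>' (v x) = x" for x
    using bij by (simp_all add: v_def bij_is_inj bij_is_surj surj_f_inv_f)
  have eq: "sheet_shift B C \<tau> = (\<lambda>(x, n). (\<tau>' x, n + of_bool (x \<in> C)))"
    by (auto simp: sheet_shift_def \<tau>'_def fun_eq_iff)
  \<comment> \<open>Whether a point was lifted depends on its source, so the inverse tests
    \<open>v y\<close> rather than \<open>y\<close>.\<close>
  show ?thesis
    unfolding eq by (rule o_bij[of "\<lambda>(y, n). (v y, n - of_bool (v y \<in> C))"]) (auto simp: v fun_eq_iff)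
qed

text \<open>Left multiplication by \<open>c \<in> C\<close> preserves both \<open>C\<close> and its
  complement in \<open>B\<close>, so the two sides climb over the same points; the twist of
  \<open>\<tau>\<close> settles the first coordinate.\<close>

lemma (in group) sheet_shift_conj:
  assumes B: "subgroup B G" and C: "C \<subseteq> B" "subgroup C G" and \<tau>: "bij_betw \<tau> B B"
    "\<And>x. x \<in> B \<Longrightarrow> \<tau> (c \<otimes> x) = d \<otimes> \<tau> x" and c: "c \<in> C"
  shows "sheet_shift B C \<tau> \<circ> sheet_mult G B c = sheet_mult G B d \<circ> sheet_shift B C \<tau>"
proof -
  interpret B: subgroup B G by fact
  interpret C: subgroup C G by fact
  have \<tau>B: "\<tau> x \<in> B" if "x \<in> B" for x using \<tau>(1) that by (auto simp: bij_betw_def)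
  have "c \<otimes> x \<in> C \<longleftrightarrow> x \<in> C" if x: "x \<in> B" for x
  proof
    assume "c \<otimes> x \<in> C"
    then have "inv c \<otimes> (c \<otimes> x) \<in> C" using c by blast
    then show "x \<in> C" using x c by (simp add: cancel_inv_left)
  qed (use c in blast)
  moreover have "x \<notin> C" if "x \<notin> B" for x using that C(1) by blast
  ultimately show ?thesis
    using c C(1) \<tau>B \<tau>(2) by (auto simp: sheet_shift_def sheet_mult_def fun_eq_iff)
qed

section \<open>Finite windows of conjugates of the generators\<close>

lemma foldr_lmult_append: "reduced (u @ v) \<Longrightarrow> foldr lmult u v = u @ v"
proof (induction u)
  case (Cons a u)
  then show ?case using lmult_reduced_Cons[of a "u @ v"] reduced_tl[of a "u @ v"] by simp
qed simp

lemma conj_t_0: "w \<in> carrier F3 \<Longrightarrow> conj_t 0 w = w"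
  by (simp add: conj_t_def)

lemma conj_t_add:
  assumes "w \<in> carrier F3"
  shows "conj_t (i + j) w = conj_t i (conj_t j w)"
  using assms by (simp add: conj_t_def to_hall.G.int_pow_mult to_hall.G.m_assoc to_hall.G.inv_mult_group)

lemma conj_t_1: "w \<in> carrier F3 \<Longrightarrow> conj_t 1 w = wt \<otimes>\<^bsub>F3\<^esub> w \<otimes>\<^bsub>F3\<^esub> inv\<^bsub>F3\<^esub> wt"
  by (simp add: conj_t_def)

lemma conj_t_inv: "w \<in> carrier F3 \<Longrightarrow> conj_t i (inv\<^bsub>F3\<^esub> w) = inv\<^bsub>F3\<^esub> conj_t i w"
  by (simp add: conj_t_def to_hall.G.m_assoc to_hall.G.inv_mult_group)

definition window_gens :: "nat \<Rightarrow> word set" where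
  "window_gens m = {conj_t e x |e x. \<bar>e\<bar> \<le> int m \<and> x \<in> {wa, wb}}"

definition window :: "nat \<Rightarrow> word set" where
  "window m = generate F3 (window_gens m)"

lemma window_gens_closed: "window_gens m \<subseteq> carrier F3"
  by (auto simp: window_gens_def conj_t_closed)

lemma window_subgroup: "subgroup (window m) F3"
  unfolding window_def by (rule to_hall.G.generate_is_subgroup[OF window_gens_closed])

lemma window_incl: "\<bar>e\<bar> \<le> int m \<Longrightarrow> x \<in> {wa, wb} \<Longrightarrow> conj_t e x \<in> window m"
  unfolding window_def window_gens_def by (rule generate.incl) blast

text \<open>Reading from the left, \<open>fst (to_hall p)\<close> is the current height, the
  exponent sum of \<open>t\<close>. A letter for \<open>a\<close> or \<open>b\<close> read at height
  \<open>e\<close> contributes a conjugate by the \<open>e\<close>-th power of \<open>t\<close>, and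
  the height never exceeds the number of letters read. A word that ends at height 0 thus lies in the
  window itself.\<close>

lemma prefix_mem_window:
  assumes "p \<in> carrier F3" "length p \<le> m"
  shows "\<bar>fst (to_hall p)\<bar> \<le> int (length p) \<and>
    p \<otimes>\<^bsub>F3\<^esub> inv\<^bsub>F3\<^esub> (wt [^]\<^bsub>F3\<^esub> fst (to_hall p)) \<in> window m"
  using assms
proof (induction p rule: rev_induct)
  case Nil
  have "\<one>\<^bsub>F3\<^esub> \<otimes>\<^bsub>F3\<^esub> inv\<^bsub>F3\<^esub> (wt [^]\<^bsub>F3\<^esub> fst (to_hall \<one>\<^bsub>F3\<^esub>)) \<in> window m"
    using subgroup.one_closed[OF window_subgroup] by simp
  moreover have "fst (to_hall \<one>\<^bsub>F3\<^esub>) = 0" by simp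
  ultimately show ?case unfolding one_free_group by simp
next
  case (snoc a p)
  let ?F = F3
  obtain i b where a: "a = (i, b)" by (cases a)
  have red: "reduced (p @ [a])" and set: "fst ` set (p @ [a]) \<subseteq> {..<3}"
    using snoc.prems(1) by (simp_all add: carrier_free_group)
  have i: "i < 3" using set a by simp
  have p: "p \<in> carrier F3" using red set by (simp add: carrier_free_group reduced_def successively_append_iff)
  define y where "y = [(i, b)]"
  define e where "e = fst (to_hall p)"
  have y: "y \<in> carrier F3" unfolding y_def by (rule letter_closed[OF i])
  have pa: "p @ [a] = p \<otimes>\<^bsub>F3\<^esub> y"
    using foldr_lmult_append[OF red] a by (simp add: mult_free_group y_def)
  have IH: "\<bar>e\<bar> \<le> int (length p)" "p \<otimes>\<^bsub>F3\<^esub> inv\<^bsub>F3\<^esub> (wt [^]\<^bsub>F3\<^esub> e) \<in> window m"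
    using snoc.IH[OF p] snoc.prems(2) by (simp_all add: e_def)
  have deg: "fst (to_hall (p \<otimes>\<^bsub>F3\<^esub> y)) = e + fst (to_hall y)"
    using p y unfolding e_def by (cases "to_hall p"; cases "to_hall y") simp
  have y_cases: "y = [(i, True)] \<or> y = inv\<^bsub>F3\<^esub> [(i, True)]"
    using inv_letter_free_group[OF i, of True] by (cases b) (simp_all add: y_def)
  consider "i = 0 \<or> i = 1" | "i = 2" using i by linarith
  then show ?case
  proof cases
    case 1
    define x where "x = [(i, True)]"
    have x: "x \<in> {wa, wb}" using 1 by (auto simp: x_def)
    then have xc: "x \<in> carrier F3" by auto
    have hx: "fst (to_hall x) = 0" using x to_hall_gens by auto
    have yx: "y = x \<or> y = inv\<^bsub>F3\<^esub> x" using y_cases by (simp add: x_def)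
    then have hy: "fst (to_hall y) = 0"
      using xc hx by (cases "to_hall x") (auto simp: inv_hall)
    have cx: "conj_t e x \<in> window m" using IH(1) snoc.prems(2) x by (intro window_incl) auto
    have "conj_t e y \<in> window m"
      using yx cx conj_t_inv[OF xc] subgroup.m_inv_closed[OF window_subgroup cx] by auto
    then have "p \<otimes>\<^bsub>F3\<^esub> inv\<^bsub>F3\<^esub> (wt [^]\<^bsub>F3\<^esub> e) \<otimes>\<^bsub>F3\<^esub> conj_t e y \<in> window m"
      using IH(2) by (rule subgroup.m_closed[OF window_subgroup, rotated])
    moreover have "p \<otimes>\<^bsub>F3\<^esub> inv\<^bsub>F3\<^esub> (wt [^]\<^bsub>F3\<^esub> e) \<otimes>\<^bsub>F3\<^esub> conj_t e y =
        p \<otimes>\<^bsub>F3\<^esub> y \<otimes>\<^bsub>F3\<^esub> inv\<^bsub>F3\<^esub> (wt [^]\<^bsub>F3\<^esub> e)"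
      using p y by (simp add: conj_t_def to_hall.G.m_assoc to_hall.G.cancel_inv_left)
    ultimately show ?thesis unfolding pa deg hy using IH(1) by (simp flip: pa)
  next
    case 2
    then have "y = wt [^]\<^bsub>F3\<^esub> (1 :: int) \<or> y = wt [^]\<^bsub>F3\<^esub> (- 1 :: int)"
      using y_cases by (simp add: to_hall.G.int_pow_neg)
    then have "\<exists>s :: int. y = wt [^]\<^bsub>F3\<^esub> s \<and> \<bar>s\<bar> \<le> 1"
      by (elim disjE) (rule exI[of _ 1], simp, rule exI[of _ "- 1"], simp)
    then obtain s :: int where s: "y = wt [^]\<^bsub>F3\<^esub> s" "\<bar>s\<bar> \<le> 1" by blast
    then have hy: "fst (to_hall y) = s" by (simp add: to_hall_t_power)
    have "p \<otimes>\<^bsub>F3\<^esub> y \<otimes>\<^bsub>F3\<^esub> inv\<^bsub>F3\<^esub> (wt [^]\<^bsub>F3\<^esub> (e + s)) = p \<otimes>\<^bsub>F3\<^esub> inv\<^bsub>F3\<^esub> (wt [^]\<^bsub>F3\<^esub> e)"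
      using p by (simp add: s(1) to_hall.G.int_pow_mult to_hall.G.inv_mult_group to_hall.G.m_assoc to_hall.G.cancel_inv_left)
    then show ?thesis unfolding pa deg hy using IH s(2) by (simp flip: pa)
  qed
qed

text \<open>The doubled range for \<open>h\<close> absorbs the products \<open>f * g'\<close>, which
  turns this finite set into a subgroup.\<close>

definition window_box :: "nat \<Rightarrow> hall set" where
  "window_box m = {(0, f, g, h) |f g h. Poly_Mapping.keys f \<subseteq> {- int m..int m} \<and>
     Poly_Mapping.keys g \<subseteq> {- int m..int m} \<and> Poly_Mapping.keys h \<subseteq> {- 2 * int m..2 * int m}}"

lemma finite_window_box: "finite (window_box m)"
proof (rule finite_subset)
  let ?R = "\<lambda>S. {f :: laurent. Poly_Mapping.keys f \<subseteq> S}"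
  show "window_box m \<subseteq> {0} \<times> ?R {- int m..int m} \<times> ?R {- int m..int m} \<times> ?R {- 2 * int m..2 * int m}"
    by (auto simp: window_box_def)
qed (simp add: finite_laurent_keys_subset)

lemma window_box_subgroup: "subgroup (window_box m) hall_group"
proof (rule hall.subgroupI)
  have "(0, 0, 0, 0) \<in> window_box m" by (simp add: window_box_def)
  then show "window_box m \<noteq> {}" by blast
next
  have prod: "Poly_Mapping.keys (f * g) \<subseteq> {- 2 * int m..2 * int m}"
    if "Poly_Mapping.keys f \<subseteq> {- int m..int m}" "Poly_Mapping.keys g \<subseteq> {- int m..int m}" for f g :: laurent
  proof
    fix k assume "k \<in> Poly_Mapping.keys (f * g)"
    then obtain i j where "k = i + j" "i \<in> Poly_Mapping.keys f" "j \<in> Poly_Mapping.keys g"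
      using keys_mult[of f g] by blast
    then show "k \<in> {- 2 * int m..2 * int m}" using that by (force simp: subset_iff)
  qed
  have sum: "Poly_Mapping.keys (f + g) \<subseteq> S" if "Poly_Mapping.keys f \<subseteq> S" "Poly_Mapping.keys g \<subseteq> S" for f g :: laurent and S
    using keys_add[of f g] that by blast
  {
    fix x assume "x \<in> window_box m"
    then obtain f g h where x: "x = (0, f, g, h)" "Poly_Mapping.keys f \<subseteq> {- int m..int m}"
        "Poly_Mapping.keys g \<subseteq> {- int m..int m}" "Poly_Mapping.keys h \<subseteq> {- 2 * int m..2 * int m}"
      by (auto simp: window_box_def)
    have "inv\<^bsub>hall_group\<^esub> x = (0, f, g, h + f * g)" unfolding x(1) by (simp add: inv_hall laurent_uminus)
    then show "inv\<^bsub>hall_group\<^esub> x \<in> window_box m"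
      using x(2,3) sum[OF x(4) prod[OF x(2,3)]] unfolding window_box_def by blast
  next
    fix x y assume "x \<in> window_box m" "y \<in> window_box m"
    then obtain f g h f' g' h' where x: "x = (0, f, g, h)" "Poly_Mapping.keys f \<subseteq> {- int m..int m}"
        "Poly_Mapping.keys g \<subseteq> {- int m..int m}" "Poly_Mapping.keys h \<subseteq> {- 2 * int m..2 * int m}"
      and y: "y = (0, f', g', h')" "Poly_Mapping.keys f' \<subseteq> {- int m..int m}"
        "Poly_Mapping.keys g' \<subseteq> {- int m..int m}" "Poly_Mapping.keys h' \<subseteq> {- 2 * int m..2 * int m}"
      by (auto simp: window_box_def)
    have "x \<otimes>\<^bsub>hall_group\<^esub> y = (0, f' + f, g + g', h + h' + f * g')" unfolding x(1) y(1) by simp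
    then show "x \<otimes>\<^bsub>hall_group\<^esub> y \<in> window_box m"
      using sum[OF y(2) x(2)] sum[OF x(3) y(3)] sum[OF sum[OF x(4) y(4)] prod[OF x(2) y(3)]]
      unfolding window_box_def by blast
  }
qed simp

lemma to_hall_window: "to_hall ` window m \<subseteq> window_box m"
proof -
  have "to_hall x \<in> window_box m" if "x \<in> window_gens m" for x
    using that to_hall_conj_t[OF _ to_hall_gens(1)] to_hall_conj_t[OF _ to_hall_gens(2)]
    unfolding window_gens_def window_box_def by auto
  then have "generate hall_group (to_hall ` window_gens m) \<subseteq> window_box m"
    by (intro hall.generate_subgroup_incl window_box_subgroup) blast
  then show ?thesis
    unfolding window_def using to_hall.generate_img[OF window_gens_closed] by simp
qed

section \<open>Periodicity in finitely presented quotients\<close>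

text \<open>The matrices without \<open>t\<close> form a Heisenberg group in characteristic two:
  squares have the form \<open>(0, 0, 0, f * g)\<close>, and squaring once more kills them.\<close>

lemma fourth_power_trivial:
  assumes "w \<in> carrier F3" "fst (to_hall w) = 0"
  shows "w \<otimes>\<^bsub>F3\<^esub> w \<otimes>\<^bsub>F3\<^esub> (w \<otimes>\<^bsub>F3\<^esub> w) \<in> hall_relations {}"
proof -
  obtain f g h where "to_hall w = (0, f, g, h)" using assms(2) by (cases "to_hall w") auto
  then have "to_hall (w \<otimes>\<^bsub>F3\<^esub> w \<otimes>\<^bsub>F3\<^esub> (w \<otimes>\<^bsub>F3\<^esub> w)) = (0, 0, 0, 0)"
    using assms(1) by (simp add: laurent_add_self laurent_two)
  then show ?thesis using assms(1) by (simp add: hall_relations_def)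
qed

text \<open>A relation of height \<open>s\<close> conjugates \<open>b\<close> to a copy shifted by
  \<open>s\<close>, so its commutator with \<open>b\<close> has \<open>g = X s - 1\<close>; taking
  the inverse makes \<open>s\<close> positive.\<close>

lemma periodic_of_moving_relation:
  assumes M: "M \<lhd> F3" and w: "w \<in> M" "fst (to_hall w) \<noteq> 0"
  shows "\<exists>d>0. \<exists>v \<in> M. \<exists>h. to_hall v = (0, 0, X d - 1, h)"
proof -
  interpret M: normal M F3 by fact
  obtain u where u: "u \<in> M" "fst (to_hall u) > 0"
  proof (cases "fst (to_hall w) > 0")
    case False
    then have "fst (to_hall (inv\<^bsub>F3\<^esub> w)) > 0"
      using w M.mem_carrier[OF w(1)] by (cases "to_hall w") (simp add: inv_hall)
    then show ?thesis using that M.m_inv_closed[OF w(1)] by blast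
  qed (use that w in blast)
  obtain s f g h where s: "to_hall u = (s, f, g, h)" by (cases "to_hall u")
  have "to_hall (commutator F3 u wb) =
      (s, f, g, h) \<otimes>\<^bsub>hall_group\<^esub> (0, 0, 1, 0) \<otimes>\<^bsub>hall_group\<^esub> inv\<^bsub>hall_group\<^esub> (s, f, g, h)
        \<otimes>\<^bsub>hall_group\<^esub> inv\<^bsub>hall_group\<^esub> (0, 0, 1, 0)"
    using M.mem_carrier[OF u(1)]
    by (simp add: to_hall.hom_commutator to_hall_gens s commutator_def del: mult_hall)
  then have "to_hall (commutator F3 u wb) = (0, 0, X s - 1, f)"
    unfolding hall_conj by (simp add: inv_hall)
  then show ?thesis using u s M.commutator_mem[OF u(1) gens_closed(2)] by auto
qed

text \<open>If no relation moves, the finitely many normal generators lie in one window, whose image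
  \<open>B\<close> in the quotient is finite. Either conjugation by \<open>T\<close> maps
  \<open>B\<close> into itself and the pigeonhole principle gives a period, or permutations of the
  sheets satisfy all relators of \<open>M\<close> and still violate the exponent 4 that
  \<open>hall_relations {} \<subseteq> M\<close> enforces.\<close>

lemma normally_finitely_generated_periodic:
  assumes fg: "normally_finitely_generated F3 M" and ker: "hall_relations {} \<subseteq> M"
  shows "\<exists>d>0. \<exists>v \<in> M. \<exists>h. to_hall v = (0, 0, X d - 1, h)"
proof (cases "\<exists>w \<in> M. fst (to_hall w) \<noteq> 0")
  case True
  have "M \<lhd> F3"
    using fg normal_closure_normal[OF group_free_group] by (auto simp: normally_finitely_generated_def)
  then show ?thesis using True periodic_of_moving_relation by blast
next
  case False
  obtain R where R: "finite R" "R \<subseteq> carrier F3" "M = normal_closure F3 R"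
    using fg by (auto simp: normally_finitely_generated_def)
  have M: "M \<lhd> F3" unfolding R(3) by (rule normal_closure_normal[OF group_free_group R(2)])
  interpret M: normal M F3 by fact
  let ?Q = "F3 Mod M"
  define \<rho> where "\<rho> w = M #>\<^bsub>F3\<^esub> w" for w
  interpret \<rho>: group_hom F3 ?Q \<rho>
    unfolding \<rho>_def by (rule to_hall.G.normal_hom_Mod[OF M])
  have \<rho>_eq_iff: "\<rho> u = \<rho> v \<longleftrightarrow> u \<otimes>\<^bsub>F3\<^esub> inv\<^bsub>F3\<^esub> v \<in> M" if "u \<in> carrier F3" "v \<in> carrier F3" for u v
    unfolding \<rho>_def by (rule to_hall.G.rcos_eq_iff[OF M that])
  have \<rho>_one: "\<rho> u = \<one>\<^bsub>?Q\<^esub>" if "u \<in> M" for u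
    using \<rho>_eq_iff[of u "\<one>\<^bsub>F3\<^esub>"] M.mem_carrier[OF that] that by simp
  obtain m where m: "\<And>r. r \<in> R \<Longrightarrow> length r \<le> m"
    using finite_imageI[OF R(1), of length] by (metis finite_nat_set_iff_bounded_le imageI)
  have Wc: "w \<in> carrier F3" if "w \<in> window m" for w
    using that subgroup.mem_carrier[OF window_subgroup] by blast
  have W0: "fst (to_hall w) = 0" if "w \<in> window m" for w
    using to_hall_window[of m] that by (force simp: window_box_def)
  have RW: "r \<in> window m" if r: "r \<in> R" for r
  proof -
    have "r \<in> M" using R(3) normal_closure_incl[of R F3] r by blast
    then have "fst (to_hall r) = 0" using False by blast
    then show ?thesis using prefix_mem_window[of r m] m[OF r] R(2) r by auto
  qed
  define B where "B = \<rho> ` window m"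
  have B: "subgroup B ?Q" unfolding B_def by (rule \<rho>.subgroup_img_is_subgroup[OF window_subgroup])
  have "finite B"
    unfolding B_def
  proof (rule finite_image_of_factor)
    show "finite (to_hall ` window m)" using to_hall_window finite_window_box by (rule finite_subset)
    fix u v assume uv: "u \<in> window m" "v \<in> window m" "to_hall u = to_hall v"
    then have "to_hall (u \<otimes>\<^bsub>F3\<^esub> inv\<^bsub>F3\<^esub> v) = \<one>\<^bsub>hall_group\<^esub>"
      using Wc by (simp del: mult_hall one_hall)
    then have "u \<otimes>\<^bsub>F3\<^esub> inv\<^bsub>F3\<^esub> v \<in> hall_relations {}"
      using uv Wc by (simp add: hall_relations_def)
    then show "\<rho> u = \<rho> v" using \<rho>_eq_iff uv Wc ker by blast
  qed
  define T where "T = \<rho> wt"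
  have T: "T \<in> carrier ?Q" unfolding T_def by simp
  have \<rho>_conj: "\<rho> (conj_t (i + 1) w) = T \<otimes>\<^bsub>?Q\<^esub> \<rho> (conj_t i w) \<otimes>\<^bsub>?Q\<^esub> inv\<^bsub>?Q\<^esub> T"
    if "w \<in> carrier F3" for i w
    using that conj_t_add[OF that, of 1 i] by (simp add: conj_t_1 conj_t_closed T_def add.commute)
  define C where "C = {q \<in> B. T \<otimes>\<^bsub>?Q\<^esub> q \<otimes>\<^bsub>?Q\<^esub> inv\<^bsub>?Q\<^esub> T \<in> B}"
  show ?thesis
  proof (cases "B \<subseteq> C")
    case True
    have conjB: "\<rho> (conj_t (int n) wb) \<in> B" for n
    proof (induction n)
      case 0
      show ?case unfolding B_def by (intro imageI) (auto intro: window_incl)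
    next
      case (Suc n)
      then have "T \<otimes>\<^bsub>?Q\<^esub> \<rho> (conj_t (int n) wb) \<otimes>\<^bsub>?Q\<^esub> inv\<^bsub>?Q\<^esub> T \<in> B" using True by (auto simp: C_def)
      then show ?case using \<rho>_conj[of wb "int n"] by (simp add: add.commute)
    qed
    \<comment> \<open>All conjugates of \<open>b\<close> by nonnegative powers of \<open>t\<close>
      lie in the finite \<open>B\<close>, so two of them agree.\<close>
    have "\<not> inj (\<lambda>n. \<rho> (conj_t (int n) wb))"
      using conjB \<open>finite B\<close> by (meson finite_subset finite_imageD image_subsetI infinite_UNIV_nat)
    then obtain n1 n2 where n: "n1 < n2" "\<rho> (conj_t (int n2) wb) = \<rho> (conj_t (int n1) wb)"
      unfolding inj_def by (metis linorder_neqE_nat)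
    define v where "v = conj_t (int n2) wb \<otimes>\<^bsub>F3\<^esub> inv\<^bsub>F3\<^esub> conj_t (int n1) wb"
    have v: "v \<in> M" using n(2) \<rho>_eq_iff by (simp add: v_def conj_t_closed)
    have "to_hall v = (0, 0, X (int n2) - X (int n1), 0)"
      unfolding v_def using to_hall_conj_t[OF gens_closed(2) to_hall_gens(2)]
      by (simp add: conj_t_closed inv_hall)
    \<comment> \<open>Shifting back by \<open>n1\<close> turns the difference of two monomials into
      \<open>X d - 1\<close> with \<open>d = int n2 - int n1\<close>.\<close>
    then have "to_hall (conj_t (- int n1) v) = (0, 0, X (- int n1) * (X (int n2) - X (int n1)), 0)"
      using to_hall_conj_t[OF M.mem_carrier[OF v]] by simp
    also have "X (- int n1) * (X (int n2) - X (int n1)) = X (int n2 - int n1) - 1"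
      by (simp add: right_diff_distrib flip: X_add)
    finally have "to_hall (conj_t (- int n1) v) = (0, 0, X (int n2 - int n1) - 1, 0)" .
    moreover have "conj_t (- int n1) v \<in> M" unfolding conj_t_def by (rule M.inv_op_closed2) (use v in simp_all)
    ultimately show ?thesis using n(1) by (intro exI[of _ "int n2 - int n1"]) auto
  next
    case False
    then obtain g where g: "g \<in> B" "g \<notin> C" by blast
    obtain \<tau> where \<tau>: "bij_betw \<tau> B B"
        "\<And>c x. c \<in> C \<Longrightarrow> x \<in> B \<Longrightarrow> \<tau> (c \<otimes>\<^bsub>?Q\<^esub> x) = T \<otimes>\<^bsub>?Q\<^esub> c \<otimes>\<^bsub>?Q\<^esub> inv\<^bsub>?Q\<^esub> T \<otimes>\<^bsub>?Q\<^esub> \<tau> x"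
      by (rule \<rho>.H.twisted_bijection[OF B \<open>finite B\<close> T C_def]) (rule that)
    have C: "C \<subseteq> B" "subgroup C ?Q"
    proof -
      interpret B: subgroup B ?Q by (rule B)
      show "C \<subseteq> B" by (auto simp: C_def)
      show "subgroup C ?Q"
      proof (rule \<rho>.H.subgroupI)
        show "C \<noteq> {}" using T B.one_closed by (auto simp: C_def intro!: exI[of _ "\<one>\<^bsub>?Q\<^esub>"])
      next
        fix a assume "a \<in> C"
        then have a: "a \<in> B" "T \<otimes>\<^bsub>?Q\<^esub> a \<otimes>\<^bsub>?Q\<^esub> inv\<^bsub>?Q\<^esub> T \<in> B" by (auto simp: C_def)
        have "T \<otimes>\<^bsub>?Q\<^esub> inv\<^bsub>?Q\<^esub> a \<otimes>\<^bsub>?Q\<^esub> inv\<^bsub>?Q\<^esub> T = inv\<^bsub>?Q\<^esub> (T \<otimes>\<^bsub>?Q\<^esub> a \<otimes>\<^bsub>?Q\<^esub> inv\<^bsub>?Q\<^esub> T)"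
          using T a(1) by (simp add: \<rho>.H.inv_mult_group \<rho>.H.m_assoc)
        then show "inv\<^bsub>?Q\<^esub> a \<in> C" using a B.m_inv_closed by (simp add: C_def)
      next
        fix a b assume "a \<in> C" "b \<in> C"
        then have ab: "a \<in> B" "b \<in> B" "T \<otimes>\<^bsub>?Q\<^esub> a \<otimes>\<^bsub>?Q\<^esub> inv\<^bsub>?Q\<^esub> T \<in> B" "T \<otimes>\<^bsub>?Q\<^esub> b \<otimes>\<^bsub>?Q\<^esub> inv\<^bsub>?Q\<^esub> T \<in> B"
          by (auto simp: C_def)
        have "T \<otimes>\<^bsub>?Q\<^esub> (a \<otimes>\<^bsub>?Q\<^esub> b) \<otimes>\<^bsub>?Q\<^esub> inv\<^bsub>?Q\<^esub> T =
            T \<otimes>\<^bsub>?Q\<^esub> a \<otimes>\<^bsub>?Q\<^esub> inv\<^bsub>?Q\<^esub> T \<otimes>\<^bsub>?Q\<^esub> (T \<otimes>\<^bsub>?Q\<^esub> b \<otimes>\<^bsub>?Q\<^esub> inv\<^bsub>?Q\<^esub> T)"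
          using T ab(1,2) by (simp add: \<rho>.H.m_assoc \<rho>.H.cancel_inv_left)
        then show "a \<otimes>\<^bsub>?Q\<^esub> b \<in> C" using B.m_closed[OF ab(3,4)] B.m_closed[OF ab(1,2)] by (simp add: C_def)
      qed (auto simp: C_def)
    qed
    let ?P = "bij_group :: ((word set \<times> int) \<Rightarrow> _) monoid"
    let ?L = "sheet_mult ?Q B" and ?t = "sheet_shift B C \<tau>"
    interpret P: group ?P by (rule group_bij_group)
    have L_in: "?L q \<in> carrier ?P" if "q \<in> B" for q
      using \<rho>.H.sheet_mult_bij[OF B that] by (simp add: bij_group_def)
    have t_in: "?t \<in> carrier ?P" using sheet_shift_bij[OF \<tau>(1)] by (simp add: bij_group_def)
    have L_comp: "?L p \<otimes>\<^bsub>?P\<^esub> ?L q = ?L (p \<otimes>\<^bsub>?Q\<^esub> q)" if "p \<in> B" "q \<in> B" for p q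
      using \<rho>.H.sheet_mult_comp[OF B that] by (simp add: bij_group_def)
    have L_one: "?L \<one>\<^bsub>?Q\<^esub> = \<one>\<^bsub>?P\<^esub>"
      using \<rho>.H.sheet_mult_one[OF B] by (simp add: bij_group_def)
    have L_conj: "?t \<otimes>\<^bsub>?P\<^esub> ?L c \<otimes>\<^bsub>?P\<^esub> inv\<^bsub>?P\<^esub> ?t = ?L (T \<otimes>\<^bsub>?Q\<^esub> c \<otimes>\<^bsub>?Q\<^esub> inv\<^bsub>?Q\<^esub> T)" if c: "c \<in> C" for c
    proof -
      have "?t \<otimes>\<^bsub>?P\<^esub> ?L c = ?L (T \<otimes>\<^bsub>?Q\<^esub> c \<otimes>\<^bsub>?Q\<^esub> inv\<^bsub>?Q\<^esub> T) \<otimes>\<^bsub>?P\<^esub> ?t"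
        using \<rho>.H.sheet_shift_conj[OF B C \<tau>(1) \<tau>(2)[OF c] c] by (simp add: bij_group_def)
      moreover have "T \<otimes>\<^bsub>?Q\<^esub> c \<otimes>\<^bsub>?Q\<^esub> inv\<^bsub>?Q\<^esub> T \<in> B" using c by (simp add: C_def)
      ultimately show ?thesis using L_in t_in by (simp add: P.m_assoc)
    qed
    have wab: "x \<in> {wa, wb} \<Longrightarrow> x \<in> carrier F3" for x by auto
    have conj_B: "\<rho> (conj_t e x) \<in> B" if "\<bar>e\<bar> \<le> int m" "x \<in> {wa, wb}" for e x
      unfolding B_def by (rule imageI[OF window_incl[OF that]])
    have gens_B: "\<rho> x \<in> B" if "x \<in> {wa, wb}" for x
      using conj_B[of 0 x] that conj_t_0[OF wab[OF that]] by simp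
    \<comment> \<open>Defined on free generators, \<open>\<theta>\<close> has to agree with
      \<open>?L\<close> after \<open>\<rho>\<close> only on the window, since that contains every
      relator.\<close>
    define \<theta> where "\<theta> = word_value ?P [?L (\<rho> wa), ?L (\<rho> wb), ?t]"
    interpret \<theta>: group_hom F3 ?P \<theta>
      unfolding \<theta>_def by (rule P.word_value_hom) (use L_in t_in gens_B in auto)
    have \<theta>_gens: "\<theta> x = ?L (\<rho> x)" if "x \<in> {wa, wb}" for x
      using that P.word_value_gen[of "[?L (\<rho> wa), ?L (\<rho> wb), ?t]"] L_in t_in gens_B
      by (auto simp: \<theta>_def)
    have \<theta>_t: "\<theta> wt = ?t"
      using P.word_value_gen[of "[?L (\<rho> wa), ?L (\<rho> wb), ?t]" 2] L_in t_in gens_B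
      by (auto simp: \<theta>_def)
    have \<theta>_conj: "\<theta> (conj_t (i + 1) w) = ?t \<otimes>\<^bsub>?P\<^esub> \<theta> (conj_t i w) \<otimes>\<^bsub>?P\<^esub> inv\<^bsub>?P\<^esub> ?t"
      if "w \<in> carrier F3" for i w
      using that conj_t_add[OF that, of 1 i] by (simp add: conj_t_1 conj_t_closed \<theta>_t add.commute)
    have conj_C: "\<rho> (conj_t e x) \<in> C" if "\<bar>e\<bar> \<le> int m" "\<bar>e + 1\<bar> \<le> int m" "x \<in> {wa, wb}" for e x
      using conj_B[OF that(1,3)] conj_B[OF that(2,3)] \<rho>_conj[OF wab[OF that(3)]] by (simp add: C_def)
    \<comment> \<open>While the next conjugate still belongs to the window, the present one lies in
      \<open>C\<close>, and there conjugation by \<open>?t\<close> imitates conjugation by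
      \<open>T\<close>.\<close>
    have up: "\<theta> (conj_t (int j) x) = ?L (\<rho> (conj_t (int j) x))" if x: "x \<in> {wa, wb}" and j: "j \<le> m" for x j
      using j
    proof (induction j)
      case 0
      then show ?case using \<theta>_gens[OF x] conj_t_0[OF wab[OF x]] by simp
    next
      case (Suc j)
      have eq: "int (Suc j) = int j + 1" by simp
      show ?case
        unfolding eq \<theta>_conj[OF wab[OF x]] \<rho>_conj[OF wab[OF x]]
        using Suc L_conj[OF conj_C[of "int j" x]] x by simp
    qed
    \<comment> \<open>The same relation read backwards: the two sides agree after conjugation by
      \<open>?t\<close>, which is then cancelled.\<close>
    have down: "\<theta> (conj_t (- int j) x) = ?L (\<rho> (conj_t (- int j) x))" if x: "x \<in> {wa, wb}" and j: "j \<le> m" for x j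
      using j
    proof (induction j)
      case 0
      then show ?case using \<theta>_gens[OF x] conj_t_0[OF wab[OF x]] by simp
    next
      case (Suc j)
      define e where "e = - int (Suc j)"
      have eq: "- int j = e + 1" by (simp add: e_def)
      have e: "\<rho> (conj_t e x) \<in> C" "\<rho> (conj_t e x) \<in> B" using conj_C[of e x] conj_B[of e x] x Suc.prems by (auto simp: e_def)
      have "?t \<otimes>\<^bsub>?P\<^esub> \<theta> (conj_t e x) \<otimes>\<^bsub>?P\<^esub> inv\<^bsub>?P\<^esub> ?t = \<theta> (conj_t (e + 1) x)"
        by (rule \<theta>_conj[OF wab[OF x], symmetric])
      also have "\<dots> = ?L (\<rho> (conj_t (e + 1) x))" using Suc unfolding eq by simp
      also have "\<dots> = ?t \<otimes>\<^bsub>?P\<^esub> ?L (\<rho> (conj_t e x)) \<otimes>\<^bsub>?P\<^esub> inv\<^bsub>?P\<^esub> ?t"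
        unfolding L_conj[OF e(1)] \<rho>_conj[OF wab[OF x]] ..
      finally have "\<theta> (conj_t e x) = ?L (\<rho> (conj_t e x))"
        using t_in L_in[OF e(2)] \<theta>.hom_closed[OF conj_t_closed[OF wab[OF x]]] by simp
      then show ?case by (simp add: e_def)
    qed
    have \<theta>_window: "\<theta> w = ?L (\<rho> w)" if "w \<in> window m" for w
      using that unfolding window_def
    proof (induction w rule: generate.induct)
      case one
      then show ?case using L_one by simp
    next
      case (incl w)
      then obtain e x where "w = conj_t e x" "\<bar>e\<bar> \<le> int m" "x \<in> {wa, wb}" by (auto simp: window_gens_def)
      then show ?case using up[of x "nat e"] down[of x "nat (- e)"] by (cases "e \<ge> 0") auto
    next
      case (inv w)
      then obtain e x where w: "w = conj_t e x" "\<bar>e\<bar> \<le> int m" "x \<in> {wa, wb}" by (auto simp: window_gens_def)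
      then have \<theta>w: "\<theta> w = ?L (\<rho> w)" using up[of x "nat e"] down[of x "nat (- e)"] by (cases "e \<ge> 0") auto
      have wB: "\<rho> w \<in> B" using conj_B w by simp
      have wc: "w \<in> carrier F3" using w conj_t_closed wab by blast
      have iB: "inv\<^bsub>?Q\<^esub> \<rho> w \<in> B" using subgroup.m_inv_closed[OF B wB] .
      have "?L (inv\<^bsub>?Q\<^esub> \<rho> w) \<otimes>\<^bsub>?P\<^esub> ?L (\<rho> w) = \<one>\<^bsub>?P\<^esub>"
        using L_comp[OF iB wB] L_one subgroup.mem_carrier[OF B wB] by simp
      then have "inv\<^bsub>?P\<^esub> ?L (\<rho> w) = ?L (inv\<^bsub>?Q\<^esub> \<rho> w)"
        using L_in wB iB by (intro P.inv_equality)
      then show ?case using \<theta>w wc by simp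
    next
      case (eng u v)
      then have uv: "u \<in> window m" "v \<in> window m" by (simp_all add: window_def)
      then have "\<rho> u \<in> B" "\<rho> v \<in> B" by (auto simp: B_def)
      then show ?case using eng L_comp Wc[OF uv(1)] Wc[OF uv(2)] by simp
    qed
    have "R \<subseteq> kernel F3 ?P \<theta>"
    proof
      fix r assume r: "r \<in> R"
      then have "r \<in> M" using R(3) normal_closure_incl[of R F3] by blast
      then show "r \<in> kernel F3 ?P \<theta>"
        using \<theta>_window[OF RW[OF r]] \<rho>_one L_one R(2) r by (auto simp: kernel_def)
    qed
    then have M_ker: "M \<subseteq> kernel F3 ?P \<theta>"
      unfolding R(3) by (rule normal_closure_minimal[OF \<theta>.normal_kernel])
    interpret B: subgroup B ?Q by (rule B)
    have \<tau>B: "\<tau> x \<in> B" if "x \<in> B" for x using \<tau>(1) that by (auto simp: bij_betw_def)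
    let ?o = "\<one>\<^bsub>?Q\<^esub>"
    \<comment> \<open>A correction inside \<open>B\<close> that leads from \<open>\<tau> g\<close>
      back to \<open>\<tau> ?o\<close>, so that \<open>v\<close> changes only the sheet of the point
      chosen.\<close>
    have "\<tau> ?o \<otimes>\<^bsub>?Q\<^esub> inv\<^bsub>?Q\<^esub> \<tau> g \<in> B"
      by (intro B.m_closed B.m_inv_closed \<tau>B B.one_closed g(1))
    then obtain w1 where w1: "w1 \<in> window m" "\<rho> w1 = \<tau> ?o \<otimes>\<^bsub>?Q\<^esub> inv\<^bsub>?Q\<^esub> \<tau> g" by (auto simp: B_def)
    obtain u where u: "u \<in> window m" "\<rho> u = g" using g(1) by (auto simp: B_def)
    \<comment> \<open>Undoing \<open>?t\<close> descends a sheet because \<open>?o \<in> C\<close>;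
      after \<open>u\<close> has moved the point to \<open>g \<notin> C\<close>, applying
      \<open>?t\<close> does not climb back. So \<open>v\<close> descends by one each time although
      it has height 0.\<close>
    define v where "v = w1 \<otimes>\<^bsub>F3\<^esub> (wt \<otimes>\<^bsub>F3\<^esub> u \<otimes>\<^bsub>F3\<^esub> inv\<^bsub>F3\<^esub> wt)"
    have v: "v \<in> carrier F3" using Wc w1(1) u(1) by (simp add: v_def)
    have v0: "fst (to_hall v) = 0"
      using Wc[OF w1(1)] Wc[OF u(1)] W0[OF w1(1)] W0[OF u(1)]
      by (cases "to_hall w1"; cases "to_hall u") (simp add: v_def to_hall_gens inv_hall)
    have \<theta>v: "\<theta> v (\<tau> ?o, n + 1) = (\<tau> ?o, n)" for n
    proof -
      have "\<theta> v = \<theta> w1 \<otimes>\<^bsub>?P\<^esub> (?t \<otimes>\<^bsub>?P\<^esub> \<theta> u \<otimes>\<^bsub>?P\<^esub> inv\<^bsub>?P\<^esub> ?t)"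
        using Wc w1(1) u(1) by (simp add: v_def \<theta>_t)
      moreover have "\<theta> w1 = ?L (\<tau> ?o \<otimes>\<^bsub>?Q\<^esub> inv\<^bsub>?Q\<^esub> \<tau> g)" "\<theta> u = ?L g"
        using \<theta>_window w1 u by simp_all
      moreover have "(inv\<^bsub>?P\<^esub> ?t) (\<tau> ?o, n + 1) = (?o, n)"
      proof -
        have "(inv\<^bsub>?P\<^esub> ?t \<otimes>\<^bsub>?P\<^esub> ?t) (?o, n) = (?o, n)"
          unfolding P.l_inv[OF t_in] by (simp add: bij_group_def)
        moreover have "?t (?o, n) = (\<tau> ?o, n + 1)"
          using subgroup.one_closed[OF C(2)] B.one_closed by (simp add: sheet_shift_def)
        ultimately show ?thesis by (simp add: bij_group_def)
      qed
      ultimately show ?thesis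
        using g \<tau>B[OF g(1)] \<tau>B[OF B.one_closed] B.one_closed C(1)
        by (simp add: bij_group_def sheet_mult_def sheet_shift_def \<rho>.H.m_assoc)
    qed
    have "v \<otimes>\<^bsub>F3\<^esub> v \<otimes>\<^bsub>F3\<^esub> (v \<otimes>\<^bsub>F3\<^esub> v) \<in> kernel F3 ?P \<theta>"
      using fourth_power_trivial[OF v v0] ker M_ker by blast
    then have "\<theta> v \<otimes>\<^bsub>?P\<^esub> \<theta> v \<otimes>\<^bsub>?P\<^esub> (\<theta> v \<otimes>\<^bsub>?P\<^esub> \<theta> v) = \<one>\<^bsub>?P\<^esub>"
      using v by (simp add: kernel_def)
    \<comment> \<open>Four descents lead from sheet 4 to sheet 0, whereas the fourth power acts
      trivially.\<close>
    then have "\<theta> v (\<theta> v (\<theta> v (\<theta> v (\<tau> ?o, 4)))) = (\<tau> ?o, 4)"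
      by (simp add: bij_group_def fun_eq_iff)
    then show ?thesis using \<theta>v[of 3] \<theta>v[of 2] \<theta>v[of 1] \<theta>v[of 0] by simp
  qed
qed

section \<open>The reduction\<close>

lemma power2_times_odd_inject:
  fixes a b :: int
  assumes "2 ^ n * a = 2 ^ m * b" "odd a" "odd b"
  shows "n = m \<and> a = b"
proof -
  have aux: "n \<ge> m" if "2 ^ n * a = 2 ^ m * b" "odd a" for n m and a b :: int
  proof (rule ccontr)
    assume "\<not> n \<ge> m"
    then have "(2 :: int) ^ m = 2 ^ n * (2 * 2 ^ (m - n - 1))"
      by (simp flip: power_Suc power_add)
    then have "a = 2 * 2 ^ (m - n - 1) * b" using that(1) by (simp add: mult.assoc)
    then show False using that(2) by simp
  qed
  have "n = m" using aux[OF assms(1,2)] aux[OF assms(1)[symmetric] assms(3)] by simp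
  then show ?thesis using assms(1) by simp
qed

text \<open>The exponents of column \<open>n\<close> have 2-adic valuation \<open>n\<close>, which keeps the columns apart, and tend
  to \<open>2 ^ n\<close> profinitely. The columns accumulate 2-adically at \<open>0\<close>, so \<open>0\<close> is always killed.\<close>

definition column_exponent :: "nat \<Rightarrow> nat \<Rightarrow> int" where
  "column_exponent n p = 2 ^ n * (1 + 2 * fact (Suc p))"

definition killed_exponents :: "(nat \<Rightarrow> nat set) \<Rightarrow> int set" where
  "killed_exponents E = insert 0 {column_exponent n p |n p. p \<in> E n}"

lemma column_exponent_inject: "column_exponent n p = column_exponent m q \<longleftrightarrow> n = m \<and> p = q"
proof
  assume "column_exponent n p = column_exponent m q"
  then have "n = m \<and> (1 + 2 * fact (Suc p) :: int) = 1 + 2 * fact (Suc q)"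
    unfolding column_exponent_def by (rule power2_times_odd_inject) simp_all
  then have nm: "n = m" and "fact (Suc p) = (fact (Suc q) :: int)" by (simp_all del: fact_Suc)
  then have "fact (Suc p) = (fact (Suc q) :: nat)" by (metis of_nat_eq_iff of_nat_fact)
  \<comment> \<open>\<open>Suc\<close> keeps the arguments positive, where the factorial is strictly
    increasing; \<open>fact 0 = fact 1\<close> would identify two exponents of a column.\<close>
  then have "p = q"
    using fact_less_mono[of "Suc p" "Suc q"] fact_less_mono[of "Suc q" "Suc p"]
    by (metis Suc_less_eq less_irrefl linorder_neqE_nat zero_less_Suc)
  with nm show "n = m \<and> p = q" by simp
qed simp

lemma column_exponent_nonzero: "column_exponent n p \<noteq> 0"
proof -
  have "(fact (Suc p) :: int) > 0" by (rule fact_gt_zero)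
  then have "1 + 2 * fact (Suc p) \<noteq> (0 :: int)" by linarith
  then show ?thesis by (simp add: column_exponent_def del: fact_Suc)
qed

text \<open>The limit of a column must survive for its loss to be visible in quotients. Its odd part
  is 1, while every column exponent has an odd part exceeding 1.\<close>

lemma power2_notin_killed_exponents: "2 ^ n \<notin> killed_exponents E"
proof
  assume "2 ^ n \<in> killed_exponents E"
  then obtain m p where "(2 :: int) ^ n * 1 = 2 ^ m * (1 + 2 * fact (Suc p))"
    by (auto simp: killed_exponents_def column_exponent_def simp del: fact_Suc)
  then have "(1 :: int) = 1 + 2 * fact (Suc p)"
    using power2_times_odd_inject by (metis even_add even_mult_iff even_numeral odd_one)
  moreover have "(fact (Suc p) :: int) > 0" by (rule fact_gt_zero)
  ultimately show False by simp
qed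

text \<open>Some \<open>2 ^ r0\<close> does not divide \<open>i\<close>, so \<open>0\<close> and all
  columns from \<open>r0\<close> on stay away from \<open>i\<close> modulo \<open>2 ^ r0\<close>.
  The earlier columns contribute only finitely many exponents.\<close>

lemma killed_exponents_closed:
  assumes fin: "\<And>n. finite (E n)" and i: "i \<notin> killed_exponents E"
  shows "\<exists>r :: nat. \<forall>k \<in> killed_exponents E. \<not> 2 ^ r dvd k - i"
proof -
  have "i \<noteq> 0" using i by (auto simp: killed_exponents_def)
  then obtain r0 :: nat where r0: "\<And>r. r0 \<le> r \<Longrightarrow> \<not> 2 ^ r dvd i"
    using finite_2adic_separation[of "{i}" 0] by (metis diff_0_right finite.emptyI finite.insertI insertI1)
  let ?S = "\<Union>n<r0. column_exponent n ` E n"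
  obtain r1 :: nat where r1: "\<And>s r. s \<in> ?S \<Longrightarrow> r1 \<le> r \<Longrightarrow> s \<noteq> i \<Longrightarrow> \<not> 2 ^ r dvd s - i"
  proof -
    have "finite ?S" using fin by simp
    from finite_2adic_separation[OF this, of i] show ?thesis using that by metis
  qed
  define r where "r = max r0 r1"
  have "\<not> 2 ^ r dvd k - i" if k: "k \<in> killed_exponents E" for k
  proof
    assume dvd: "2 ^ r dvd k - i"
    have "(2 :: int) ^ r0 dvd 2 ^ r" by (rule le_imp_power_dvd) (simp add: r_def)
    then have dvd0: "2 ^ r0 dvd k - i" using dvd by (rule dvd_trans)
    consider "k = 0" | n p where "p \<in> E n" "k = column_exponent n p"
      using k by (auto simp: killed_exponents_def)
    then show False
    proof cases
      case 1
      then show ?thesis using dvd0 r0[of r0] by simp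
    next
      case 2
      show ?thesis
      proof (cases "n < r0")
        case True
        then have "k \<in> ?S" using 2 by blast
        moreover have "k \<noteq> i" using k i by blast
        ultimately show ?thesis using r1[of k r] dvd by (simp add: r_def)
      next
        case False
        then have "2 ^ r0 dvd k"
          unfolding 2(2) column_exponent_def by (intro dvd_mult2 le_imp_power_dvd) simp
        then have "2 ^ r0 dvd k - (k - i)" using dvd0 by (rule dvd_diff)
        then show ?thesis using r0[of r0] by simp
      qed
    qed
  qed
  then show ?thesis by blast
qed

text \<open>An infinite column contains some \<open>p \<ge> d\<close>. Then \<open>d\<close> divides
  \<open>fact (Suc p)\<close>, so a killed exponent of this column is congruent to
  \<open>2 ^ n\<close> modulo the period.\<close>

lemma central_word_in_periodic:
  assumes inf: "infinite (E n)" and M: "M \<lhd> F3" "hall_relations (killed_exponents E) \<subseteq> M"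
    and per: "\<exists>d>0. \<exists>v \<in> M. \<exists>h. to_hall v = (0, 0, X d - 1, h)"
  shows "central_word (2 ^ n) \<in> M"
proof -
  obtain d v h where d: "d > 0" and v: "v \<in> M" "to_hall v = (0, 0, X d - 1, h)" using per by blast
  obtain p where p: "p \<in> E n" "nat d \<le> p" using inf by (metis infinite_nat_iff_unbounded_le)
  have "nat d dvd fact (Suc p)" using d p(2) by (intro dvd_fact) auto
  then have "int (nat d) dvd int (fact (Suc p))" by (simp only: of_nat_dvd_iff)
  then have "d dvd fact (Suc p)" using d by (simp del: fact_Suc)
  then have "d dvd 2 ^ Suc n * fact (Suc p)" by (rule dvd_mult)
  then obtain q where q: "2 ^ Suc n * fact (Suc p) = d * q" by (rule dvdE)
  \<comment> \<open>\<open>central_word_mem\<close> counts periods by a natural number, so the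
    quotient must not be negative.\<close>
  have "d * q > 0" unfolding q[symmetric] by (intro mult_pos_pos fact_gt_zero) simp
  then have "q > 0" using d by (simp add: zero_less_mult_iff)
  then have "column_exponent n p = 2 ^ n + d * int (nat q)"
    using q by (simp add: column_exponent_def distrib_left del: fact_Suc)
  moreover have "column_exponent n p \<in> killed_exponents E" using p(1) by (auto simp: killed_exponents_def)
  ultimately show ?thesis using central_word_mem[OF M v, of "2 ^ n" "nat q"] by simp
qed

lemma central_word_notin: "central_word (2 ^ n) \<in> carrier F3 - hall_relations (killed_exponents E)"
  using power2_notin_killed_exponents[of n E] central_word_closed
  by (simp add: hall_relations_def to_hall_central_word)

lemma hall_relations_mono: "K \<subseteq> L \<Longrightarrow> hall_relations K \<subseteq> hall_relations L"
  unfolding hall_relations_def by blast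

definition column_relations :: "(nat \<Rightarrow> nat set) \<Rightarrow> word set" where
  "column_relations E = hall_relations (killed_exponents E)"

lemma column_relations_normal: "column_relations E \<lhd> F3"
  unfolding column_relations_def by (rule hall_relations_normal)

section \<open>Correctness and continuity of the reduction\<close>

text \<open>\<open>weak\<close> and \<open>strong\<close> bracket the three classes: each contains
  the quotients that are both finite and nilpotent, which suffice to separate points, and each
  forces the periodicity by which an infinite column kills
  \<open>central_word (2 ^ n)\<close>.\<close>

lemma residually_column_quotient_iff:
  assumes P: "P (F3 Mod column_relations E) \<longleftrightarrow>
      (\<forall>w \<in> carrier F3 - column_relations E. \<exists>M. M \<lhd> F3 \<and> column_relations E \<subseteq> M \<and> w \<notin> M \<and> D M)"
    and weak: "\<And>M. M \<lhd> F3 \<Longrightarrow> finite (carrier (F3 Mod M)) \<Longrightarrow> \<exists>c. lower_central F3 c \<subseteq> M \<Longrightarrow> D M"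
    and strong: "\<And>M. \<lbrakk>M \<lhd> F3; hall_relations {} \<subseteq> M; D M\<rbrakk> \<Longrightarrow> \<exists>d>0. \<exists>v \<in> M. \<exists>h. to_hall v = (0, 0, X d - 1, h)"
  shows "P (F3 Mod column_relations E) \<longleftrightarrow> (\<forall>n. finite (E n))"
proof
  assume res: "P (F3 Mod column_relations E)"
  show "\<forall>n. finite (E n)"
  proof (rule ccontr)
    assume "\<not> (\<forall>n. finite (E n))"
    then obtain n where n: "infinite (E n)" by blast
    obtain M where M: "M \<lhd> F3" "column_relations E \<subseteq> M" "central_word (2 ^ n) \<notin> M" "D M"
      using res central_word_notin[of n E] unfolding P by (auto simp: column_relations_def)
    have "hall_relations {} \<subseteq> M"
      using M(2) hall_relations_mono[of "{}" "killed_exponents E"] by (auto simp: column_relations_def)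
    then have "central_word (2 ^ n) \<in> M"
      using central_word_in_periodic[of E n M] n M(1) strong[OF M(1) _ M(4)] M(2) by (simp add: column_relations_def)
    then show False using M(3) by blast
  qed
next
  assume "\<forall>n. finite (E n)"
  then show "P (F3 Mod column_relations E)"
    unfolding P using hall_quotient_residually[OF killed_exponents_closed[of E]] weak
    unfolding column_relations_def by blast
qed

lemma residually_finite_column_quotient:
  "residually finite_group (F3 Mod column_relations E) \<longleftrightarrow> (\<forall>n. finite (E n))"
proof (rule residually_column_quotient_iff[where P = "residually finite_group" and D = "\<lambda>M. finite (carrier (F3 Mod M))",
      OF residually_finite_iff[OF column_relations_normal]])
  fix M assume "M \<lhd> F3" "hall_relations {} \<subseteq> M" "finite (carrier (F3 Mod M))"
  then show "\<exists>d>0. \<exists>v \<in> M. \<exists>h. to_hall v = (0, 0, X d - 1, h)"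
    using finite_index_normally_finitely_generated normally_finitely_generated_periodic by blast
qed

lemma residually_nilpotent_column_quotient:
  "residually nilpotent_group (F3 Mod column_relations E) \<longleftrightarrow> (\<forall>n. finite (E n))"
  by (rule residually_column_quotient_iff[where P = "residually nilpotent_group" and D = "\<lambda>M. \<exists>c. lower_central F3 c \<subseteq> M",
      OF residually_nilpotent_iff[OF column_relations_normal]])
    (use nilpotent_periodic in blast)+

lemma residually_finitely_presentable_column_quotient:
  "residually finitely_presentable (F3 Mod column_relations E) \<longleftrightarrow> (\<forall>n. finite (E n))"
  by (rule residually_column_quotient_iff[where P = "residually finitely_presentable" and D = "normally_finitely_generated F3",
      OF residually_finitely_presentable_iff[OF column_relations_normal]])
    (use finite_index_normally_finitely_generated normally_finitely_generated_periodic in blast)+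

text \<open>Whether \<open>w\<close> is a relation depends on the finitely many exponents of its
  central entry, and whether an exponent is killed depends on at most one clopen
  \<open>V n p\<close>, as distinct pairs give distinct exponents.\<close>

lemma continuous_map_column_relations:
  assumes V: "\<And>n p. openin Y (V n p)" "\<And>n p. closedin Y (V n p)"
  shows "continuous_map Y marked_groups (\<lambda>y. marked_point 3 (column_relations (\<lambda>n. {p. y \<in> V n p})))"
proof (rule continuous_map_marked_point)
  let ?K = "\<lambda>y. killed_exponents (\<lambda>n. {p. y \<in> V n p})"
  have K: "openin Y {y \<in> topspace Y. k \<in> ?K y} \<and> closedin Y {y \<in> topspace Y. k \<in> ?K y}" for k
  proof -
    consider "k = 0" | n p where "k = column_exponent n p" | "k \<noteq> 0" "\<And>n p. k \<noteq> column_exponent n p" by blast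
    then show ?thesis
    proof cases
      case 1
      then show ?thesis by (simp add: killed_exponents_def)
    next
      case (2 n p)
      have "{y \<in> topspace Y. k \<in> ?K y} = V n p"
        using openin_subset[OF V(1)] 2 column_exponent_nonzero
        by (auto simp: killed_exponents_def column_exponent_inject)
      then show ?thesis using V by simp
    next
      case 3
      then have "{y \<in> topspace Y. k \<in> ?K y} = {}" by (auto simp: killed_exponents_def)
      then show ?thesis by (simp only: openin_empty closedin_empty simp_thms)
    qed
  qed
  fix w assume w: "w \<in> carrier F3"
  let ?U = "{y \<in> topspace Y. w \<in> column_relations (\<lambda>n. {p. y \<in> V n p})}"
  have "openin Y ?U \<and> closedin Y ?U"
  proof (cases "\<exists>h. to_hall w = (0, 0, 0, h)")
    case True
    then obtain h where h: "to_hall w = (0, 0, 0, h)" by blast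
    \<comment> \<open>For \<open>h = 0\<close> the index set is empty, and intersecting with the
      space keeps the result inside it.\<close>
    have "?U = topspace Y \<inter> (\<Inter>k \<in> Poly_Mapping.keys h. {y \<in> topspace Y. k \<in> ?K y})"
      using w h by (auto simp: column_relations_def hall_relations_def)
    moreover have "openin Y (topspace Y \<inter> (\<Inter>k \<in> Poly_Mapping.keys h. {y \<in> topspace Y. k \<in> ?K y}))"
      by (rule openin_Int_Inter) (use K in auto)
    moreover have "closedin Y (\<Inter>(insert (topspace Y) ((\<lambda>k. {y \<in> topspace Y. k \<in> ?K y}) ` Poly_Mapping.keys h)))"
      by (rule closedin_Inter) (use K in auto)
    ultimately show ?thesis by simp
  next
    case False
    then have "?U = {}" by (auto simp: column_relations_def hall_relations_def)
    then show ?thesis by (simp only: openin_empty closedin_empty simp_thms)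
  qed
  moreover have "{y \<in> topspace Y. w \<notin> column_relations (\<lambda>n. {p. y \<in> V n p})} = topspace Y - ?U" by blast
  ultimately show "openin Y ?U \<and> openin Y {y \<in> topspace Y. w \<notin> column_relations (\<lambda>n. {p. y \<in> V n p})}"
    by (simp add: closedin_def)
qed (rule column_relations_normal)

lemma pi0_complete_in_3_marked_groups:
  assumes pi0: "pi0_in marked_groups 3 (marked_groups_with P)"
    and red: "\<And>E. P (F3 Mod column_relations E) \<longleftrightarrow> (\<forall>n. finite (E n))"
  shows "pi0_complete_in TYPE('y) marked_groups 3 (marked_groups_with P)"
  unfolding pi0_complete_in_def
proof (intro conjI allI impI pi0)
  fix Y :: "'y topology" and B assume Y: "zero_dim_polish_space Y \<and> pi0_in Y 3 B"
  obtain V :: "nat \<Rightarrow> nat \<Rightarrow> 'y set" where V: "\<And>n p. openin Y (V n p)" "\<And>n p. closedin Y (V n p)"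
      "B = {y \<in> topspace Y. \<forall>n. finite {p. y \<in> V n p}}"
    using pi0_in_3_clopens[of Y B] Y by blast
  let ?f = "\<lambda>y. marked_point 3 (column_relations (\<lambda>n. {p. y \<in> V n p}))"
  have "?f y \<in> marked_groups_with P \<longleftrightarrow> (\<forall>n. finite {p. y \<in> V n p})" for y
  proof -
    let ?N = "column_relations (\<lambda>n. {p. y \<in> V n p})"
    have "?f y \<in> marked_groups_with P \<longleftrightarrow> P (F3 Mod ?N)"
    proof
      assume "?f y \<in> marked_groups_with P"
      then obtain k N where N: "marked_point 3 ?N = marked_point k N" "N \<lhd> free_group k" "P (free_group k Mod N)"
        unfolding marked_groups_with_def by blast
      then have "3 = k \<and> ?N = N" using marked_point_inject[OF column_relations_normal N(2,1)] by simp
      then show "P (F3 Mod ?N)" using N(3) by blast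
    next
      assume "P (F3 Mod ?N)"
      then show "?f y \<in> marked_groups_with P"
        unfolding marked_groups_with_def using column_relations_normal by blast
    qed
    then show ?thesis using red by simp
  qed
  then have "B = {y \<in> topspace Y. ?f y \<in> marked_groups_with P}" using V(3) by simp
  then show "\<exists>f. continuous_map Y marked_groups f \<and> B = {y \<in> topspace Y. f y \<in> marked_groups_with P}"
    using continuous_map_column_relations[of Y V] V(1,2) by blast
qed

theorem theorem8:
  "pi0_complete_in TYPE('y) marked_groups 3
     (marked_groups_with (residually finite_group)) \<and>
   pi0_complete_in TYPE('y) marked_groups 3
     (marked_groups_with (residually nilpotent_group)) \<and>
   pi0_complete_in TYPE('y) marked_groups 3
     (marked_groups_with (residually finitely_presentable))"
proof (intro conjI pi0_complete_in_3_marked_groups)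
  show "pi0_in marked_groups 3 (marked_groups_with (residually finite_group))"
    by (rule pi0_in_3_residually[OF residually_finite_iff finite_index_normally_finitely_generated])
  show "pi0_in marked_groups 3 (marked_groups_with (residually finitely_presentable))"
    by (rule pi0_in_3_residually[OF residually_finitely_presentable_iff])
qed (rule pi0_in_3_residually_nilpotent residually_finite_column_quotient
    residually_nilpotent_column_quotient residually_finitely_presentable_column_quotient)+

end
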